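(* Let $(M,g,J)$ be an almost Hermitian $4$-manifold with $\mathrm{supp}(W_+)=M$. Then $(M,g,J)$ is Kähler if and only if it satisfies the condition $$|W_+|^2=\frac38\Big(S_\star-\frac S3\Big)^2$$ on $M$ and the condition $$\delta W_++\nabla\log|W_+|\lrcorner W_+=0$$ on $M_+=\{x\in M:W_+(x)\neq0\}$.
   Context: Almost Hermitian $4$-manifold: a smooth Riemannian manifold $(M,g)$ of real dimension $4$ with an endomorphism field $J$ of $TM$ satisfying $J^2=-1$, $J^*=-J$. Its fundamental form is $\Omega(X,Y)=g(JX,Y)$ and it is oriented by the volume form $\omega=\frac12\Omega\wedge\Omega$. It is Kähler if $\nabla J=0$, where $\nabla$ is the Levi-Civita connection. $(X_k)$ denotes a local orthonormal frame; repeated indices are summed. $R(X,Y)Z=\nabla^2_{X,Y}Z-\nabla^2_{Y,X}Z$ with $\nabla^2_{X,Y}=\nabla_X\circ\nabla_Y-\nabla_{\nabla_XY}$; $\mathrm{Ric}(X)=R(X,X_k)X_k$; $S=\mathrm{tr}(\mathrm{Ric})$; $\mathrm{Ric}_\star(X)=R(JX,JX_k)X_k$; $S_\star=\mathrm{tr}(\mathrm{Ric}_\star)$. Skew-symmetric endomorphisms $A$ of $TM$ are identified with $2$-forms via $\Omega_A(X,Y)=g(AX,Y)$, with scalar product $\langle A,B\rangle=\frac14\mathrm{tr}(A^*\circ B)$. The Weyl tensor $W$ (the totally trace-free part of $R$) acts on them by $W(A)=W(AX_k,X_k)$; it preserves the bundle $\Lambda^2_+$ of self-dual $2$-forms, and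 $W_+:\Lambda^2_+\to\Lambda^2_+$ is its restriction (extended by $0$ to anti-self-dual forms). $|W_+|^2=\mathrm{tr}(W_+\circ W_+)$. $\mathrm{supp}(W_+)=M$ means that $M_+$ is dense in $M$. With $(g(Y)\otimes X)(Z)=g(Y,Z)X$: $W_+(X,Y)=\frac12W_+(g(Y)\otimes X-g(X)\otimes Y)$; $(X\lrcorner W_+)(Y)=W_+(X,Y)$; and $\delta W_+(X)=\frac12(\nabla_{X_k}W_+)(g(X_k)\otimes X-g(X)\otimes X_k)$, i.e. $\delta W_+(X)=(\nabla_{X_k}W_+)(X,X_k)$. *)

theory Defs
  imports "HOL-Analysis.Analysis"
begin

section \<open>Smooth functions on open subsets of Euclidean space\<close>

primrec Ck_on :: "nat \<Rightarrow> 'a::euclidean_space set \<Rightarrow> ('a \<Rightarrow> 'b::real_normed_vector) \<Rightarrow> bool" where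
  "Ck_on 0 S f \<longleftrightarrow> continuous_on S f"
| "Ck_on (Suc k) S f \<longleftrightarrow> (\<forall>x\<in>S. f differentiable (at x)) \<and>
     (\<forall>v. Ck_on k S (\<lambda>x. frechet_derivative f (at x) v))"

definition smooth_on :: "'a::euclidean_space set \<Rightarrow> ('a \<Rightarrow> 'b::real_normed_vector) \<Rightarrow> bool" where
  "smooth_on S f \<longleftrightarrow> (\<forall>k. Ck_on k S f)"

section \<open>Trace of an endomorphism of a finite-dimensional subspace\<close>

definition trace_on :: "'a::real_vector set \<Rightarrow> ('a \<Rightarrow> 'a) \<Rightarrow> real" where
  "trace_on V T = (let B = (SOME B. independent B \<and> span B = V)
                   in \<Sum>b\<in>B. representation B (T b) b)"

section \<open>Local tensor calculus\<close>

text \<open>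
  In this section everything lives on an open set of real 4-space, the image of a chart.
  Vector fields and endomorphism fields are given by their components with respect to the
  coordinate fields, so they have values in \<open>real^4\<close> and \<open>real^4^4\<close>, and a metric is given by its
  Gram matrix.  Expressions that are tensorial in their vector arguments are evaluated
  on constant (coordinate) fields.
\<close>

type_synonym point = "real^4"
type_synonym vfield = "point \<Rightarrow> real^4"
type_synonym mfield = "point \<Rightarrow> real^4^4"

subsection \<open>Linear algebra in a single tangent space\<close>

definition inn :: "real^4^4 \<Rightarrow> real^4 \<Rightarrow> real^4 \<Rightarrow> real" where
  "inn G u v = u \<bullet> (G *v v)"

definition orthonormal_frame :: "real^4^4 \<Rightarrow> (4 \<Rightarrow> real^4) \<Rightarrow> bool" where
  "orthonormal_frame G e \<longleftrightarrow> (\<forall>i j. inn G (e i) (e j) = (if i = j then 1 else 0))"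

text \<open>
  The frame \<open>(X\<^sub>k)\<close> at a point; all the expressions below in which it is summed over do not depend
  on its choice.
\<close>

definition frame :: "real^4^4 \<Rightarrow> 4 \<Rightarrow> real^4" where
  "frame G = (SOME e. orthonormal_frame G e)"

definition skew :: "real^4^4 \<Rightarrow> (real^4^4) set" where
  "skew G = {A. \<forall>u v. inn G (A *v u) v = - inn G u (A *v v)}"

text \<open>The endomorphism \<open>g(Y) \<otimes> X\<close>, mapping \<open>Z\<close> to \<open>g(Y, Z) X\<close>.\<close>

definition tens :: "real^4^4 \<Rightarrow> real^4 \<Rightarrow> real^4 \<Rightarrow> real^4^4" where
  "tens G Y X = matrix (\<lambda>Z. inn G Y Z *\<^sub>R X)"

definition two_form :: "real^4^4 \<Rightarrow> real^4^4 \<Rightarrow> real^4 \<Rightarrow> real^4 \<Rightarrow> real" where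
  "two_form G A u v = inn G (A *v u) v"

text \<open>
  The volume form \<open>\<omega> = (\<Omega> \<and> \<Omega>) / 2\<close> with \<open>\<Omega>(X, Y) = g(J X, Y)\<close>; the wedge product of two
  2-forms is the sum over the six (2,2)-shuffles, which coincide in pairs here.
\<close>

definition vol :: "real^4^4 \<Rightarrow> real^4^4 \<Rightarrow> real^4 \<Rightarrow> real^4 \<Rightarrow> real^4 \<Rightarrow> real^4 \<Rightarrow> real" where
  "vol G J a b c d =
     two_form G J a b * two_form G J c d - two_form G J a c * two_form G J b d
     + two_form G J a d * two_form G J b c"

text \<open>The Hodge star operator on 2-forms, transported to endomorphisms.\<close>

definition star :: "real^4^4 \<Rightarrow> real^4^4 \<Rightarrow> real^4^4 \<Rightarrow> real^4^4" where
  "star G J A = (THE B. \<forall>u v. two_form G B u v =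
     1/2 * (\<Sum>k\<in>UNIV. \<Sum>l\<in>UNIV. two_form G A (frame G k) (frame G l) *
                                  vol G J (frame G k) (frame G l) u v))"

definition Lambda_plus :: "real^4^4 \<Rightarrow> real^4^4 \<Rightarrow> (real^4^4) set" where
  "Lambda_plus G J = {A \<in> skew G. star G J A = A}"

subsection \<open>The Levi-Civita connection and curvature\<close>

text \<open>
  The Christoffel map of the Levi-Civita connection: the unique symmetric (i.e. torsion-free) one
  that is compatible with the metric.
\<close>

definition christoffel :: "mfield \<Rightarrow> point \<Rightarrow> real^4 \<Rightarrow> real^4 \<Rightarrow> real^4" where
  "christoffel g x = (THE \<Gamma>. bilinear \<Gamma> \<and> (\<forall>u v. \<Gamma> u v = \<Gamma> v u) \<and>
     (\<forall>u v w. frechet_derivative (\<lambda>y. inn (g y) v w) (at x) u =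
              inn (g x) (\<Gamma> u v) w + inn (g x) v (\<Gamma> u w)))"

definition nabla :: "mfield \<Rightarrow> vfield \<Rightarrow> vfield \<Rightarrow> vfield" where
  "nabla g X Y = (\<lambda>x. frechet_derivative Y (at x) (X x) + christoffel g x (X x) (Y x))"

definition nabla2 :: "mfield \<Rightarrow> vfield \<Rightarrow> vfield \<Rightarrow> vfield \<Rightarrow> vfield" where
  "nabla2 g X Y Z = (\<lambda>x. nabla g X (nabla g Y Z) x - nabla g (nabla g X Y) Z x)"

definition Riem :: "mfield \<Rightarrow> point \<Rightarrow> real^4 \<Rightarrow> real^4 \<Rightarrow> real^4 \<Rightarrow> real^4" where
  "Riem g x u v w = nabla2 g (\<lambda>_. u) (\<lambda>_. v) (\<lambda>_. w) x - nabla2 g (\<lambda>_. v) (\<lambda>_. u) (\<lambda>_. w) x"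

definition Ric :: "mfield \<Rightarrow> point \<Rightarrow> real^4 \<Rightarrow> real^4" where
  "Ric g x u = (\<Sum>k\<in>UNIV. Riem g x u (frame (g x) k) (frame (g x) k))"

definition scal :: "mfield \<Rightarrow> point \<Rightarrow> real" where
  "scal g x = trace (matrix (Ric g x))"

definition Ric_star :: "mfield \<Rightarrow> mfield \<Rightarrow> point \<Rightarrow> real^4 \<Rightarrow> real^4" where
  "Ric_star g J x u = (\<Sum>k\<in>UNIV. Riem g x (J x *v u) (J x *v frame (g x) k) (frame (g x) k))"

definition scal_star :: "mfield \<Rightarrow> mfield \<Rightarrow> point \<Rightarrow> real" where
  "scal_star g J x = trace (matrix (Ric_star g J x))"

text \<open>
  Covariant derivatives in the direction \<open>u\<close> at \<open>x\<close> of an endomorphism field, by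
  \<open>(\<nabla>\<^sub>X A) Y = \<nabla>\<^sub>X (A Y) - A (\<nabla>\<^sub>X Y)\<close>, and of a field of operators on endomorphisms, by
  \<open>(\<nabla>\<^sub>X T) A = \<nabla>\<^sub>X (T A) - T (\<nabla>\<^sub>X A)\<close>.
\<close>

definition nabla_end :: "mfield \<Rightarrow> mfield \<Rightarrow> point \<Rightarrow> real^4 \<Rightarrow> real^4^4" where
  "nabla_end g A x u = matrix (\<lambda>w. nabla g (\<lambda>_. u) (\<lambda>y. A y *v w) x
                                    - A x *v nabla g (\<lambda>_. u) (\<lambda>_. w) x)"

definition nabla_op ::
  "mfield \<Rightarrow> (point \<Rightarrow> real^4^4 \<Rightarrow> real^4^4) \<Rightarrow> point \<Rightarrow> real^4 \<Rightarrow> real^4^4 \<Rightarrow> real^4^4" where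
  "nabla_op g T x u A = nabla_end g (\<lambda>y. T y A) x u - T x (nabla_end g (\<lambda>_. A) x u)"

definition grad :: "mfield \<Rightarrow> (point \<Rightarrow> real) \<Rightarrow> vfield" where
  "grad g f x = (THE w. \<forall>v. inn (g x) w v = frechet_derivative f (at x) v)"

subsection \<open>The Weyl tensor and its self-dual part\<close>

text \<open>The totally trace-free part of the curvature tensor in dimension 4.\<close>

definition Weyl :: "mfield \<Rightarrow> point \<Rightarrow> real^4 \<Rightarrow> real^4 \<Rightarrow> real^4 \<Rightarrow> real^4" where
  "Weyl g x u v w = Riem g x u v w
     - (1/2) *\<^sub>R (inn (g x) v w *\<^sub>R Ric g x u - inn (g x) u w *\<^sub>R Ric g x v
               + inn (g x) (Ric g x v) w *\<^sub>R u - inn (g x) (Ric g x u) w *\<^sub>R v)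
     + (scal g x / 6) *\<^sub>R (inn (g x) v w *\<^sub>R u - inn (g x) u w *\<^sub>R v)"

definition Weyl_op :: "mfield \<Rightarrow> point \<Rightarrow> real^4^4 \<Rightarrow> real^4^4" where
  "Weyl_op g x A = matrix (\<lambda>w. \<Sum>k\<in>UNIV. Weyl g x (A *v frame (g x) k) (frame (g x) k) w)"

text \<open>
  \<open>W\<^sub>+\<close> is \<open>W\<close> on self-dual and 0 on anti-self-dual endomorphisms, hence \<open>W\<close> after the
  projection \<open>A \<mapsto> (A + *A) / 2\<close>.  On symmetric endomorphisms \<open>star\<close> and \<open>W\<close> are 0, so the
  formula extends \<open>W\<^sub>+\<close> by 0 to all endomorphisms.  As the bundle of skew endomorphisms is parallel,
  \<open>nabla_op\<close> applied to this extension restricts to the covariant derivative of \<open>W\<^sub>+\<close>.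
\<close>

definition Wp :: "mfield \<Rightarrow> mfield \<Rightarrow> point \<Rightarrow> real^4^4 \<Rightarrow> real^4^4" where
  "Wp g J x A = Weyl_op g x ((1/2) *\<^sub>R (A + star (g x) (J x) A))"

definition Wp_nonzero :: "mfield \<Rightarrow> mfield \<Rightarrow> point \<Rightarrow> bool" where
  "Wp_nonzero g J x \<longleftrightarrow> (\<exists>A \<in> skew (g x). Wp g J x A \<noteq> 0)"

definition Wp_sqnorm :: "mfield \<Rightarrow> mfield \<Rightarrow> point \<Rightarrow> real" where
  "Wp_sqnorm g J x = trace_on (Lambda_plus (g x) (J x)) (Wp g J x \<circ> Wp g J x)"

definition Wp_norm :: "mfield \<Rightarrow> mfield \<Rightarrow> point \<Rightarrow> real" where
  "Wp_norm g J x = sqrt (Wp_sqnorm g J x)"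

text \<open>\<open>W\<^sub>+(X, Y)\<close>, which is also the value at \<open>Y\<close> of the contraction of \<open>X\<close> with \<open>W\<^sub>+\<close>.\<close>

definition Wp_vec :: "mfield \<Rightarrow> mfield \<Rightarrow> point \<Rightarrow> real^4 \<Rightarrow> real^4 \<Rightarrow> real^4^4" where
  "Wp_vec g J x X Y = (1/2) *\<^sub>R Wp g J x (tens (g x) Y X - tens (g x) X Y)"

definition delta_Wp :: "mfield \<Rightarrow> mfield \<Rightarrow> point \<Rightarrow> real^4 \<Rightarrow> real^4^4" where
  "delta_Wp g J x X = (1/2) *\<^sub>R (\<Sum>k\<in>UNIV. nabla_op g (Wp g J) x (frame (g x) k)
     (tens (g x) (frame (g x) k) X - tens (g x) X (frame (g x) k)))"

section \<open>Almost Hermitian 4-manifolds\<close>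

text \<open>
  A chart is a coordinate domain together with a coordinate map, whose values outside the domain
  are irrelevant.  Tensor fields on the manifold are given by their components in all charts of a
  smooth atlas, subject to the tensor transformation law.
\<close>

type_synonym 'm chart = "'m set \<times> ('m \<Rightarrow> point)"

definition chart_image :: "'m chart \<Rightarrow> point set" where
  "chart_image c = snd c ` fst c"

definition transition :: "'m chart \<Rightarrow> 'm chart \<Rightarrow> point \<Rightarrow> point" where
  "transition c d = snd d \<circ> inv_into (fst c) (snd c)"

definition jacobian :: "'m chart \<Rightarrow> 'm chart \<Rightarrow> point \<Rightarrow> real^4^4" where
  "jacobian c d x = matrix (frechet_derivative (transition c d) (at x))"

definition charts_at :: "'m chart set \<Rightarrow> 'm \<Rightarrow> 'm chart set" where
  "charts_at A p = {c \<in> A. p \<in> fst c}"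

locale smooth_4_manifold =
  fixes M :: "'m topology" and A :: "'m chart set"
  assumes Hausdorff: "Hausdorff_space M"
    and second_countable: "second_countable M"
    and open_domain: "\<And>c. c \<in> A \<Longrightarrow> openin M (fst c)"
    and open_image: "\<And>c. c \<in> A \<Longrightarrow> open (chart_image c)"
    and homeomorphic: "\<And>c. c \<in> A \<Longrightarrow>
      homeomorphic_map (subtopology M (fst c)) (top_of_set (chart_image c)) (snd c)"
    and covering: "(\<Union>c\<in>A. fst c) = topspace M"
    and smooth_transition: "\<And>c d. c \<in> A \<Longrightarrow> d \<in> A \<Longrightarrow>
      smooth_on (snd c ` (fst c \<inter> fst d)) (transition c d)"

locale riemannian_4_manifold = smooth_4_manifold M A
  for M :: "'m topology" and A :: "'m chart set" +
  fixes g :: "'m chart \<Rightarrow> mfield"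
  assumes metric_smooth: "\<And>c. c \<in> A \<Longrightarrow> smooth_on (chart_image c) (g c)"
    and metric_sym: "\<And>c x u v. c \<in> A \<Longrightarrow> x \<in> chart_image c \<Longrightarrow>
      inn (g c x) u v = inn (g c x) v u"
    and metric_pos: "\<And>c x u. c \<in> A \<Longrightarrow> x \<in> chart_image c \<Longrightarrow> u \<noteq> 0 \<Longrightarrow> inn (g c x) u u > 0"
    and metric_transform: "\<And>c d x u v. c \<in> A \<Longrightarrow> d \<in> A \<Longrightarrow> x \<in> snd c ` (fst c \<inter> fst d) \<Longrightarrow>
      inn (g c x) u v =
      inn (g d (transition c d x)) (jacobian c d x *v u) (jacobian c d x *v v)"

locale almost_hermitian_4_manifold = riemannian_4_manifold M A g
  for M :: "'m topology" and A :: "'m chart set" and g :: "'m chart \<Rightarrow> mfield" +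
  fixes J :: "'m chart \<Rightarrow> mfield"
  assumes J_smooth: "\<And>c. c \<in> A \<Longrightarrow> smooth_on (chart_image c) (J c)"
    and J_square: "\<And>c x. c \<in> A \<Longrightarrow> x \<in> chart_image c \<Longrightarrow> J c x ** J c x = - mat 1"
    and J_skew: "\<And>c x. c \<in> A \<Longrightarrow> x \<in> chart_image c \<Longrightarrow> J c x \<in> skew (g c x)"
    and J_transform: "\<And>c d x u. c \<in> A \<Longrightarrow> d \<in> A \<Longrightarrow> x \<in> snd c ` (fst c \<inter> fst d) \<Longrightarrow>
      jacobian c d x *v (J c x *v u) = J d (transition c d x) *v (jacobian c d x *v u)"

text \<open>
  Equations between tensors at a point \<open>p\<close> are required in every chart around \<open>p\<close>; by the
  transformation law it does not matter which chart is used.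
\<close>

definition kaehler ::
  "'m topology \<Rightarrow> 'm chart set \<Rightarrow> ('m chart \<Rightarrow> mfield) \<Rightarrow> ('m chart \<Rightarrow> mfield) \<Rightarrow> bool" where
  "kaehler M A g J \<longleftrightarrow>
     (\<forall>p\<in>topspace M. \<forall>c\<in>charts_at A p. \<forall>u. nabla_end (g c) (J c) (snd c p) u = 0)"

definition M_plus ::
  "'m topology \<Rightarrow> 'm chart set \<Rightarrow> ('m chart \<Rightarrow> mfield) \<Rightarrow> ('m chart \<Rightarrow> mfield) \<Rightarrow> 'm set" where
  "M_plus M A g J = {p \<in> topspace M. \<exists>c\<in>charts_at A p. Wp_nonzero (g c) (J c) (snd c p)}"

end

theory Submission
  imports Defs
begin

text \<open>At a point, \<open>W\<^sub>+\<close> is a trace-free self-adjoint operator on the 3-dimensional space of self-dual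
  forms, in which \<open>J\<close> is a unit vector.  Put \<open>\<lambda> = \<langle>W\<^sub>+ J, J\<rangle>\<close>; the first Bianchi identity
  gives \<open>\<lambda> = (S\<^sub>\<star> - S / 3) / 2\<close>.  A trace-free symmetric matrix of order 3 with diagonal entry \<open>\<lambda>\<close>
  has square norm at least \<open>3 / 2 \<lambda>\<^sup>2\<close>, and equality forces it to be diagonal with entries
  \<open>\<lambda>, - \<lambda> / 2, - \<lambda> / 2\<close>.  So the first condition says exactly that \<open>W\<^sub>+ = \<lambda> Q\<close>, where
  \<open>Q A = 3 / 2 \<langle>J, A\<rangle> J - P A / 2\<close> and \<open>P\<close> is the projection to the self-dual forms
  (\<open>norm_condition_iff_Qf\<close>).

  On a Kaehler manifold the curvature endomorphisms \<open>R(X, Y)\<close> commute with \<open>J\<close>; the self-dual forms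
  that commute with \<open>J\<close> are the multiples of \<open>J\<close>, and this gives \<open>W\<^sub>+ = \<lambda> Q\<close>
  (\<open>norm_condition_if_commuting\<close>).

  Now let \<open>W\<^sub>+ = \<lambda> Q\<close>.  Then \<open>|W\<^sub>+|\<close> is a constant times \<open>|\<lambda>|\<close>, so in the second condition the terms
  that contain the derivative of \<open>\<lambda>\<close> cancel, and what remains is \<open>\<lambda>\<close> times the divergence of \<open>Q\<close>.
  The projection \<open>P\<close> is parallel, hence the derivative of \<open>Q\<close> comes from \<open>J \<otimes> J\<close> alone, and its
  divergence at \<open>X\<close> is a nonzero multiple of \<open>c(X) J + \<nabla>\<^bsub>JX\<^esub> J\<close> with a scalar \<open>c(X)\<close>
  (\<open>delta_formula\<close>).  The two summands are orthogonal, because \<open>J\<close> has constant length; so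
  the divergence vanishes if and only if \<open>\<nabla>J = 0\<close>.  Hence, under the first condition, the second one
  means that \<open>\<nabla>J\<close> vanishes on \<open>M\<^sub>+\<close>, and by continuity on the closure of \<open>M\<^sub>+\<close>, which is \<open>M\<close>.

  All of this happens in a single chart.  A point of \<open>M\<^sub>+\<close> is known to have \<open>W\<^sub>+ \<noteq> 0\<close> in some chart
  only, whereas the second condition is about all charts around it; this is bridged by the
  invariance of \<open>\<lambda>\<close> under changes of coordinates (\<open>lam_change\<close>).\<close>

section \<open>Calculus of smooth functions\<close>

lemma has_derivative_cong_open:
  assumes "open S" "x \<in> S" "\<And>y. y \<in> S \<Longrightarrow> f y = h y"
  shows "(f has_derivative D) (at x) \<longleftrightarrow> (h has_derivative D) (at x)"
  using assms(3) has_derivative_transform_within_open[OF _ assms(1,2), of f D UNIV h]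
    has_derivative_transform_within_open[OF _ assms(1,2), of h D UNIV f] by auto

lemma frechet_derivative_cong_open:
  assumes "open S" "x \<in> S" "\<And>y. y \<in> S \<Longrightarrow> f y = h y"
  shows "frechet_derivative f (at x) = frechet_derivative h (at x)"
  unfolding frechet_derivative_def using has_derivative_cong_open[OF assms] by simp

lemma differentiable_cong_open:
  assumes "open S" "x \<in> S" "\<And>y. y \<in> S \<Longrightarrow> f y = h y"
  shows "f differentiable (at x) \<longleftrightarrow> h differentiable (at x)"
  unfolding differentiable_def using has_derivative_cong_open[OF assms] by simp

text \<open>\<open>Ck_on\<close> speaks of derivatives at points of \<open>S\<close>; on an open set these only depend on the
  restriction to \<open>S\<close>, which allows replacing a field by any formula valid on the chart domain.\<close>

lemma Ck_on_cong:
  assumes "open S"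
  shows "(\<And>x. x \<in> S \<Longrightarrow> f x = h x) \<Longrightarrow> Ck_on k S f \<longleftrightarrow> Ck_on k S h"
proof (induction k arbitrary: f h)
  case 0
  then show ?case using continuous_on_cong[of S S f h] by simp
next
  case (Suc k)
  have "f differentiable (at x) \<longleftrightarrow> h differentiable (at x)" if "x \<in> S" for x
    using differentiable_cong_open[OF assms that] Suc.prems by blast
  moreover have "Ck_on k S (\<lambda>x. frechet_derivative f (at x) v) \<longleftrightarrow>
      Ck_on k S (\<lambda>x. frechet_derivative h (at x) v)" for v
    by (rule Suc.IH) (use frechet_derivative_cong_open[OF assms _ Suc.prems] in auto)
  ultimately show ?case by simp
qed

lemma Ck_on_SucI:
  assumes "open S" and D: "\<And>x. x \<in> S \<Longrightarrow> (f has_derivative D x) (at x)"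
    and C: "\<And>v. Ck_on k S (\<lambda>x. D x v)"
  shows "Ck_on (Suc k) S f"
proof -
  have eq: "frechet_derivative f (at x) = D x" if "x \<in> S" for x
    using frechet_derivative_at[OF D[OF that]] by simp
  have "Ck_on k S (\<lambda>x. frechet_derivative f (at x) v)" for v
    using Ck_on_cong[OF assms(1), of "\<lambda>x. frechet_derivative f (at x) v" "\<lambda>x. D x v" k] eq C by simp
  then show ?thesis using D by (auto simp: differentiable_def)
qed

lemma Ck_on_SucD:
  assumes "Ck_on (Suc k) S f" "x \<in> S"
  shows "(f has_derivative frechet_derivative f (at x)) (at x)"
  using assms by (simp add: frechet_derivative_works)

lemma Ck_on_Suc_imp: "Ck_on (Suc k) S f \<Longrightarrow> Ck_on k S f"
proof (induction k arbitrary: f)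
  case 0
  then show ?case
    by (simp add: continuous_at_imp_continuous_on differentiable_imp_continuous_within)
next
  case (Suc k)
  then show ?case by simp
qed

lemma Ck_on_const: "open S \<Longrightarrow> Ck_on k S (\<lambda>_. c)"
proof (induction k arbitrary: c)
  case (Suc k)
  show ?case by (rule Ck_on_SucI[OF Suc.prems has_derivative_const]) (use Suc in blast)
qed simp

lemma Ck_on_bounded_linear:
  assumes "open S" "bounded_linear L"
  shows "Ck_on k S f \<Longrightarrow> Ck_on k S (\<lambda>x. L (f x))"
proof (induction k arbitrary: f)
  case 0
  then show ?case using bounded_linear.continuous_on[OF assms(2)] by simp
next
  case (Suc k)
  show ?case
    by (rule Ck_on_SucI[OF assms(1) bounded_linear.has_derivative[OF assms(2) Ck_on_SucD[OF Suc.prems]]])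
      (use Suc in auto)
qed

lemma Ck_on_add:
  assumes "open S"
  shows "Ck_on k S f \<Longrightarrow> Ck_on k S h \<Longrightarrow> Ck_on k S (\<lambda>x. f x + h x)"
proof (induction k arbitrary: f h)
  case 0
  then show ?case by (simp add: continuous_on_add)
next
  case (Suc k)
  show ?case
    by (rule Ck_on_SucI[OF assms has_derivative_add[OF Ck_on_SucD[OF Suc.prems(1)] Ck_on_SucD[OF Suc.prems(2)]]])
      (use Suc in auto)
qed

lemma Ck_on_sum:
  assumes "open S" "\<And>i. i \<in> I \<Longrightarrow> Ck_on k S (f i)"
  shows "Ck_on k S (\<lambda>x. \<Sum>i\<in>I. f i x)"
  using assms(2)
proof (induction I rule: infinite_finite_induct)
  case (insert i I)
  then show ?case using Ck_on_add[OF assms(1), of k "f i" "\<lambda>x. \<Sum>i\<in>I. f i x"] by simp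
qed (simp_all add: Ck_on_const assms(1))

text \<open>The derivative of a product only involves products of functions of class \<open>C\<^sup>k\<close>, because a
  function of class \<open>C\<^bsup>k+1\<^esup>\<close> is itself of class \<open>C\<^sup>k\<close>.\<close>

lemma Ck_on_bilinear:
  assumes "open S" "bounded_bilinear B"
  shows "Ck_on k S f \<Longrightarrow> Ck_on k S h \<Longrightarrow> Ck_on k S (\<lambda>x. B (f x) (h x))"
proof (induction k arbitrary: f h)
  case 0
  then show ?case using bounded_bilinear.continuous_on[OF assms(2)] by simp
next
  case (Suc k)
  have "Ck_on k S (\<lambda>x. B (f x) (frechet_derivative h (at x) v) + B (frechet_derivative f (at x) v) (h x))" for v
    by (intro Ck_on_add[OF assms(1)] Suc.IH) (use Suc.prems Ck_on_Suc_imp in auto)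
  then show ?case
    by (intro Ck_on_SucI[OF assms(1) bounded_bilinear.FDERIV[OF assms(2) Ck_on_SucD[OF Suc.prems(1)] Ck_on_SucD[OF Suc.prems(2)]]])
qed

lemma Ck_on_inverse_real:
  fixes f :: "'a::euclidean_space \<Rightarrow> real"
  assumes "open S" "\<And>x. x \<in> S \<Longrightarrow> f x \<noteq> 0"
  shows "Ck_on k S f \<Longrightarrow> Ck_on k S (\<lambda>x. inverse (f x))"
proof (induction k)
  case 0
  then show ?case using assms(2) by (auto intro!: continuous_intros)
next
  case (Suc k)
  have "Ck_on k S (\<lambda>x. - (inverse (f x) * frechet_derivative f (at x) v * inverse (f x)))" for v
    by (intro Ck_on_bounded_linear[OF assms(1) bounded_linear_minus[OF bounded_linear_ident]]
          Ck_on_bilinear[OF assms(1) bounded_bilinear_mult] Suc.IH)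
      (use Suc.prems Ck_on_Suc_imp in auto)
  then show ?case
    by (intro Ck_on_SucI[OF assms(1) Deriv.has_derivative_inverse[OF assms(2) Ck_on_SucD[OF Suc.prems]]])
qed

lemma smooth_on_const: "open S \<Longrightarrow> smooth_on S (\<lambda>_. c)"
  by (simp add: smooth_on_def Ck_on_const)

lemma smooth_on_add: "open S \<Longrightarrow> smooth_on S f \<Longrightarrow> smooth_on S h \<Longrightarrow> smooth_on S (\<lambda>x. f x + h x)"
  by (simp add: smooth_on_def Ck_on_add)

lemma smooth_on_bounded_linear:
  "open S \<Longrightarrow> bounded_linear L \<Longrightarrow> smooth_on S f \<Longrightarrow> smooth_on S (\<lambda>x. L (f x))"
  by (simp add: smooth_on_def Ck_on_bounded_linear)

lemma smooth_on_bilinear: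
  "open S \<Longrightarrow> bounded_bilinear B \<Longrightarrow> smooth_on S f \<Longrightarrow> smooth_on S h \<Longrightarrow>
    smooth_on S (\<lambda>x. B (f x) (h x))"
  by (simp add: smooth_on_def Ck_on_bilinear)

lemma smooth_on_sum:
  "open S \<Longrightarrow> (\<And>i. i \<in> I \<Longrightarrow> smooth_on S (f i)) \<Longrightarrow> smooth_on S (\<lambda>x. \<Sum>i\<in>I. f i x)"
  by (simp add: smooth_on_def Ck_on_sum)

lemma smooth_on_diff:
  "open S \<Longrightarrow> smooth_on S f \<Longrightarrow> smooth_on S h \<Longrightarrow> smooth_on S (\<lambda>x. f x - h x)"
  using smooth_on_add[of S f "\<lambda>x. - h x"]
    smooth_on_bounded_linear[OF _ bounded_linear_minus[OF bounded_linear_ident], of S h] by simp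

lemma smooth_on_inverse_real:
  fixes f :: "'a::euclidean_space \<Rightarrow> real"
  shows "open S \<Longrightarrow> (\<And>x. x \<in> S \<Longrightarrow> f x \<noteq> 0) \<Longrightarrow> smooth_on S f \<Longrightarrow> smooth_on S (\<lambda>x. inverse (f x))"
  by (simp add: smooth_on_def Ck_on_inverse_real)

lemma smooth_on_prod:
  fixes f :: "'i \<Rightarrow> 'a::euclidean_space \<Rightarrow> real"
  assumes "open S" "\<And>i. i \<in> I \<Longrightarrow> smooth_on S (f i)"
  shows "smooth_on S (\<lambda>x. \<Prod>i\<in>I. f i x)"
  using assms(2)
proof (induction I rule: infinite_finite_induct)
  case (insert i I)
  then show ?case
    using smooth_on_bilinear[OF assms(1) bounded_bilinear_mult, of "f i" "\<lambda>x. \<Prod>i\<in>I. f i x"] by simp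
qed (simp_all add: smooth_on_const assms(1))

lemma smooth_on_cong:
  "open S \<Longrightarrow> (\<And>x. x \<in> S \<Longrightarrow> f x = h x) \<Longrightarrow> smooth_on S f \<Longrightarrow> smooth_on S h"
  using Ck_on_cong[of S f h] by (simp add: smooth_on_def)

lemma smooth_on_differentiable: "smooth_on S f \<Longrightarrow> x \<in> S \<Longrightarrow> f differentiable (at x)"
  unfolding smooth_on_def using Ck_on.simps(2) by blast

lemma smooth_on_has_derivative:
  "smooth_on S f \<Longrightarrow> x \<in> S \<Longrightarrow> (f has_derivative frechet_derivative f (at x)) (at x)"
  using smooth_on_differentiable frechet_derivative_works by blast

lemma smooth_on_frechet_derivative:
  "smooth_on S f \<Longrightarrow> smooth_on S (\<lambda>x. frechet_derivative f (at x) v)"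
  unfolding smooth_on_def using Ck_on.simps(2) by blast

lemma smooth_on_subset:
  assumes "smooth_on S f" "T \<subseteq> S" shows "smooth_on T f"
proof -
  have "Ck_on k S f \<Longrightarrow> Ck_on k T f" for k
    using assms(2) by (induction k arbitrary: f) (auto intro: continuous_on_subset)
  then show ?thesis using assms(1) by (simp add: smooth_on_def)
qed

text \<open>The mean value theorem in the direction \<open>u\<close> and then in the direction \<open>v\<close>.  The left-hand side is
  symmetric in \<open>u\<close> and \<open>v\<close>, which is the reason for the symmetry of second derivatives.\<close>

lemma second_difference_mean_value:
  fixes f :: "'a::euclidean_space \<Rightarrow> real"
  assumes f: "smooth_on (ball x r) f" and t: "0 < t" "t * (norm u + norm v) < r"
  shows "\<exists>\<xi>. dist x \<xi> \<le> t * (norm u + norm v) \<and>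
    f (x + t *\<^sub>R u + t *\<^sub>R v) - f (x + t *\<^sub>R u) - f (x + t *\<^sub>R v) + f x
      = t * t * frechet_derivative (\<lambda>y. frechet_derivative f (at y) u) (at \<xi>) v"
proof -
  have near: "norm (a *\<^sub>R u + b *\<^sub>R v) \<le> t * (norm u + norm v)" if "0 \<le> a" "a \<le> t" "0 \<le> b" "b \<le> t" for a b
  proof -
    have "norm (a *\<^sub>R u + b *\<^sub>R v) \<le> a * norm u + b * norm v"
      using norm_triangle_ineq[of "a *\<^sub>R u" "b *\<^sub>R v"] that by simp
    also have "\<dots> \<le> t * norm u + t * norm v" using that by (intro add_mono mult_right_mono) auto
    finally show ?thesis by (simp add: distrib_left)
  qed
  have dist: "dist x (x + a *\<^sub>R u + b *\<^sub>R v) = norm (a *\<^sub>R u + b *\<^sub>R v)" for a b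
    by (subst dist_commute) (simp add: dist_norm add.assoc)
  have mem: "x + a *\<^sub>R u + b *\<^sub>R v \<in> ball x r" if "0 \<le> a" "a \<le> t" "0 \<le> b" "b \<le> t" for a b
    using near[OF that] t(2) by (simp add: dist)
  let ?g = "\<lambda>s. f (x + s *\<^sub>R u + t *\<^sub>R v) - f (x + s *\<^sub>R u + 0 *\<^sub>R v)"
  let ?g' = "\<lambda>s. frechet_derivative f (at (x + s *\<^sub>R u + t *\<^sub>R v)) u
     - frechet_derivative f (at (x + s *\<^sub>R u + 0 *\<^sub>R v)) u"
  have lin: "linear (frechet_derivative f (at y))" if "y \<in> ball x r" for y
    using smooth_on_has_derivative[OF f that] has_derivative_linear by blast
  have line: "((\<lambda>s. f (x + s *\<^sub>R u + b *\<^sub>R v)) has_real_derivative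
      frechet_derivative f (at (x + s *\<^sub>R u + b *\<^sub>R v)) u) (at s)"
    if "0 \<le> s" "s \<le> t" "0 \<le> b" "b \<le> t" for s b
  proof -
    have "((\<lambda>s. x + s *\<^sub>R u + b *\<^sub>R v) has_derivative (\<lambda>h. h *\<^sub>R u)) (at s)"
      by (auto intro!: derivative_eq_intros)
    from has_derivative_compose[OF this smooth_on_has_derivative[OF f mem[OF that]]]
    show ?thesis
      by (simp add: has_field_derivative_def linear_scale[OF lin[OF mem[OF that]]] o_def mult_commute_abs)
  qed
  have "\<exists>z. 0 < z \<and> z < t \<and> ?g t - ?g 0 = (t - 0) * ?g' z"
    by (rule MVT2[OF t(1)]) (use line t(1) in \<open>auto intro!: DERIV_diff simp del: scale_zero_left\<close>)
  then obtain a where a: "0 < a" "a < t" "?g t - ?g 0 = t * ?g' a" by auto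
  have f2: "smooth_on (ball x r) (\<lambda>y. frechet_derivative f (at y) u)"
    by (rule smooth_on_frechet_derivative[OF f])
  let ?h = "\<lambda>s. frechet_derivative f (at (x + a *\<^sub>R u + s *\<^sub>R v)) u"
  let ?D = "\<lambda>y. frechet_derivative (\<lambda>y. frechet_derivative f (at y) u) (at y)"
  have "(?h has_real_derivative ?D (x + a *\<^sub>R u + s *\<^sub>R v) v) (at s)" if "0 \<le> s" "s \<le> t" for s
  proof -
    have m: "x + a *\<^sub>R u + s *\<^sub>R v \<in> ball x r" using mem that a by auto
    have l: "linear (?D (x + a *\<^sub>R u + s *\<^sub>R v))"
      using smooth_on_has_derivative[OF f2 m] has_derivative_linear by blast
    have "((\<lambda>s. x + a *\<^sub>R u + s *\<^sub>R v) has_derivative (\<lambda>h. h *\<^sub>R v)) (at s)"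
      by (auto intro!: derivative_eq_intros)
    from has_derivative_compose[OF this smooth_on_has_derivative[OF f2 m]]
    show ?thesis by (simp add: has_field_derivative_def linear_scale[OF l] o_def mult_commute_abs)
  qed
  from MVT2[OF t(1) this] obtain b where b: "0 < b" "b < t"
     "?h t - ?h 0 = t * ?D (x + a *\<^sub>R u + b *\<^sub>R v) v" by auto
  show ?thesis
  proof (intro exI[of _ "x + a *\<^sub>R u + b *\<^sub>R v"] conjI)
    show "dist x (x + a *\<^sub>R u + b *\<^sub>R v) \<le> t * (norm u + norm v)"
      using near[of a b] a b by (simp add: dist)
    show "f (x + t *\<^sub>R u + t *\<^sub>R v) - f (x + t *\<^sub>R u) - f (x + t *\<^sub>R v) + f x
      = t * t * ?D (x + a *\<^sub>R u + b *\<^sub>R v) v"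
      using a(3) b(3) by (simp add: algebra_simps)
  qed
qed

lemma second_derivative_sym_real:
  fixes f :: "'a::euclidean_space \<Rightarrow> real"
  assumes "open S" "smooth_on S f" "x \<in> S"
  shows "frechet_derivative (\<lambda>y. frechet_derivative f (at y) u) (at x) v
       = frechet_derivative (\<lambda>y. frechet_derivative f (at y) v) (at x) u"
proof -
  obtain r where r: "r > 0" "ball x r \<subseteq> S" using assms openE by blast
  have f: "smooth_on (ball x r) f" using smooth_on_subset assms r by blast
  let ?n = "norm u + norm v"
  let ?L = "\<lambda>u v y. frechet_derivative (\<lambda>y. frechet_derivative f (at y) u) (at y) v"
  \<comment> \<open>Step sizes tending to 0 for which the parallelogram stays inside the ball.\<close>
  define c where "c = r / (?n + 1)"
  define tt where "tt n = c * inverse (real (Suc n))" for n :: nat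
  have n: "?n + 1 > 0" by (simp add: add_nonneg_pos)
  have c: "c > 0" using r n by (simp add: c_def)
  have "c * (?n + 1) = r" using n by (simp add: c_def)
  then have cn: "c * ?n < r" using c by (simp add: distrib_left)
  have tpos: "tt n > 0" for n using c by (simp add: tt_def)
  have tlim: "tt \<longlonglongrightarrow> 0"
    unfolding tt_def using tendsto_mult[OF tendsto_const[of c] LIMSEQ_inverse_real_of_nat] by simp
  have tr: "tt n * ?n < r" for n
  proof -
    have "tt n \<le> c" using c by (simp add: tt_def field_simps)
    then have "tt n * ?n \<le> c * ?n" by (intro mult_right_mono) auto
    then show ?thesis using cn by simp
  qed
  have tr': "tt n * (norm v + norm u) < r" for n using tr[of n] by (simp add: add.commute)
  let ?d = "\<lambda>n. f (x + tt n *\<^sub>R u + tt n *\<^sub>R v) - f (x + tt n *\<^sub>R u) - f (x + tt n *\<^sub>R v) + f x"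
  have "\<forall>n. \<exists>\<xi>. dist x \<xi> \<le> tt n * ?n \<and> ?d n = tt n * tt n * ?L u v \<xi>"
    using second_difference_mean_value[OF f tpos tr] by blast
  from choice[OF this] obtain p
    where p: "\<And>n. dist x (p n) \<le> tt n * ?n" "\<And>n. ?d n = tt n * tt n * ?L u v (p n)" by blast
  have "\<exists>\<xi>. dist x \<xi> \<le> tt n * ?n \<and> ?d n = tt n * tt n * ?L v u \<xi>" for n
  proof -
    have swap: "x + tt n *\<^sub>R v + tt n *\<^sub>R u = x + tt n *\<^sub>R u + tt n *\<^sub>R v" by (simp add: add.commute add.left_commute)
    obtain \<xi> where "dist x \<xi> \<le> tt n * (norm v + norm u)"
      and "f (x + tt n *\<^sub>R u + tt n *\<^sub>R v) - f (x + tt n *\<^sub>R v) - f (x + tt n *\<^sub>R u) + f x = tt n * tt n * ?L v u \<xi>"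
      using second_difference_mean_value[OF f tpos tr', of n] unfolding swap by blast
    then show ?thesis by (intro exI[of _ \<xi>]) (auto simp: add.commute)
  qed
  then have "\<forall>n. \<exists>\<xi>. dist x \<xi> \<le> tt n * ?n \<and> ?d n = tt n * tt n * ?L v u \<xi>" by blast
  from choice[OF this] obtain q
    where q: "\<And>n. dist x (q n) \<le> tt n * ?n" "\<And>n. ?d n = tt n * tt n * ?L v u (q n)" by blast
  have eq: "?L u v (p n) = ?L v u (q n)" for n
  proof -
    have "tt n * tt n * ?L u v (p n) = tt n * tt n * ?L v u (q n)" using p(2)[of n] q(2)[of n] by linarith
    then show ?thesis using tpos[of n] by simp
  qed
  have lim: "s \<longlonglongrightarrow> x" if "\<And>n. dist x (s n) \<le> tt n * ?n" for s
  proof -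
    have "(\<lambda>n. tt n * ?n) \<longlonglongrightarrow> 0" using tendsto_mult_right[OF tlim, of ?n] by simp
    then have "(\<lambda>n. dist (s n) x) \<longlonglongrightarrow> 0"
      by (rule tendsto_sandwich[OF _ _ tendsto_const, rotated 2]) (use that in \<open>auto simp: dist_commute\<close>)
    then show ?thesis using tendsto_dist_iff by blast
  qed
  have cont: "isCont (?L u v) x" for u v
    using smooth_on_differentiable[OF smooth_on_frechet_derivative[OF smooth_on_frechet_derivative[OF assms(2)]] assms(3)]
    by (rule differentiable_imp_continuous_within)
  have "(\<lambda>n. ?L u v (p n)) \<longlonglongrightarrow> ?L u v x"
    by (rule isCont_tendsto_compose[OF cont lim[OF p(1)]])
  moreover have "(\<lambda>n. ?L v u (q n)) \<longlonglongrightarrow> ?L v u x"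
    by (rule isCont_tendsto_compose[OF cont lim[OF q(1)]])
  ultimately show ?thesis using eq LIMSEQ_unique by simp
qed

lemma frechet_derivative_bounded_linear:
  assumes "bounded_linear L" "f differentiable (at x)"
  shows "frechet_derivative (\<lambda>y. L (f y)) (at x) u = L (frechet_derivative f (at x) u)"
  using frechet_derivative_at[OF bounded_linear.has_derivative[OF assms(1) assms(2)[unfolded frechet_derivative_works]]]
  by metis

lemma second_derivative_sym:
  fixes f :: "'a::euclidean_space \<Rightarrow> 'b::euclidean_space"
  assumes "open S" "smooth_on S f" "x \<in> S"
  shows "frechet_derivative (\<lambda>y. frechet_derivative f (at y) u) (at x) v
       = frechet_derivative (\<lambda>y. frechet_derivative f (at y) v) (at x) u"
proof (rule euclidean_eqI)
  fix b :: 'b assume "b \<in> Basis"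
  have bl: "bounded_linear (\<lambda>w. w \<bullet> b)" by (rule bounded_linear_inner_left)
  have 1: "frechet_derivative (\<lambda>y. f y \<bullet> b) (at y) u = frechet_derivative f (at y) u \<bullet> b" if "y \<in> S" for y u
    by (rule frechet_derivative_bounded_linear[OF bl smooth_on_differentiable[OF assms(2) that]])
  have 2: "frechet_derivative (\<lambda>y. frechet_derivative f (at y) u) (at x) v \<bullet> b
     = frechet_derivative (\<lambda>y. frechet_derivative (\<lambda>y. f y \<bullet> b) (at y) u) (at x) v" for u v
  proof -
    have "frechet_derivative (\<lambda>y. frechet_derivative (\<lambda>y. f y \<bullet> b) (at y) u) (at x)
       = frechet_derivative (\<lambda>y. frechet_derivative f (at y) u \<bullet> b) (at x)"
      by (rule frechet_derivative_cong_open[OF assms(1,3) 1])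
    then show ?thesis
      using frechet_derivative_bounded_linear[OF bl smooth_on_differentiable[OF smooth_on_frechet_derivative[OF assms(2)] assms(3)]]
      by simp
  qed
  show "frechet_derivative (\<lambda>y. frechet_derivative f (at y) u) (at x) v \<bullet> b
       = frechet_derivative (\<lambda>y. frechet_derivative f (at y) v) (at x) u \<bullet> b"
    unfolding 2
    by (rule second_derivative_sym_real[OF assms(1) smooth_on_bounded_linear[OF assms(1) bl assms(2)] assms(3)])
qed

section \<open>Matrix-valued functions\<close>

lemma bounded_bilinear_matmul:
  "bounded_bilinear ((**) :: real^4^4 \<Rightarrow> real^4^4 \<Rightarrow> real^4^4)"
  unfolding bilinear_conv_bounded_bilinear[symmetric] bilinear_def
  by (auto intro!: linearI simp: matrix_add_ldistrib matrix_matrix_mult_def vec_eq_iff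
      sum.distrib algebra_simps sum_distrib_left)

lemma bounded_bilinear_matvec:
  "bounded_bilinear ((*v) :: real^4^4 \<Rightarrow> real^4 \<Rightarrow> real^4)"
  unfolding bilinear_conv_bounded_bilinear[symmetric] bilinear_def
  by (auto intro!: linearI simp: matrix_vector_mult_def vec_eq_iff
      sum.distrib algebra_simps sum_distrib_left)

lemma bounded_linear_transpose: "bounded_linear (transpose :: real^4^4 \<Rightarrow> real^4^4)"
  unfolding linear_conv_bounded_linear[symmetric]
  by (auto intro!: linearI simp: transpose_def vec_eq_iff)

lemma bounded_linear_trace: "bounded_linear (trace :: real^4^4 \<Rightarrow> real)"
  unfolding linear_conv_bounded_linear[symmetric]
  by (auto intro!: linearI simp: trace_def sum.distrib sum_distrib_left)

lemmas matmul_algebra =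
  bounded_bilinear.add_left[OF bounded_bilinear_matmul]
  bounded_bilinear.add_right[OF bounded_bilinear_matmul]
  bounded_bilinear.diff_left[OF bounded_bilinear_matmul]
  bounded_bilinear.diff_right[OF bounded_bilinear_matmul]
  bounded_bilinear.minus_left[OF bounded_bilinear_matmul]
  bounded_bilinear.minus_right[OF bounded_bilinear_matmul]
  bounded_bilinear.zero_left[OF bounded_bilinear_matmul]
  bounded_bilinear.zero_right[OF bounded_bilinear_matmul]
  bounded_bilinear.scaleR_left[OF bounded_bilinear_matmul]
  bounded_bilinear.scaleR_right[OF bounded_bilinear_matmul]
  bounded_bilinear.sum_left[OF bounded_bilinear_matmul]
  bounded_bilinear.sum_right[OF bounded_bilinear_matmul]

lemmas matvec_algebra =
  bounded_bilinear.add_left[OF bounded_bilinear_matvec]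
  bounded_bilinear.add_right[OF bounded_bilinear_matvec]
  bounded_bilinear.diff_left[OF bounded_bilinear_matvec]
  bounded_bilinear.diff_right[OF bounded_bilinear_matvec]
  bounded_bilinear.minus_left[OF bounded_bilinear_matvec]
  bounded_bilinear.minus_right[OF bounded_bilinear_matvec]
  bounded_bilinear.zero_left[OF bounded_bilinear_matvec]
  bounded_bilinear.zero_right[OF bounded_bilinear_matvec]
  bounded_bilinear.scaleR_left[OF bounded_bilinear_matvec]
  bounded_bilinear.scaleR_right[OF bounded_bilinear_matvec]
  bounded_bilinear.sum_left[OF bounded_bilinear_matvec]
  bounded_bilinear.sum_right[OF bounded_bilinear_matvec]

lemmas transpose_algebra =
  linear_add[OF bounded_linear.linear[OF bounded_linear_transpose]]
  linear_diff[OF bounded_linear.linear[OF bounded_linear_transpose]]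
  linear_neg[OF bounded_linear.linear[OF bounded_linear_transpose]]
  linear_scale[OF bounded_linear.linear[OF bounded_linear_transpose]]
  linear_0[OF bounded_linear.linear[OF bounded_linear_transpose]]

lemmas trace_algebra =
  linear_add[OF bounded_linear.linear[OF bounded_linear_trace]]
  linear_diff[OF bounded_linear.linear[OF bounded_linear_trace]]
  linear_neg[OF bounded_linear.linear[OF bounded_linear_trace]]
  linear_scale[OF bounded_linear.linear[OF bounded_linear_trace]]
  linear_sum[OF bounded_linear.linear[OF bounded_linear_trace]]
  linear_0[OF bounded_linear.linear[OF bounded_linear_trace]]

abbreviation pd :: "('a::real_normed_vector \<Rightarrow> 'b::real_normed_vector) \<Rightarrow> 'a \<Rightarrow> 'a \<Rightarrow> 'b" where
  "pd f x u \<equiv> frechet_derivative f (at x) u"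

lemma pd_eqI: "(f has_derivative D) (at x) \<Longrightarrow> pd f x u = D u"
  using frechet_derivative_at by metis

lemma pd_works: "f differentiable (at x) \<Longrightarrow> (f has_derivative pd f x) (at x)"
  using frechet_derivative_works by blast

lemma linear_pd: "f differentiable (at x) \<Longrightarrow> linear (pd f x)"
  using pd_works has_derivative_linear by blast

lemma pd_bilinear:
  assumes "bounded_bilinear B" "f differentiable (at x)" "h differentiable (at x)"
  shows "pd (\<lambda>y. B (f y) (h y)) x u = B (f x) (pd h x u) + B (pd f x u) (h x)"
  by (rule pd_eqI[OF bounded_bilinear.FDERIV[OF assms(1) pd_works[OF assms(2)] pd_works[OF assms(3)]]])

lemma differentiable_bilinear:
  assumes "bounded_bilinear B" "f differentiable (at x)" "h differentiable (at x)"
  shows "(\<lambda>y. B (f y) (h y)) differentiable (at x)"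
  using bounded_bilinear.FDERIV[OF assms(1) pd_works[OF assms(2)] pd_works[OF assms(3)]]
  by (auto simp: differentiable_def)

lemmas pd_linear = frechet_derivative_bounded_linear

lemma differentiable_linear:
  assumes "bounded_linear L" "f differentiable (at x)"
  shows "(\<lambda>y. L (f y)) differentiable (at x)"
  using bounded_linear.has_derivative[OF assms(1) pd_works[OF assms(2)]]
  by (auto simp: differentiable_def)

lemma pd_add: "f differentiable (at x) \<Longrightarrow> h differentiable (at x) \<Longrightarrow>
    pd (\<lambda>y. f y + h y) x u = pd f x u + pd h x u"
  by (rule pd_eqI[OF has_derivative_add[OF pd_works pd_works]])

lemma pd_diff: "f differentiable (at x) \<Longrightarrow> h differentiable (at x) \<Longrightarrow>
    pd (\<lambda>y. f y - h y) x u = pd f x u - pd h x u"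
  by (rule pd_eqI[OF has_derivative_diff[OF pd_works pd_works]])

text \<open>The workhorse for differentiating an identity between fields on a chart domain.\<close>

lemma pd_cong:
  "open S \<Longrightarrow> x \<in> S \<Longrightarrow> (\<And>y. y \<in> S \<Longrightarrow> f y = h y) \<Longrightarrow> pd f x u = pd h x u"
  by (simp add: frechet_derivative_cong_open[of S x f h])

lemma pd_const: "pd (\<lambda>_. c) x u = 0"
  by (rule pd_eqI[OF has_derivative_const])

lemma pd_compose:
  assumes "f differentiable (at x)" "h differentiable (at (f x))"
  shows "pd (\<lambda>y. h (f y)) x u = pd h (f x) (pd f x u)"
  by (rule pd_eqI[OF has_derivative_compose[OF pd_works pd_works]]) (use assms in auto)

lemmas pd_matmul = pd_bilinear[OF bounded_bilinear_matmul]
lemmas pd_matvec = pd_bilinear[OF bounded_bilinear_matvec]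

lemma pd_matvec_const:
  "F differentiable (at x) \<Longrightarrow> pd (\<lambda>y. F y *v v) x u = pd F x u *v (v::real^4)" for F :: "_ \<Rightarrow> real^4^4"
  by (rule pd_linear[OF bounded_bilinear.bounded_linear_left[OF bounded_bilinear_matvec]])

lemma matrix_works4: "linear f \<Longrightarrow> matrix f *v v = f (v::real^4)" for f :: "real^4 \<Rightarrow> real^4"
  using matrix_vector_mul[of f] by metis

lemma matrix_eq_vec: "(\<And>v. A *v v = B *v v) \<Longrightarrow> A = B" for A B :: "real^4^4"
  by (simp add: matrix_eq)

lemma inner_transpose: "u \<bullet> (transpose A *v v) = (A *v u) \<bullet> v" for A :: "real^4^4"
  unfolding transpose_matrix_vector inner_commute[of u] dot_lmul_matrix by (rule inner_commute)

lemma smooth_on_matrix: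
  fixes F :: "'a::euclidean_space \<Rightarrow> real^4^4"
  assumes "open S" "\<And>v. smooth_on S (\<lambda>x. F x *v v)"
  shows "smooth_on S F"
proof -
  define col where "col j w = (\<chi> a b. if b = j then w$a else 0)" for j :: 4 and w :: "real^4"
  have "bounded_linear (col j)" for j :: 4
    unfolding linear_conv_bounded_linear[symmetric] col_def
    by (auto intro!: linearI simp: vec_eq_iff)
  then have "smooth_on S (\<lambda>x. col j (F x *v axis j 1))" for j
    by (rule smooth_on_bounded_linear[OF assms(1) _ assms(2)])
  then have "smooth_on S (\<lambda>x. \<Sum>j\<in>UNIV. col j (F x *v axis j 1))"
    by (rule smooth_on_sum[OF assms(1)])
  moreover have "(\<Sum>j\<in>UNIV. col j (F x *v axis j 1)) = F x" for x
    by (simp add: vec_eq_iff col_def matrix_vector_mult_basis column_def)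
  ultimately show ?thesis by simp
qed

lemma smooth_on_det:
  fixes F :: "'a::euclidean_space \<Rightarrow> real^4^4"
  assumes "open S" "\<And>i j. smooth_on S (\<lambda>x. F x $ i $ j)"
  shows "smooth_on S (\<lambda>x. det (F x))"
  unfolding det_def
  by (intro smooth_on_sum smooth_on_bilinear[OF _ bounded_bilinear_mult] smooth_on_const smooth_on_prod assms)

lemma smooth_on_entry:
  fixes F :: "'a::euclidean_space \<Rightarrow> real^4^4"
  shows "open S \<Longrightarrow> smooth_on S F \<Longrightarrow> smooth_on S (\<lambda>x. F x $ i $ j)"
  by (rule smooth_on_bounded_linear[OF _ bounded_linear_compose[OF bounded_linear_vec_nth bounded_linear_vec_nth]])

lemma matrix_inv_right4: "invertible A \<Longrightarrow> A ** matrix_inv A = mat 1" for A :: "real^4^4"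
  unfolding invertible_def matrix_inv_def by (rule someI2_ex) auto

lemma matrix_inv_left4: "invertible A \<Longrightarrow> matrix_inv A ** A = mat 1" for A :: "real^4^4"
  unfolding invertible_def matrix_inv_def by (rule someI2_ex) auto

text \<open>Cramer's rule expresses the inverse by determinants, which are polynomials in the entries.\<close>

lemma smooth_on_matrix_inv:
  fixes F :: "'a::euclidean_space \<Rightarrow> real^4^4"
  assumes S: "open S" and F: "smooth_on S F" and inv: "\<And>x. x \<in> S \<Longrightarrow> invertible (F x)"
  shows "smooth_on S (\<lambda>x. matrix_inv (F x))"
proof (rule smooth_on_matrix[OF S])
  fix v :: "real^4"
  let ?C = "\<lambda>x k. (\<chi> i j. if j = k then v$i else F x $ i $ j) :: real^4^4"
  have nz: "det (F x) \<noteq> 0" if "x \<in> S" for x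
    using inv[OF that] invertible_det_nz by blast
  have eq: "(\<Sum>k\<in>UNIV. (inverse (det (F x)) * det (?C x k)) *\<^sub>R axis k 1) = matrix_inv (F x) *v v" if "x \<in> S" for x
  proof -
    have "F x *v (matrix_inv (F x) *v v) = v"
      by (simp add: matrix_vector_mul_assoc matrix_inv_right4 inv that)
    then have "matrix_inv (F x) *v v = (\<chi> k. det (?C x k) / det (F x))"
      using cramer[OF nz[OF that]] by blast
    then show ?thesis by (simp add: vec_eq_iff axis_def divide_inverse mult.commute if_distrib cong: if_cong)
  qed
  have C: "smooth_on S (\<lambda>x. ?C x k $ i $ j)" for k i j
    by (cases "j = k") (simp_all add: smooth_on_const S smooth_on_entry F)
  have d: "smooth_on S (\<lambda>x. inverse (det (F x)))"
    by (rule smooth_on_inverse_real[OF S nz smooth_on_det[OF S smooth_on_entry[OF S F]]])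
  have "smooth_on S (\<lambda>x. (inverse (det (F x)) * det (?C x k)) *\<^sub>R axis k 1)" for k
    by (rule smooth_on_bounded_linear[OF S bounded_linear_scaleR_left])
      (rule smooth_on_bilinear[OF S bounded_bilinear_mult d smooth_on_det[OF S C]])
  then have sm: "smooth_on S (\<lambda>x. \<Sum>k\<in>UNIV. (inverse (det (F x)) * det (?C x k)) *\<^sub>R axis k 1)"
    by (rule smooth_on_sum[OF S])
  show "smooth_on S (\<lambda>x. matrix_inv (F x) *v v)"
    by (rule smooth_on_cong[OF S eq sm])
qed

section \<open>The Levi-Civita connection in a chart\<close>

lemma inn_algebra:
  "inn G (u + v) w = inn G u w + inn G v w" "inn G u (v + w) = inn G u v + inn G u w"
  "inn G (u - v) w = inn G u w - inn G v w" "inn G u (v - w) = inn G u v - inn G u w"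
  "inn G (- u) w = - inn G u w" "inn G u (- w) = - inn G u w"
  "inn G (c *\<^sub>R u) w = c * inn G u w" "inn G u (c *\<^sub>R w) = c * inn G u w"
  "inn G 0 w = 0" "inn G u 0 = 0"
  by (simp_all add: inn_def inner_add_left inner_add_right inner_diff_left inner_diff_right matvec_algebra)

lemma inn_sum: "inn G (\<Sum>i\<in>I. f i) w = (\<Sum>i\<in>I. inn G (f i) w)" "inn G u (\<Sum>i\<in>I. f i) = (\<Sum>i\<in>I. inn G u (f i))"
  by (simp_all add: inn_def inner_sum_left inner_sum_right matvec_algebra)

locale metric_space_4 =
  fixes G :: "real^4^4"
  assumes inn_sym: "inn G u v = inn G v u"
    and inn_pos: "u \<noteq> 0 \<Longrightarrow> inn G u u > 0"
begin

lemma inn_eqI: assumes "\<And>w. inn G u w = inn G v w" shows "u = v"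
proof (rule ccontr)
  assume "u \<noteq> v"
  then have "inn G (u - v) (u - v) > 0" using inn_pos by simp
  then show False using assms[of "u - v"] by (simp add: inn_algebra)
qed

lemma transpose_metric: "transpose G = G"
proof (rule matrix_eq_vec, rule vector_eq_ldot[THEN iffD1], rule allI)
  fix v u show "u \<bullet> (transpose G *v v) = u \<bullet> (G *v v)"
    using inn_sym[of u v] unfolding inn_def inner_transpose by (simp add: inner_commute[of "G *v u" v])
qed

lemma invertible_metric: "invertible G"
proof -
  have "G *v x = 0 \<Longrightarrow> x = 0" for x using inn_pos[of x] by (auto simp: inn_def)
  then show ?thesis unfolding invertible_left_inverse matrix_left_invertible_ker by blast
qed

end

text \<open>Koszul's argument: the three cyclic permutations of the compatibility condition, together with the
  symmetry of \<open>\<Gamma>\<close>, determine \<open>g(\<Gamma>(u, v), w)\<close>.  So any candidate with these properties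
  is the Christoffel map.\<close>

lemma christoffel_eqI:
  assumes "metric_space_4 (g x)" and bil: "bilinear \<Gamma>" and sym: "\<And>u v. \<Gamma> u v = \<Gamma> v u"
    and compat: "\<And>u v w. pd (\<lambda>y. inn (g y) v w) x u = inn (g x) (\<Gamma> u v) w + inn (g x) v (\<Gamma> u w)"
  shows "christoffel g x = \<Gamma>"
  unfolding christoffel_def
proof (rule the_equality)
  interpret metric_space_4 "g x" by fact
  show "bilinear \<Gamma> \<and> (\<forall>u v. \<Gamma> u v = \<Gamma> v u) \<and> (\<forall>u v w. frechet_derivative (\<lambda>y. inn (g y) v w) (at x) u
      = inn (g x) (\<Gamma> u v) w + inn (g x) v (\<Gamma> u w))"
    using assms by blast
  fix \<Delta> assume D: "bilinear \<Delta> \<and> (\<forall>u v. \<Delta> u v = \<Delta> v u) \<and> (\<forall>u v w. frechet_derivative (\<lambda>y. inn (g y) v w) (at x) u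
      = inn (g x) (\<Delta> u v) w + inn (g x) v (\<Delta> u w))"
  show "\<Delta> = \<Gamma>"
  proof (intro ext inn_eqI)
    fix u v w
    have eq: "inn (g x) (\<Delta> a b) c + inn (g x) (\<Delta> a c) b = inn (g x) (\<Gamma> a b) c + inn (g x) (\<Gamma> a c) b" for a b c
    proof -
      have "pd (\<lambda>y. inn (g y) b c) x a = inn (g x) (\<Delta> a b) c + inn (g x) b (\<Delta> a c)" using D by blast
      then show ?thesis
        using compat[where u=a and v=b and w=c] inn_sym[of b "\<Delta> a c"] inn_sym[of b "\<Gamma> a c"] by simp
    qed
    have "\<Delta> v u = \<Delta> u v" "\<Delta> w u = \<Delta> u w" "\<Delta> w v = \<Delta> v w" "\<Gamma> v u = \<Gamma> u v" "\<Gamma> w u = \<Gamma> u w" "\<Gamma> w v = \<Gamma> v w"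
      using D by (blast, blast, blast) (rule sym)+
    then show "inn (g x) (\<Delta> u v) w = inn (g x) (\<Gamma> u v) w"
      using eq[of u v w] eq[of v u w] eq[of w u v] by simp
  qed
qed

locale chart_metric =
  fixes U :: "point set" and G :: mfield
  assumes open_U: "open U" and smooth_G: "smooth_on U G"
    and G_sym: "x \<in> U \<Longrightarrow> inn (G x) u v = inn (G x) v u"
    and G_pos: "x \<in> U \<Longrightarrow> u \<noteq> 0 \<Longrightarrow> inn (G x) u u > 0"
begin

lemma metric_at: "x \<in> U \<Longrightarrow> metric_space_4 (G x)"
  by unfold_locales (auto simp: G_sym G_pos)

text \<open>The vector whose Euclidean product with \<open>w\<close> is
  \<open>\<partial>\<^sub>u g(v, w) + \<partial>\<^sub>v g(u, w) - \<partial>\<^sub>w g(u, v)\<close>, the right-hand side of the Koszul formula.\<close>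

definition koszul :: "point \<Rightarrow> real^4 \<Rightarrow> real^4 \<Rightarrow> real^4" where
  "koszul x u v = pd G x u *v v + pd G x v *v u - (\<Sum>i\<in>UNIV. (u \<bullet> (pd G x (axis i 1) *v v)) *\<^sub>R axis i 1)"

text \<open>The connection matrix \<open>\<Gamma>\<^sub>u\<close>.  Working with matrices turns the covariant derivative of an
  endomorphism field into \<open>\<partial>\<^sub>u A + [\<Gamma>\<^sub>u, A]\<close> and reduces the curvature identities to matrix algebra.\<close>

definition Gam :: "point \<Rightarrow> real^4 \<Rightarrow> real^4^4" where
  "Gam x u = matrix (\<lambda>v. matrix_inv (G x) *v ((1/2) *\<^sub>R koszul x u v))"

lemma G_diff: "x \<in> U \<Longrightarrow> G differentiable (at x)"
  by (rule smooth_on_differentiable[OF smooth_G])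

lemma G_pd_sym: assumes "x \<in> U" shows "u \<bullet> (pd G x w *v v) = v \<bullet> (pd G x w *v u)"
proof -
  have "pd G x w = pd (\<lambda>y. transpose (G y)) x w"
    by (rule pd_cong[OF open_U assms]) (simp add: metric_space_4.transpose_metric[OF metric_at])
  also have "\<dots> = transpose (pd G x w)" by (rule pd_linear[OF bounded_linear_transpose G_diff[OF assms]])
  finally have "u \<bullet> (pd G x w *v v) = u \<bullet> (transpose (pd G x w) *v v)" by simp
  then show ?thesis by (simp only: inner_transpose inner_commute)
qed

lemma koszul_linear: "x \<in> U \<Longrightarrow> bilinear (koszul x)"
  unfolding bilinear_def koszul_def
  by (auto intro!: linearI simp: matvec_algebra linear_add[OF linear_pd[OF G_diff]] linear_scale[OF linear_pd[OF G_diff]]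
      inner_add_left inner_add_right sum.distrib scaleR_add_left scaleR_add_right scaleR_sum_right scaleR_diff_right)

lemma Gam_works: assumes "x \<in> U" shows "Gam x u *v v = matrix_inv (G x) *v ((1/2) *\<^sub>R koszul x u v)"
  unfolding Gam_def
  by (rule matrix_works4, rule linearI)
    (simp_all add: bilinear_radd[OF koszul_linear[OF assms]] bilinear_rmul[OF koszul_linear[OF assms]]
      matvec_algebra scaleR_add_right)

lemma inn_Gam:
  assumes "x \<in> U"
  shows "2 * inn (G x) w (Gam x u *v v)
    = w \<bullet> (pd G x u *v v) + w \<bullet> (pd G x v *v u) - u \<bullet> (pd G x w *v v)"
proof -
  interpret metric_space_4 "G x" by (rule metric_at[OF assms])
  have w: "w = (\<Sum>i\<in>UNIV. w$i *\<^sub>R axis i 1)"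
    by (simp add: vec_eq_iff axis_def if_distrib cong: if_cong)
  have "inn (G x) w (Gam x u *v v) = w \<bullet> ((1/2) *\<^sub>R koszul x u v)"
    by (simp only: inn_def Gam_works[OF assms] matrix_vector_mul_assoc matrix_inv_right4[OF invertible_metric] matrix_vector_mul_lid)
  moreover have "w \<bullet> (\<Sum>i\<in>UNIV. (u \<bullet> (pd G x (axis i 1) *v v)) *\<^sub>R axis i 1) = u \<bullet> (pd G x w *v v)"
    by (subst (2) w) (simp add: linear_sum[OF linear_pd[OF G_diff[OF assms]]] linear_scale[OF linear_pd[OF G_diff[OF assms]]]
        matvec_algebra inner_sum_right inner_axis mult.commute)
  ultimately show ?thesis by (simp add: koszul_def inner_add_right inner_diff_right)
qed

lemma Gam_linear: assumes "x \<in> U" shows "linear (Gam x)"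
  by (rule linearI; rule matrix_eq_vec)
    (simp_all add: Gam_works[OF assms] bilinear_ladd[OF koszul_linear[OF assms]]
      bilinear_lmul[OF koszul_linear[OF assms]] matvec_algebra scaleR_add_right)

lemma Gam_sym: assumes "x \<in> U" shows "Gam x u *v v = Gam x v *v u"
proof (rule metric_space_4.inn_eqI[OF metric_at[OF assms]])
  fix w show "inn (G x) (Gam x u *v v) w = inn (G x) (Gam x v *v u) w"
    using inn_Gam[OF assms, of w u v] inn_Gam[OF assms, of w v u] G_pd_sym[OF assms, of u w v] G_sym[OF assms, of w]
    by (metis add.commute mult_left_cancel zero_neq_numeral)
qed

lemma Gam_compat_inn:
  assumes "x \<in> U"
  shows "v \<bullet> (pd G x u *v w) = inn (G x) (Gam x u *v v) w + inn (G x) v (Gam x u *v w)"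
  using inn_Gam[OF assms, of w u v] inn_Gam[OF assms, of v u w] G_pd_sym[OF assms]
    G_sym[OF assms, of "Gam x u *v v" w] by (smt (verit))

lemma pd_inn: "x \<in> U \<Longrightarrow> pd (\<lambda>y. inn (G y) v w) x u = v \<bullet> (pd G x u *v w)"
  unfolding inn_def
  by (rule pd_linear[OF bounded_linear_compose[OF bounded_linear_inner_right
       bounded_bilinear.bounded_linear_left[OF bounded_bilinear_matvec]], OF G_diff])

lemma christoffel_Gam: assumes "x \<in> U" shows "christoffel G x u v = Gam x u *v v"
proof -
  have "christoffel G x = (\<lambda>u v. Gam x u *v v)"
  proof (rule christoffel_eqI[where g=G and x=x])
    show "metric_space_4 (G x)" by (rule metric_at[OF assms])
    show "Gam x u *v v = Gam x v *v u" for u v by (rule Gam_sym[OF assms])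
    show "bilinear (\<lambda>u v. Gam x u *v v)"
      unfolding bilinear_def
      by (auto intro!: linearI simp: matvec_algebra linear_add[OF Gam_linear[OF assms]] linear_scale[OF Gam_linear[OF assms]])
    show "pd (\<lambda>y. inn (G y) v w) x u = inn (G x) (Gam x u *v v) w + inn (G x) v (Gam x u *v w)" for u v w
      using Gam_compat_inn[OF assms] pd_inn[OF assms] by simp
  qed
  then show ?thesis by simp
qed

lemma Gam_compat:
  assumes "x \<in> U" shows "pd G x u = transpose (Gam x u) ** G x + G x ** Gam x u"
proof (rule matrix_eq_vec, rule vector_eq_ldot[THEN iffD1], rule allI)
  fix w v
  have "(Gam x u *v v) \<bullet> (G x *v w) = v \<bullet> (transpose (Gam x u) *v (G x *v w))"
    by (simp only: inner_transpose)
  then show "v \<bullet> (pd G x u *v w) = v \<bullet> ((transpose (Gam x u) ** G x + G x ** Gam x u) *v w)"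
    using Gam_compat_inn[OF assms, of v u w]
    by (simp add: inn_def matvec_algebra inner_add_right matrix_vector_mul_assoc del: transpose_matrix_vector)
qed

lemma smooth_Ginv: "smooth_on U (\<lambda>x. matrix_inv (G x))"
  by (rule smooth_on_matrix_inv[OF open_U smooth_G metric_space_4.invertible_metric[OF metric_at]])

lemma smooth_Gam: "smooth_on U (\<lambda>x. Gam x u)"
proof (rule smooth_on_matrix[OF open_U])
  fix v
  have pG: "smooth_on U (\<lambda>x. pd G x a *v b)" for a b
    by (rule smooth_on_bounded_linear[OF open_U bounded_bilinear.bounded_linear_left[OF bounded_bilinear_matvec]
       smooth_on_frechet_derivative[OF smooth_G]])
  have "smooth_on U (\<lambda>x. koszul x u v)"
    unfolding koszul_def
    by (intro smooth_on_diff[OF open_U] smooth_on_add[OF open_U] smooth_on_sum[OF open_U] pG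
        smooth_on_bounded_linear[OF open_U bounded_linear_scaleR_left]
        smooth_on_bounded_linear[OF open_U bounded_linear_inner_right])
  then have "smooth_on U (\<lambda>x. matrix_inv (G x) *v ((1/2) *\<^sub>R koszul x u v))"
    by (intro smooth_on_bilinear[OF open_U bounded_bilinear_matvec smooth_Ginv]
        smooth_on_bounded_linear[OF open_U bounded_linear_scaleR_right])
  then show "smooth_on U (\<lambda>x. Gam x u *v v)"
    by (rule smooth_on_cong[OF open_U, rotated]) (simp add: Gam_works)
qed

lemmas Gam_diff = smooth_on_differentiable[OF smooth_Gam]

lemma pd_Gam_linear: assumes "x \<in> U" shows "linear (\<lambda>u. pd (\<lambda>y. Gam y u) x v)"
proof (rule linearI)
  fix a b and c :: real
  have "pd (\<lambda>y. Gam y (a + b)) x v = pd (\<lambda>y. Gam y a + Gam y b) x v"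
    by (rule pd_cong[OF open_U assms])
      (simp add: linear_add[OF Gam_linear])
  then show "pd (\<lambda>y. Gam y (a + b)) x v = pd (\<lambda>y. Gam y a) x v + pd (\<lambda>y. Gam y b) x v"
    by (simp add: pd_add Gam_diff assms)
  have "pd (\<lambda>y. Gam y (c *\<^sub>R a)) x v = pd (\<lambda>y. c *\<^sub>R Gam y a) x v"
    by (rule pd_cong[OF open_U assms])
      (simp add: linear_scale[OF Gam_linear])
  then show "pd (\<lambda>y. Gam y (c *\<^sub>R a)) x v = c *\<^sub>R pd (\<lambda>y. Gam y a) x v"
    by (simp add: pd_linear[OF bounded_linear_scaleR_right] Gam_diff assms)
qed

end

context chart_metric begin
section \<open>Curvature in a chart\<close>

text \<open>The curvature form \<open>d\<Gamma> + \<Gamma> \<and> \<Gamma>\<close> of the connection matrix.\<close>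

definition Rm :: "point \<Rightarrow> real^4 \<Rightarrow> real^4 \<Rightarrow> real^4^4" where
  "Rm x u v = pd (\<lambda>y. Gam y v) x u - pd (\<lambda>y. Gam y u) x v + Gam x u ** Gam x v - Gam x v ** Gam x u"

lemma nabla_const: "x \<in> U \<Longrightarrow> nabla G (\<lambda>_. u) (\<lambda>_. v) x = Gam x u *v v"
  by (simp add: nabla_def pd_const christoffel_Gam)

lemma Riem_Rm: assumes "x \<in> U" shows "Riem G x u v w = Rm x u v *v w"
proof -
  have 1: "pd (nabla G (\<lambda>_. v) (\<lambda>_. w)) x u = pd (\<lambda>y. Gam y v) x u *v w" for u v w
  proof -
    have "pd (nabla G (\<lambda>_. v) (\<lambda>_. w)) x u = pd (\<lambda>y. Gam y v *v w) x u"
      by (rule pd_cong[OF open_U assms])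
        (rule nabla_const)
    then show ?thesis by (simp add: pd_matvec_const Gam_diff assms)
  qed
  have "nabla2 G (\<lambda>_. u) (\<lambda>_. v) (\<lambda>_. w) x
      = pd (\<lambda>y. Gam y v) x u *v w + Gam x u *v (Gam x v *v w) - Gam x (Gam x u *v v) *v w" for u v w
    unfolding nabla2_def nabla_def[of G "\<lambda>_. u" "nabla G (\<lambda>_. v) (\<lambda>_. w)"]
       nabla_def[of G "nabla G (\<lambda>_. u) (\<lambda>_. v)" "\<lambda>_. w"]
    by (simp add: 1 nabla_const assms pd_const christoffel_Gam)
  then show ?thesis
    by (simp add: Riem_def Rm_def matvec_algebra matrix_vector_mul_assoc Gam_sym[OF assms, of v u])
qed

lemma smooth_Rm: "smooth_on U (\<lambda>x. Rm x u v)"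
  unfolding Rm_def
  by (intro smooth_on_diff[OF open_U] smooth_on_add[OF open_U] smooth_on_frechet_derivative smooth_Gam
      smooth_on_bilinear[OF open_U bounded_bilinear_matmul])

lemma Rm_antisym: "Rm x v u = - Rm x u v"
  by (simp add: Rm_def)

lemma Rm_linear: assumes "x \<in> U" shows "linear (\<lambda>u. Rm x u v)"
  by (rule linearI)
    (simp_all add: Rm_def matmul_algebra linear_add[OF Gam_linear[OF assms]] linear_scale[OF Gam_linear[OF assms]]
      linear_add[OF pd_Gam_linear[OF assms]] linear_scale[OF pd_Gam_linear[OF assms]]
      linear_add[OF linear_pd[OF Gam_diff[OF assms]]] linear_scale[OF linear_pd[OF Gam_diff[OF assms]]] algebra_simps)

text \<open>Both the first-order and the quadratic terms cancel in pairs by the symmetry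
  \<open>\<Gamma>\<^sub>u v = \<Gamma>\<^sub>v u\<close> and its derivative.\<close>

lemma Rm_bianchi: assumes "x \<in> U" shows "Rm x u v *v w + Rm x v w *v u + Rm x w u *v v = 0"
proof -
  have "pd (\<lambda>y. Gam y a) x u *v b = pd (\<lambda>y. Gam y b) x u *v a" for a b u
  proof -
    have "pd (\<lambda>y. Gam y a *v b) x u = pd (\<lambda>y. Gam y b *v a) x u"
      by (rule pd_cong[OF open_U assms])
        (rule Gam_sym)
    then show ?thesis by (simp add: pd_matvec_const Gam_diff assms)
  qed
  from this[of v w u] this[of w u v] this[of u v w]
  show ?thesis
    using Gam_sym[OF assms, of u v] Gam_sym[OF assms, of v w] Gam_sym[OF assms, of w u]
    by (simp add: Rm_def matvec_algebra matrix_vector_mul_assoc[symmetric])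
qed

text \<open>Differentiate \<open>\<partial>\<^sub>v g = \<Gamma>\<^sub>v\<^sup>T g + g \<Gamma>\<^sub>v\<close> once more and use that second derivatives of the metric
  commute; the mixed terms \<open>\<Gamma>\<^sub>v\<^sup>T g \<Gamma>\<^sub>u\<close> are symmetrized and drop out.\<close>

lemma Rm_skew_matrix: assumes "x \<in> U" shows "transpose (Rm x u v) ** G x + G x ** Rm x u v = 0"
proof -
  have D: "pd (\<lambda>y. transpose (Gam y v)) x u = transpose (pd (\<lambda>y. Gam y v) x u)" for u v
    by (rule pd_linear[OF bounded_linear_transpose Gam_diff[OF assms]])
  have d: "(\<lambda>y. transpose (Gam y v)) differentiable (at x)" for v
    by (rule differentiable_linear[OF bounded_linear_transpose Gam_diff[OF assms]])
  have "pd (\<lambda>y. pd G y v) x u = transpose (Gam x v) ** (transpose (Gam x u) ** G x + G x ** Gam x u)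
      + transpose (pd (\<lambda>y. Gam y v) x u) ** G x
      + (G x ** pd (\<lambda>y. Gam y v) x u + (transpose (Gam x u) ** G x + G x ** Gam x u) ** Gam x v)" for u v
  proof -
    have "pd (\<lambda>y. pd G y v) x u = pd (\<lambda>y. transpose (Gam y v) ** G y + G y ** Gam y v) x u"
      by (rule pd_cong[OF open_U assms])
        (rule Gam_compat)
    also have "\<dots> = pd (\<lambda>y. transpose (Gam y v) ** G y) x u + pd (\<lambda>y. G y ** Gam y v) x u"
      by (rule pd_add; intro differentiable_bilinear[OF bounded_bilinear_matmul] d G_diff Gam_diff assms)
    finally show ?thesis
      by (simp add: pd_matmul d G_diff Gam_diff assms D Gam_compat)
  qed
  from this[of u v] this[of v u] second_derivative_sym[OF open_U smooth_G assms, of u v]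
  show ?thesis
    by (simp add: Rm_def transpose_algebra matmul_algebra matrix_transpose_mul matrix_mul_assoc algebra_simps)
qed

lemma Rm_skew: assumes "x \<in> U" shows "inn (G x) (Rm x u v *v a) b = - inn (G x) a (Rm x u v *v b)"
proof -
  have "inn (G x) (Rm x u v *v a) b + inn (G x) a (Rm x u v *v b)
     = a \<bullet> ((transpose (Rm x u v) ** G x + G x ** Rm x u v) *v b)"
    by (simp add: inn_def matvec_algebra inner_add_right matrix_vector_mul_assoc[symmetric] inner_transpose
        del: transpose_matrix_vector)
  then show ?thesis by (simp add: Rm_skew_matrix[OF assms])
qed

lemma nabla_end_eq:
  assumes x: "x \<in> U" and A: "A differentiable (at x)"
  shows "nabla_end G A x u = pd A x u + Gam x u ** A x - A x ** Gam x u"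
proof -
  have eq: "nabla G (\<lambda>_. u) (\<lambda>y. A y *v w) x - A x *v nabla G (\<lambda>_. u) (\<lambda>_. w) x
     = (pd A x u + Gam x u ** A x - A x ** Gam x u) *v w" for w
    unfolding nabla_const[OF x]
    by (simp add: nabla_def christoffel_Gam x pd_matvec_const[OF A] matvec_algebra matrix_vector_mul_assoc)
  show ?thesis unfolding nabla_end_def eq by simp
qed

end

section \<open>Hermitian linear algebra in dimension 4\<close>

lemma linear_matvec: "linear ((*v) (A :: real^4^4))"
  by simp

context metric_space_4
begin

definition frame_matrix :: "(4 \<Rightarrow> real^4) \<Rightarrow> real^4^4" where
  "frame_matrix e = (\<chi> a i. e i $ a)"

lemma frame_matrix_transpose: "(transpose (frame_matrix e) *v v) $ i = e i \<bullet> v"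
  by (simp add: frame_matrix_def matrix_vector_mult_def transpose_def inner_vec_def)

lemma frame_matrix_axis: "frame_matrix e *v w = (\<Sum>i\<in>UNIV. w $ i *\<^sub>R e i)"
  by (simp add: frame_matrix_def matrix_vector_mult_def vec_eq_iff mult.commute)

lemma frame_matrix_gram:
  assumes "orthonormal_frame G e"
  shows "transpose (frame_matrix e) ** G ** frame_matrix e = mat 1"
    and "frame_matrix e ** transpose (frame_matrix e) ** G = mat 1"
proof -
  show 1: "transpose (frame_matrix e) ** G ** frame_matrix e = mat 1"
  proof (rule matrix_eq_vec)
    fix w
    have "((transpose (frame_matrix e) ** G ** frame_matrix e) *v w) $ i = w $ i" for i
    proof -
      have "((transpose (frame_matrix e) ** G ** frame_matrix e) *v w) $ i = inn G (e i) (\<Sum>j\<in>UNIV. w $ j *\<^sub>R e j)"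
        by (simp only: matrix_vector_mul_assoc[symmetric] frame_matrix_transpose frame_matrix_axis inn_def)
      also have "\<dots> = w $ i"
      proof -
        have "inn G (e i) (\<Sum>j\<in>UNIV. w $ j *\<^sub>R e j) = (\<Sum>j\<in>UNIV. if i = j then w $ j else 0)"
          unfolding inn_sum inn_algebra
          by (rule sum.cong) (use assms in \<open>auto simp: orthonormal_frame_def\<close>)
        then show ?thesis by simp
      qed
      finally show ?thesis .
    qed
    then show "(transpose (frame_matrix e) ** G ** frame_matrix e) *v w = mat 1 *v w"
      by (simp add: vec_eq_iff)
  qed
  then show "frame_matrix e ** transpose (frame_matrix e) ** G = mat 1"
    by (metis matrix_left_right_inverse matrix_mul_assoc)
qed

lemma frame_expand:
  assumes "orthonormal_frame G e" shows "v = (\<Sum>i\<in>UNIV. inn G (e i) v *\<^sub>R e i)"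
proof -
  have "v = (frame_matrix e ** transpose (frame_matrix e) ** G) *v v"
    by (simp add: frame_matrix_gram[OF assms])
  then show ?thesis
    by (simp only: matrix_vector_mul_assoc[symmetric] frame_matrix_transpose frame_matrix_axis inn_def)
qed

lemma frame_parseval:
  assumes "orthonormal_frame G e" shows "(\<Sum>i\<in>UNIV. inn G (e i) u * inn G (e i) v) = inn G u v"
proof -
  have "inn G u v = inn G (\<Sum>i\<in>UNIV. inn G (e i) u *\<^sub>R e i) v" using frame_expand[OF assms] by simp
  then show ?thesis by (simp add: inn_sum inn_algebra)
qed

text \<open>This is what makes the choice hidden in \<open>frame\<close> harmless: every contraction may be computed in a
  frame of one's own choosing.\<close>

lemma frame_sum_indep:
  assumes B: "bilinear B" and e: "orthonormal_frame G e" "orthonormal_frame G f"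
  shows "(\<Sum>k\<in>UNIV. B (f k) (f k)) = (\<Sum>k\<in>UNIV. B (e k) (e k))"
proof -
  interpret l: linear "\<lambda>u. B u v" for v using B by (simp add: bilinear_def)
  interpret r: linear "B u" for u using B by (simp add: bilinear_def)
  have exp: "B u v = (\<Sum>i\<in>UNIV. \<Sum>j\<in>UNIV. (inn G (e i) u * inn G (e j) v) *\<^sub>R B (e i) (e j))" for u v
  proof -
    have "B u v = B (\<Sum>i\<in>UNIV. inn G (e i) u *\<^sub>R e i) v" using frame_expand[OF e(1), of u] by simp
    also have "\<dots> = (\<Sum>i\<in>UNIV. inn G (e i) u *\<^sub>R B (e i) v)" by (simp only: l.sum l.scale)
    also have "\<dots> = (\<Sum>i\<in>UNIV. inn G (e i) u *\<^sub>R B (e i) (\<Sum>j\<in>UNIV. inn G (e j) v *\<^sub>R e j))"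
      using frame_expand[OF e(1), of v] by simp
    also have "\<dots> = (\<Sum>i\<in>UNIV. inn G (e i) u *\<^sub>R (\<Sum>j\<in>UNIV. inn G (e j) v *\<^sub>R B (e i) (e j)))"
      by (simp only: r.sum r.scale)
    finally show ?thesis by (simp add: scaleR_sum_right)
  qed
  have "(\<Sum>k\<in>UNIV. B (f k) (f k))
      = (\<Sum>k\<in>UNIV. \<Sum>i\<in>UNIV. \<Sum>j\<in>UNIV. (inn G (e i) (f k) * inn G (e j) (f k)) *\<^sub>R B (e i) (e j))"
    by (intro sum.cong refl exp)
  also have "\<dots> = (\<Sum>i\<in>UNIV. \<Sum>k\<in>UNIV. \<Sum>j\<in>UNIV. (inn G (e i) (f k) * inn G (e j) (f k)) *\<^sub>R B (e i) (e j))"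
    by (rule sum.swap)
  also have "\<dots> = (\<Sum>i\<in>UNIV. \<Sum>j\<in>UNIV. \<Sum>k\<in>UNIV. (inn G (e i) (f k) * inn G (e j) (f k)) *\<^sub>R B (e i) (e j))"
    by (intro sum.cong refl sum.swap)
  also have "\<dots> = (\<Sum>i\<in>UNIV. \<Sum>j\<in>UNIV. inn G (e i) (e j) *\<^sub>R B (e i) (e j))"
  proof -
    have "(\<Sum>k\<in>UNIV. inn G (e i) (f k) * inn G (e j) (f k)) = inn G (e i) (e j)" for i j
      unfolding inn_sym[of "e _" "f _"] by (rule frame_parseval[OF e(2)])
    then show ?thesis by (simp add: scaleR_sum_left[symmetric])
  qed
  also have "\<dots> = (\<Sum>k\<in>UNIV. B (e k) (e k))"
    using e(1) by (simp add: orthonormal_frame_def if_distrib[of "\<lambda>c. c *\<^sub>R _"] cong: if_cong)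
  finally show ?thesis .
qed

lemma trace_frame:
  assumes "orthonormal_frame G e" shows "trace A = (\<Sum>i\<in>UNIV. inn G (A *v e i) (e i))"
proof -
  let ?E = "frame_matrix e"
  have col: "?E *v axis i 1 = e i" for i
    by (simp add: frame_matrix_axis axis_def if_distrib[of "\<lambda>c. c *\<^sub>R _"] cong: if_cong)
  have "trace A = trace (A ** ?E ** (transpose ?E ** G))"
    using frame_matrix_gram(2)[OF assms] by (metis matrix_mul_assoc matrix_mul_rid)
  also have "\<dots> = trace (transpose ?E ** G ** (A ** ?E))"
    by (subst trace_mul_sym) simp
  also have "\<dots> = (\<Sum>i\<in>UNIV. ((transpose ?E ** G ** (A ** ?E)) *v axis i 1) $ i)"
    by (simp add: trace_def matrix_vector_mult_basis column_def)
  also have "\<dots> = (\<Sum>i\<in>UNIV. inn G (A *v e i) (e i))"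
    by (simp only: matrix_vector_mul_assoc[symmetric] frame_matrix_transpose col inn_def[symmetric] inn_sym)
  finally show ?thesis .
qed

text \<open>At most two vectors do not span a space of dimension 4; one Gram-Schmidt step does the rest.\<close>

lemma unit_orthogonal:
  assumes "card B \<le> 2" "finite B" "\<And>a b. a \<in> B \<Longrightarrow> b \<in> B \<Longrightarrow> inn G a b = (if a = b then 1 else 0)"
  obtains v where "inn G v v = 1" "\<And>b. b \<in> B \<Longrightarrow> inn G v b = 0"
proof -
  have "dim B \<le> 2" using dim_le_card[of B B] assms by (simp add: span_superset)
  have "span B \<noteq> (UNIV :: (real^4) set)"
  proof
    assume "span B = UNIV"
    then have "dim B = dim (UNIV :: (real^4) set)" by (metis dim_span)
    then show False using \<open>dim B \<le> 2\<close> by simp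
  qed
  then obtain w where w: "w \<notin> span B" by blast
  define z where "z = w - (\<Sum>b\<in>B. inn G w b *\<^sub>R b)"
  have "(\<Sum>b\<in>B. inn G w b *\<^sub>R b) \<in> span B" by (intro span_sum span_scale span_base)
  then have z: "z \<noteq> 0" using w by (auto simp: z_def)
  have zb: "inn G z b = 0" if "b \<in> B" for b
  proof -
    have "(\<Sum>a\<in>B. inn G w a * inn G a b) = (\<Sum>a\<in>B. if a = b then inn G w b else 0)"
      by (rule sum.cong) (use assms that in auto)
    then show ?thesis using assms(2) that by (simp add: z_def inn_algebra inn_sum)
  qed
  define v where "v = (1 / sqrt (inn G z z)) *\<^sub>R z"
  have "inn G v v = 1" using inn_pos[OF z] by (simp add: v_def inn_algebra real_sqrt_mult_self divide_simps)
  moreover have "inn G v b = 0" if "b \<in> B" for b using zb[OF that] by (simp add: v_def inn_algebra)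
  ultimately show ?thesis using that by blast
qed

end

locale hermitian_space_4 = metric_space_4 +
  fixes J :: "real^4^4"
  assumes J_sq: "J ** J = - mat 1" and J_skew: "J \<in> skew G"
begin

lemma J_J: "J *v (J *v v) = - v"
  by (simp add: matrix_vector_mul_assoc J_sq matvec_algebra)

lemma inn_J: "inn G (J *v u) v = - inn G u (J *v v)"
  using J_skew by (simp add: skew_def)

text \<open>A frame of the form \<open>e, J e, f, J f\<close>.  It is positively oriented, and in it \<open>J\<close> has entries
  0, 1 and -1 only.\<close>

definition adapted :: "(4 \<Rightarrow> real^4) \<Rightarrow> bool" where
  "adapted e \<longleftrightarrow> orthonormal_frame G e \<and> J *v e 1 = e 2 \<and> J *v e 3 = e 4"

lemma adapted_exists: "\<exists>e. adapted e"
proof -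
  obtain a where a: "inn G a a = 1" using unit_orthogonal[of "{}"] by auto
  have self: "inn G v (J *v v) = 0" "inn G (J *v v) v = 0" for v
    using inn_J[of v v] inn_sym[of "J *v v" v] by auto
  have nrm: "inn G (J *v v) (J *v w) = inn G v w" for v w
    using inn_J[of v "J *v w"] by (simp add: J_J inn_algebra)
  have "a \<noteq> J *v a"
  proof
    assume "a = J *v a"
    then have "inn G a a = inn G a (J *v a)" by (rule arg_cong)
    then show False using a self by simp
  qed
  then have two: "card {a, J *v a} \<le> 2" by simp
  have orth: "inn G c d = (if c = d then 1 else 0)" if "c \<in> {a, J *v a}" "d \<in> {a, J *v a}" for c d
    using that a self nrm \<open>a \<noteq> J *v a\<close> by auto
  obtain b where "inn G b b = 1" "\<And>c. c \<in> {a, J *v a} \<Longrightarrow> inn G b c = 0"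
    using unit_orthogonal[OF two _ orth] by blast
  then have b: "inn G b b = 1" "inn G b a = 0" "inn G b (J *v a) = 0" by auto
  let ?e = "\<lambda>i::4. if i = 1 then a else if i = 2 then J *v a else if i = 3 then b else J *v b"
  have "inn G a b = 0" "inn G (J *v a) b = 0" using b inn_sym by metis+
  moreover have "inn G (J *v b) a = 0" "inn G a (J *v b) = 0"
    using b inn_sym inn_J by (metis neg_equal_0_iff_equal)+
  ultimately have "adapted ?e"
    unfolding adapted_def orthonormal_frame_def forall_4 using a b self nrm by simp
  then show ?thesis by blast
qed

lemma frame_orthonormal: "orthonormal_frame G (frame G)"
proof -
  obtain e where "adapted e" using adapted_exists by blast
  then have "orthonormal_frame G e" by (simp add: adapted_def)
  then show ?thesis unfolding frame_def by (rule someI[where P="orthonormal_frame G"])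
qed

definition adj :: "real^4^4 \<Rightarrow> real^4^4" where
  "adj A = matrix_inv G ** transpose A ** G"

lemma inn_adj: "inn G (A *v u) v = inn G u (adj A *v v)"
proof -
  have "G ** adj A = transpose A ** G"
    by (simp add: adj_def matrix_mul_assoc matrix_inv_right4[OF invertible_metric])
  then have "inn G u (adj A *v v) = u \<bullet> (transpose A *v (G *v v))"
    by (simp add: inn_def matrix_vector_mul_assoc del: transpose_matrix_vector)
  then show ?thesis by (simp only: inner_transpose inn_def)
qed

text \<open>The Hodge star in closed form.  For skew \<open>A\<close> it is \<open>2 \<langle>J, A\<rangle> J + J A J\<close>: it fixes \<open>J\<close>
  and the skew endomorphisms that anticommute with \<open>J\<close>, and it is -1 on those that commute with \<open>J\<close> and
  are orthogonal to it.  This form depends smoothly on the metric and on \<open>J\<close>, without a frame.\<close>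

definition starf :: "real^4^4 \<Rightarrow> real^4^4" where
  "starf A = (- (1/2) * trace (J ** A)) *\<^sub>R J + (1/2) *\<^sub>R (J ** A ** J - J ** adj A ** J)"

text \<open>The volume form is a sum of three products of values of the fundamental form, so each of the
  three double sums is evaluated by Parseval's identity.\<close>

lemma star_starf: "star G J A = starf A"
proof -
  let ?f = "frame G"
  note fo = frame_orthonormal
  \<comment> \<open>The term in which both frame vectors are paired with each other by \<open>J\<close>.\<close>
  have s1: "(\<Sum>k\<in>UNIV. \<Sum>l\<in>UNIV. inn G (A *v ?f k) (?f l) * inn G (J *v ?f k) (?f l)) = - trace (J ** A)"
  proof -
    have "inn G (A *v a) (J *v a) = - inn G ((J ** A) *v a) a" for a
      using inn_J[of "A *v a" a] by (simp add: matrix_vector_mul_assoc)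
    then show ?thesis
      by (simp add: inn_sym[of _ "?f _"] frame_parseval[OF fo] trace_frame[OF fo] sum_negf)
  qed
  \<comment> \<open>The terms in which the frame vectors are paired with \<open>u\<close> and \<open>v\<close>; the third one has them exchanged.\<close>
  have s2: "(\<Sum>k\<in>UNIV. \<Sum>l\<in>UNIV. inn G (A *v ?f k) (?f l) * (inn G (J *v ?f k) u * inn G (J *v ?f l) v))
      = inn G (A *v (J *v u)) (J *v v)" for u v
  proof -
    have "(\<Sum>k\<in>UNIV. \<Sum>l\<in>UNIV. inn G (A *v ?f k) (?f l) * (inn G (J *v ?f k) u * inn G (J *v ?f l) v))
      = (\<Sum>k\<in>UNIV. inn G (?f k) (J *v u) * (\<Sum>l\<in>UNIV. inn G (?f l) (A *v ?f k) * inn G (?f l) (J *v v)))"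
      by (simp add: inn_J sum_distrib_left mult_ac inn_sym[of "A *v _"])
    also have "\<dots> = (\<Sum>k\<in>UNIV. inn G (?f k) (J *v u) * inn G (?f k) (adj A *v (J *v v)))"
      by (simp add: frame_parseval[OF fo] inn_adj)
    finally show ?thesis by (simp add: frame_parseval[OF fo] inn_adj)
  qed
  have key: "1/2 * (\<Sum>k\<in>UNIV. \<Sum>l\<in>UNIV. two_form G A (?f k) (?f l) * vol G J (?f k) (?f l) u v)
    = two_form G (starf A) u v" for u v
  proof -
    have "(\<Sum>k\<in>UNIV. \<Sum>l\<in>UNIV. two_form G A (?f k) (?f l) * vol G J (?f k) (?f l) u v)
      = (\<Sum>k\<in>UNIV. \<Sum>l\<in>UNIV. inn G (A *v ?f k) (?f l) * inn G (J *v ?f k) (?f l)) * inn G (J *v u) v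
       - (\<Sum>k\<in>UNIV. \<Sum>l\<in>UNIV. inn G (A *v ?f k) (?f l) * (inn G (J *v ?f k) u * inn G (J *v ?f l) v))
       + (\<Sum>k\<in>UNIV. \<Sum>l\<in>UNIV. inn G (A *v ?f k) (?f l) * (inn G (J *v ?f k) v * inn G (J *v ?f l) u))"
      by (simp add: two_form_def vol_def sum_distrib_right sum_distrib_left sum_subtractf sum.distrib algebra_simps)
    also have "\<dots> = - trace (J ** A) * inn G (J *v u) v - inn G (A *v (J *v u)) (J *v v) + inn G (A *v (J *v v)) (J *v u)"
      unfolding s1 s2 ..
    also have "inn G (A *v (J *v u)) (J *v v) = - inn G ((J ** A ** J) *v u) v"
      using inn_J[of "A *v (J *v u)" v] by (simp add: matrix_vector_mul_assoc matrix_mul_assoc)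
    also have "inn G (A *v (J *v v)) (J *v u) = - inn G ((J ** adj A ** J) *v u) v"
    proof -
      have "inn G (A *v (J *v v)) (J *v u) = - inn G v (J *v (adj A *v (J *v u)))"
        unfolding inn_adj[of A] by (rule inn_J)
      then show ?thesis unfolding inn_sym[of v] by (simp only: matrix_vector_mul_assoc matrix_mul_assoc)
    qed
    finally show ?thesis
      by (simp add: two_form_def starf_def matvec_algebra inn_algebra algebra_simps)
  qed
  show ?thesis
    unfolding star_def
  proof (rule the_equality)
    show "\<forall>u v. two_form G (starf A) u v = 1/2 * (\<Sum>k\<in>UNIV. \<Sum>l\<in>UNIV. two_form G A (?f k) (?f l) * vol G J (?f k) (?f l) u v)"
      using key by simp
    fix B assume "\<forall>u v. two_form G B u v = 1/2 * (\<Sum>k\<in>UNIV. \<Sum>l\<in>UNIV. two_form G A (?f k) (?f l) * vol G J (?f k) (?f l) u v)"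
    then have "inn G (B *v u) v = inn G (starf A *v u) v" for u v using key by (simp add: two_form_def)
    then show "B = starf A" by (intro matrix_eq_vec inn_eqI) auto
  qed
qed

lemma linear_adj: "linear adj"
  by (rule linearI) (simp_all add: adj_def matmul_algebra transpose_algebra)

lemma linear_starf: "linear starf"
  by (rule linearI) (simp_all add: starf_def matmul_algebra trace_algebra linear_add[OF linear_adj]
      linear_scale[OF linear_adj] algebra_simps)

end

text \<open>\<open>trace_on\<close> uses an arbitrary basis of the subspace; the usual change of basis argument applies
  because \<open>T\<close> maps the span of \<open>B\<close> into itself.\<close>

lemma trace_on_basis:
  assumes B: "independent B" "finite B" "span B = V" and T: "linear T"
    and m: "\<And>b. b \<in> B \<Longrightarrow> T b = (\<Sum>c\<in>B. m b c *\<^sub>R c)"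
  shows "trace_on V T = (\<Sum>b\<in>B. m b b)"
proof -
  define C where "C = (SOME B. independent B \<and> span B = V)"
  have C: "independent C" "span C = V"
    using someI[of "\<lambda>B. independent B \<and> span B = V" B] B by (auto simp: C_def)
  have finC: "finite C" using independent_span_bound[OF B(2) C(1)] B C span_superset by fastforce
  have CB: "c = (\<Sum>b\<in>B. representation B c b *\<^sub>R b)" if "c \<in> C" for c
    using sum_representation_eq[OF B(1) _ B(2) subset_refl, of c] B C span_base[OF that] by simp
  have CspanB: "c \<in> span B" if "c \<in> C" for c using B(3) C(2) span_base[OF that] by simp
  have inV: "T b \<in> V" if "b \<in> B" for b
    unfolding B(3)[symmetric] m[OF that] by (intro span_sum span_scale span_base)
  have repV: "representation C (T c) d = (\<Sum>b\<in>B. representation B c b * representation C (T b) d)" if "c \<in> C" for c d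
  proof -
    have "T c = (\<Sum>b\<in>B. representation B c b *\<^sub>R T b)"
      by (subst CB[OF that]) (simp add: linear_sum[OF T] linear_scale[OF T])
    then have "representation C (T c) d = representation C (\<Sum>b\<in>B. representation B c b *\<^sub>R T b) d" by simp
    also have "\<dots> = (\<Sum>b\<in>B. representation C (representation B c b *\<^sub>R T b) d)"
      by (subst representation_sum[OF C(1)]) (use inV C in \<open>auto intro: span_scale\<close>)
    also have "\<dots> = (\<Sum>b\<in>B. representation B c b * representation C (T b) d)"
      by (rule sum.cong) (use inV C in \<open>simp_all add: representation_scale[OF C(1)]\<close>)
    finally show ?thesis .
  qed
  have repB: "(\<Sum>c\<in>C. representation C v c * representation B c b) = representation B v b" if "v \<in> V" for v b
  proof -
    have "representation B v b = representation B (\<Sum>c\<in>C. representation C v c *\<^sub>R c) b"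
      using sum_representation_eq[OF C(1) _ finC subset_refl, of v] C that by simp
    also have "\<dots> = (\<Sum>c\<in>C. representation B (representation C v c *\<^sub>R c) b)"
      by (rule fun_cong[OF representation_sum[OF B(1)]]) (rule span_scale[OF CspanB])
    also have "\<dots> = (\<Sum>c\<in>C. representation C v c * representation B c b)"
      by (rule sum.cong) (simp_all add: representation_scale[OF B(1)] CspanB)
    finally show ?thesis by simp
  qed
  have "trace_on V T = (\<Sum>c\<in>C. representation C (T c) c)" by (simp add: trace_on_def C_def Let_def)
  also have "\<dots> = (\<Sum>c\<in>C. \<Sum>b\<in>B. representation B c b * representation C (T b) c)"
    by (simp add: repV)
  also have "\<dots> = (\<Sum>b\<in>B. \<Sum>c\<in>C. representation C (T b) c * representation B c b)"
    by (subst sum.swap) (simp add: mult.commute)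
  also have "\<dots> = (\<Sum>b\<in>B. representation B (T b) b)"
    by (simp add: repB inV)
  also have "\<dots> = (\<Sum>b\<in>B. m b b)"
  proof (rule sum.cong[OF refl])
    fix b assume b: "b \<in> B"
    have "representation B (T b) b = (\<Sum>c\<in>B. representation B (m b c *\<^sub>R c) b)"
      unfolding m[OF b] by (subst representation_sum[OF B(1)]) (auto intro: span_scale span_base)
    also have "\<dots> = (\<Sum>c\<in>B. if c = b then m b c else 0)"
      by (rule sum.cong) (simp_all add: representation_scale[OF B(1)] span_base representation_basis[OF B(1)])
    finally show "representation B (T b) b = m b b" using B(2) b by simp
  qed
  finally show ?thesis .
qed

text \<open>The operator \<open>Q = 3 / 2 \<langle>J, \<cdot>\<rangle> J - P / 2\<close>, where \<open>P\<close> is the projection to the self-dual forms,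
  extended by 0 to symmetric endomorphisms.
  It is obtained from \<open>\<langle>J, A\<rangle> = - tr (J A) / 4\<close> and the closed form of the Hodge star.\<close>

definition (in hermitian_space_4) Qf :: "real^4^4 \<Rightarrow> real^4^4" where
  "Qf A = (- (1/4) * trace (J ** A)) *\<^sub>R J
     - (1/4) *\<^sub>R ((1/2) *\<^sub>R (A - adj A) + J ** ((1/2) *\<^sub>R (A - adj A)) ** J)"

locale adapted_frame = hermitian_space_4 +
  fixes e :: "4 \<Rightarrow> real^4"
  assumes adapted: "adapted e"
begin

lemma orthonormal: "orthonormal_frame G e"
  using adapted by (simp add: adapted_def)

lemma inn_e: "inn G (e i) (e j) = (if i = j then 1 else 0)"
  using orthonormal by (simp add: orthonormal_frame_def)

lemma J_e: "J *v e 1 = e 2" "J *v e 2 = - e 1" "J *v e 3 = e 4" "J *v e 4 = - e 3"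
  using adapted J_J[of "e 1"] J_J[of "e 3"] by (auto simp: adapted_def)

text \<open>The entry of \<open>A (e i)\<close> at \<open>e j\<close>, as in the 2-form of \<open>A\<close>; this is the transpose of the usual
  matrix, so products appear in reversed order.\<close>

definition cm :: "real^4^4 \<Rightarrow> 4 \<Rightarrow> 4 \<Rightarrow> real" where
  "cm A i j = inn G (A *v e i) (e j)"

lemma matvec_e: "A *v e i = (\<Sum>j\<in>UNIV. cm A i j *\<^sub>R e j)"
  unfolding cm_def inn_sym[of _ "e _"] by (rule frame_expand[OF orthonormal])

lemma cm_eqI: assumes "\<And>i j. cm A i j = cm B i j" shows "A = B"
proof (rule matrix_eq_vec)
  fix v
  have "A *v e i = B *v e i" for i unfolding matvec_e assms ..
  then show "A *v v = B *v v"
    by (subst (1 2) frame_expand[OF orthonormal, of v]) (simp add: matvec_algebra)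
qed

lemma cm_algebra:
  "cm (A + B) i j = cm A i j + cm B i j" "cm (A - B) i j = cm A i j - cm B i j"
  "cm (- A) i j = - cm A i j" "cm (c *\<^sub>R A) i j = c * cm A i j" "cm 0 i j = 0"
  by (simp_all add: cm_def matvec_algebra inn_algebra)

lemma cm_mult: "cm (A ** B) i j = (\<Sum>k\<in>UNIV. cm B i k * cm A k j)"
proof -
  have "cm (A ** B) i j = inn G (A *v (\<Sum>k\<in>UNIV. cm B i k *\<^sub>R e k)) (e j)"
    unfolding matvec_e[symmetric] by (simp add: cm_def matrix_vector_mul_assoc)
  then show ?thesis by (simp add: matvec_algebra inn_sum inn_algebra cm_def[of A])
qed

lemma cm_adj: "cm (adj A) i j = cm A j i"
  using inn_adj[of A "e j" "e i"] inn_sym by (simp add: cm_def)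

lemma cm_trace: "trace A = (\<Sum>i\<in>UNIV. cm A i i)"
  by (simp add: trace_frame[OF orthonormal] cm_def)

lemma cm_skew: "A \<in> skew G \<longleftrightarrow> (\<forall>i j. cm A i j = - cm A j i)"
proof
  assume A: "A \<in> skew G"
  have "cm A i j = - cm A j i" for i j
  proof -
    have "inn G (A *v e i) (e j) = - inn G (e i) (A *v e j)" using A by (simp add: skew_def)
    then show ?thesis unfolding cm_def by (simp add: inn_sym[of "e i" "A *v e j"])
  qed
  then show "\<forall>i j. cm A i j = - cm A j i" by blast
next
  assume *: "\<forall>i j. cm A i j = - cm A j i"
  have "adj A = - A"
  proof (rule cm_eqI)
    fix i j show "cm (adj A) i j = cm (- A) i j"
      unfolding cm_adj cm_algebra using * by blast
  qed
  then show "A \<in> skew G"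
    unfolding skew_def by (simp add: inn_adj[of A] matvec_algebra inn_algebra)
qed

lemma cm_J: "cm J i j = (if (i,j) = (1,2) \<or> (i,j) = (3,4) then 1 else if (i,j) = (2,1) \<or> (i,j) = (4,3) then -1 else 0)"
  using exhaust_4[of i] by (elim disjE) (auto simp: cm_def J_e inn_e inn_algebra)

definition of_cm :: "(4 \<Rightarrow> 4 \<Rightarrow> real) \<Rightarrow> real^4^4" where
  "of_cm c = matrix (\<lambda>v. \<Sum>i\<in>UNIV. \<Sum>j\<in>UNIV. (c i j * inn G (e i) v) *\<^sub>R e j)"

lemma cm_of_cm: "cm (of_cm c) i j = c i j"
proof -
  have "linear (\<lambda>v. \<Sum>i\<in>UNIV. \<Sum>j\<in>UNIV. (c i j * inn G (e i) v) *\<^sub>R e j)"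
    by (intro linear_compose_sum ballI linearI) (simp_all add: inn_algebra algebra_simps)
  then show ?thesis
    by (simp add: cm_def of_cm_def matrix_works4 inn_sum inn_algebra inn_e if_distrib[of "\<lambda>c. _ * c"] cong: if_cong)
qed

text \<open>Together with \<open>J\<close>, the following two endomorphisms form an orthonormal basis of the self-dual
  forms: they map \<open>e 1\<close> to \<open>e 3\<close> and to \<open>e 4\<close>, respectively, and anticommute with \<open>J\<close>.\<close>

definition I2 :: "real^4^4" where
  "I2 = of_cm (\<lambda>i j. if (i,j) = (1,3) \<or> (i,j) = (4,2) then 1 else if (i,j) = (3,1) \<or> (i,j) = (2,4) then -1 else 0)"

definition I3 :: "real^4^4" where
  "I3 = of_cm (\<lambda>i j. if (i,j) = (1,4) \<or> (i,j) = (2,3) then 1 else if (i,j) = (4,1) \<or> (i,j) = (3,2) then -1 else 0)"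

lemma cm_I2: "cm I2 i j = (if (i,j) = (1,3) \<or> (i,j) = (4,2) then 1 else if (i,j) = (3,1) \<or> (i,j) = (2,4) then -1 else 0)"
  by (simp only: I2_def cm_of_cm)

lemma cm_I3: "cm I3 i j = (if (i,j) = (1,4) \<or> (i,j) = (2,3) then 1 else if (i,j) = (4,1) \<or> (i,j) = (3,2) then -1 else 0)"
  by (simp only: I3_def cm_of_cm)

lemmas cm_basis = cm_J cm_I2 cm_I3

lemma cm_skew_eqI:
  assumes "A \<in> skew G" "B \<in> skew G"
    and "cm A 1 2 = cm B 1 2" "cm A 1 3 = cm B 1 3" "cm A 1 4 = cm B 1 4"
      "cm A 2 3 = cm B 2 3" "cm A 2 4 = cm B 2 4" "cm A 3 4 = cm B 3 4"
  shows "A = B"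
proof (rule cm_eqI)
  have sk: "cm C j i = - cm C i j" if "C \<in> skew G" for C i j using that cm_skew by blast
  have diag: "cm C i i = 0" if "C \<in> skew G" for C i using sk[OF that, of i i] by simp
  fix i j
  note swap = sk[of _ 2 1] sk[of _ 3 1] sk[of _ 3 2] sk[of _ 4 1] sk[of _ 4 2] sk[of _ 4 3]
  show "cm A i j = cm B i j"
    using exhaust_4[of i] exhaust_4[of j]
    by (elim disjE) (simp_all only: diag swap assms)
qed

lemma skew_basis: "J \<in> skew G" "I2 \<in> skew G" "I3 \<in> skew G"
  by (simp_all add: J_skew cm_skew cm_basis forall_4)

text \<open>The coordinates of the self-dual part of \<open>A\<close> with respect to \<open>J\<close>, \<open>I2\<close> and \<open>I3\<close>.\<close>

definition p1 :: "real^4^4 \<Rightarrow> real" where "p1 A = (cm A 1 2 - cm A 2 1 + cm A 3 4 - cm A 4 3) / 4"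
definition p2 :: "real^4^4 \<Rightarrow> real" where "p2 A = (cm A 1 3 - cm A 3 1 - cm A 2 4 + cm A 4 2) / 4"
definition p3 :: "real^4^4 \<Rightarrow> real" where "p3 A = (cm A 1 4 - cm A 4 1 + cm A 2 3 - cm A 3 2) / 4"

text \<open>\<open>Wp\<close> applies \<open>Weyl_op\<close> to the endomorphism on the left, whose symmetric part is killed by \<open>Weyl_op\<close>;
  so this reduces \<open>Wp\<close> to the three basis forms.\<close>

lemma projection_cm:
  "(1/2) *\<^sub>R (A + starf A) = (1/4) *\<^sub>R (A + adj A) + p1 A *\<^sub>R J + p2 A *\<^sub>R I2 + p3 A *\<^sub>R I3"
proof (rule cm_eqI)
  fix i j
  show "cm ((1/2) *\<^sub>R (A + starf A)) i j = cm ((1/4) *\<^sub>R (A + adj A) + p1 A *\<^sub>R J + p2 A *\<^sub>R I2 + p3 A *\<^sub>R I3) i j"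
    using exhaust_4[of i] exhaust_4[of j]
    by (elim disjE) (simp_all add: starf_def cm_algebra cm_mult cm_trace cm_adj sum_4 cm_basis p1_def p2_def p3_def field_simps)
qed

lemma adj_skew: "A \<in> skew G \<Longrightarrow> adj A = - A"
proof (rule cm_eqI)
  fix i j assume "A \<in> skew G"
  then have "cm A j i = - cm A i j" unfolding cm_skew by blast
  then show "cm (adj A) i j = cm (- A) i j" unfolding cm_adj cm_algebra .
qed

lemma p_basis:
  "p1 J = 1" "p2 J = 0" "p3 J = 0" "p1 I2 = 0" "p2 I2 = 1" "p3 I2 = 0" "p1 I3 = 0" "p2 I3 = 0" "p3 I3 = 1"
  by (simp_all add: p1_def p2_def p3_def cm_basis)

lemma starf_basis: "starf J = J" "starf I2 = I2" "starf I3 = I3"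
proof -
  have "starf A = A" if "A \<in> skew G" "p1 A *\<^sub>R J + p2 A *\<^sub>R I2 + p3 A *\<^sub>R I3 = A" for A
  proof -
    have "(1/2) *\<^sub>R (A + starf A) = A"
      using projection_cm[of A] that adj_skew[OF that(1)] by (simp add: add.assoc)
    from arg_cong[OF this, of "\<lambda>X. 2 *\<^sub>R X"] show ?thesis by (simp add: scaleR_2)
  qed
  then show "starf J = J" "starf I2 = I2" "starf I3 = I3" by (simp_all add: skew_basis p_basis)
qed

lemma Lambda_plus_span: "Lambda_plus G J = span {J, I2, I3}"
proof
  show "Lambda_plus G J \<subseteq> span {J, I2, I3}"
  proof
    fix A assume "A \<in> Lambda_plus G J"
    then have A: "A \<in> skew G" "starf A = A" by (simp_all add: Lambda_plus_def star_starf)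
    have "A = p1 A *\<^sub>R J + p2 A *\<^sub>R I2 + p3 A *\<^sub>R I3"
      using projection_cm[of A] A(2) adj_skew[OF A(1)] by simp
    also have "\<dots> \<in> span {J, I2, I3}" by (intro span_add span_scale span_base) auto
    finally show "A \<in> span {J, I2, I3}" .
  qed
  have "subspace (Lambda_plus G J)"
    unfolding Lambda_plus_def star_starf subspace_def skew_def
    by (auto simp: matvec_algebra inn_algebra linear_0[OF linear_starf] linear_add[OF linear_starf] linear_scale[OF linear_starf])
  moreover have "{J, I2, I3} \<subseteq> Lambda_plus G J"
    by (simp add: Lambda_plus_def star_starf starf_basis skew_basis)
  ultimately show "span {J, I2, I3} \<subseteq> Lambda_plus G J" by (simp add: span_minimal)
qed

lemma distinct_basis: "J \<noteq> I2" "J \<noteq> I3" "I2 \<noteq> I3"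
  using p_basis by force+

lemma independent_basis: "independent {J, I2, I3}"
proof -
  have p: "p1 (a *\<^sub>R J + b *\<^sub>R I2 + c *\<^sub>R I3) = a" "p2 (a *\<^sub>R J + b *\<^sub>R I2 + c *\<^sub>R I3) = b"
    "p3 (a *\<^sub>R J + b *\<^sub>R I2 + c *\<^sub>R I3) = c" for a b c
    by (simp_all add: p1_def p2_def p3_def cm_algebra cm_basis)
  have p0: "p1 0 = 0" "p2 0 = 0" "p3 0 = 0" by (simp_all add: p1_def p2_def p3_def cm_algebra)
  show ?thesis
    unfolding independent_explicit
  proof (intro conjI allI impI)
    fix u :: "real^4^4 \<Rightarrow> real" assume "(\<Sum>v\<in>{J, I2, I3}. u v *\<^sub>R v) = 0"
    then have z: "u J *\<^sub>R J + u I2 *\<^sub>R I2 + u I3 *\<^sub>R I3 = 0" using distinct_basis by (simp add: add.assoc)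
    show "\<forall>v\<in>{J, I2, I3}. u v = 0"
      using p[of "u J" "u I2" "u I3"] unfolding z p0 by simp
  qed simp
qed

lemma Qf_cm: "Qf A = p1 A *\<^sub>R J - (1/2) *\<^sub>R (p2 A *\<^sub>R I2 + p3 A *\<^sub>R I3)"
proof (rule cm_eqI)
  fix i j
  show "cm (Qf A) i j = cm (p1 A *\<^sub>R J - (1/2) *\<^sub>R (p2 A *\<^sub>R I2 + p3 A *\<^sub>R I3)) i j"
    using exhaust_4[of i] exhaust_4[of j]
    by (elim disjE) (simp_all add: Qf_def cm_algebra cm_mult cm_trace cm_adj sum_4 cm_basis p1_def p2_def p3_def field_simps)
qed

text \<open>This expresses that the projection to the self-dual forms is parallel: for \<open>N = \<nabla>J\<close> the
  difference of both sides is the derivative of the Hodge star in its closed form.  On self-dual \<open>A\<close>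
  it follows from the quaternion relations; an anti-self-dual \<open>A\<close> commutes with \<open>J\<close> and \<open>N\<close> and is
  orthogonal to them, so that both sides are 0.\<close>

lemma anticommutator_identity:
  assumes N: "N \<in> skew G" "N ** J = - (J ** N)" and A: "A \<in> skew G"
  shows "N ** A ** J + J ** A ** N = (1/2) *\<^sub>R (trace (N ** A) *\<^sub>R J + trace (J ** A) *\<^sub>R N)"
proof -
  have n: "cm (N ** J) i j = - cm (J ** N) i j" for i j unfolding N(2) cm_algebra ..
  have sk: "cm C j i = - cm C i j" if "C \<in> skew G" for C i j using that cm_skew by blast
  have diag: "cm C i i = 0" if "C \<in> skew G" for C i using sk[OF that, of i i] by simp
  note sks = sk[of _ 2 1] sk[of _ 3 1] sk[of _ 3 2] sk[of _ 4 1] sk[of _ 4 2] sk[of _ 4 3]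
  have n12: "cm N 1 2 = 0" using n[of 1 1] by (simp add: cm_mult sum_4 cm_basis sks N(1))
  have n34: "cm N 3 4 = 0" using n[of 3 3] by (simp add: cm_mult sum_4 cm_basis sks N(1))
  have n24: "cm N 2 4 = - cm N 1 3" using n[of 1 4] by (simp add: cm_mult sum_4 cm_basis sks N(1))
  have n23: "cm N 2 3 = cm N 1 4" using n[of 1 3] by (simp add: cm_mult sum_4 cm_basis sks N(1))
  show ?thesis
  proof (rule cm_eqI)
    fix i j
    show "cm (N ** A ** J + J ** A ** N) i j = cm ((1/2) *\<^sub>R (trace (N ** A) *\<^sub>R J + trace (J ** A) *\<^sub>R N)) i j"
      using exhaust_4[of i] exhaust_4[of j]
      by (elim disjE) (simp_all add: cm_algebra cm_mult cm_trace sum_4 cm_basis sks N(1) A diag n12 n34 n24 n23 field_simps)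
  qed
qed

end

section \<open>The self-dual Weyl operator at a point\<close>

text \<open>An algebraic curvature tensor on a Hermitian vector space.  The chart enters only through
  the symmetries of its curvature at the point.\<close>

locale curvature_point = hermitian_space_4 "g x" "J x" for g J :: mfield and x :: point +
  assumes Riem_linear: "linear (\<lambda>u. Riem g x u v w)"
    and Riem_linear_arg: "linear (\<lambda>w. Riem g x u v w)"
    and Riem_antisym: "Riem g x v u w = - Riem g x u v w"
    and Riem_skew: "inn (g x) (Riem g x u v a) b = - inn (g x) a (Riem g x u v b)"
    and Riem_bianchi: "Riem g x u v w + Riem g x v w u + Riem g x w u v = 0"
begin

lemma Riem_linear_snd: "linear (\<lambda>v. Riem g x u v w)"
  using linear_compose_neg[OF Riem_linear, of u w] unfolding Riem_antisym[of u, symmetric] .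

lemma Ric_frame:
  assumes "orthonormal_frame (g x) e"
  shows "Ric g x u = (\<Sum>k\<in>UNIV. Riem g x u (e k) (e k))"
  unfolding Ric_def
  by (rule frame_sum_indep[OF _ assms frame_orthonormal])
    (simp add: bilinear_def Riem_linear_snd Riem_linear_arg)

lemma linear_Ric: "linear (Ric g x)"
  unfolding Ric_def by (rule linear_compose_sum) (simp add: Riem_linear)

lemma scal_frame:
  assumes "orthonormal_frame (g x) e"
  shows "scal g x = (\<Sum>i\<in>UNIV. \<Sum>k\<in>UNIV. inn (g x) (Riem g x (e i) (e k) (e k)) (e i))"
  by (simp add: scal_def trace_frame[OF assms] matrix_works4[OF linear_Ric] Ric_frame[OF assms] inn_sum)

lemma scal_star_frame:
  assumes "orthonormal_frame (g x) e"
  shows "scal_star g J x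
    = (\<Sum>i\<in>UNIV. \<Sum>k\<in>UNIV. inn (g x) (Riem g x (J x *v e i) (J x *v e k) (e k)) (e i))"
proof -
  have lin: "linear (\<lambda>v. Riem g x u (J x *v v) w)" "linear (\<lambda>v. Riem g x (J x *v v) u w)" for u w
    using linear_compose[OF linear_matvec Riem_linear_snd]
      linear_compose[OF linear_matvec Riem_linear] by (simp_all add: o_def)
  have Rs: "Ric_star g J x u = (\<Sum>k\<in>UNIV. Riem g x (J x *v u) (J x *v e k) (e k))" for u
    unfolding Ric_star_def
    by (rule frame_sum_indep[OF _ assms frame_orthonormal])
      (simp add: bilinear_def lin Riem_linear_arg)
  have "linear (Ric_star g J x)"
    unfolding Rs by (rule linear_compose_sum) (simp add: lin)
  then show ?thesis
    by (simp add: scal_star_def trace_frame[OF assms] matrix_works4 Rs inn_sum)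
qed

lemma Weyl_linear:
  "linear (\<lambda>u. Weyl g x u v w)" "linear (\<lambda>v. Weyl g x u v w)" "linear (\<lambda>w. Weyl g x u v w)"
  by (rule linearI; simp add: Weyl_def linear_add[OF Riem_linear] linear_scale[OF Riem_linear]
      linear_add[OF Riem_linear_snd] linear_scale[OF Riem_linear_snd]
      linear_add[OF Riem_linear_arg] linear_scale[OF Riem_linear_arg]
      linear_add[OF linear_Ric] linear_scale[OF linear_Ric] inn_algebra algebra_simps)+

lemma Weyl_op_works:
  assumes "orthonormal_frame (g x) e"
  shows "Weyl_op g x A *v w = (\<Sum>k\<in>UNIV. Weyl g x (A *v e k) (e k) w)"
proof -
  have "linear (\<lambda>v. Weyl g x (A *v v) u w)" for u w
    using linear_compose[OF linear_matvec Weyl_linear(1)] by (simp add: o_def)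
  then have "(\<Sum>k\<in>UNIV. Weyl g x (A *v frame (g x) k) (frame (g x) k) w) = (\<Sum>k\<in>UNIV. Weyl g x (A *v e k) (e k) w)"
    by (intro frame_sum_indep[OF _ assms frame_orthonormal, of "\<lambda>u v. Weyl g x (A *v u) v w"])
      (simp add: bilinear_def Weyl_linear)
  moreover have "linear (\<lambda>w. \<Sum>k\<in>UNIV. Weyl g x (A *v frame (g x) k) (frame (g x) k) w)"
    by (rule linear_compose_sum) (simp add: Weyl_linear)
  ultimately show ?thesis by (simp add: Weyl_op_def matrix_works4)
qed

lemma linear_Weyl_op: "linear (Weyl_op g x)"
  by (rule linearI; rule matrix_eq_vec)
    (simp_all add: Weyl_op_works[OF frame_orthonormal] matvec_algebra linear_add[OF Weyl_linear(1)]
      linear_scale[OF Weyl_linear(1)] sum.distrib scaleR_sum_right)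

end

locale curvature_frame = curvature_point + adapted_frame "g x" "J x" e
  for e
begin

definition r :: "4 \<Rightarrow> 4 \<Rightarrow> 4 \<Rightarrow> 4 \<Rightarrow> real" where
  "r i j k l = inn (g x) (Riem g x (e i) (e j) (e k)) (e l)"

lemma r_antisym: "r j i k l = - r i j k l" "r i j l k = - r i j k l"
  using Riem_antisym[of "e j" "e i" "e k"] Riem_skew[of "e i" "e j" "e k" "e l"] inn_sym
  by (simp_all add: r_def inn_algebra)

lemma r_bianchi: "r i j k l + r j k i l + r k i j l = 0"
  using arg_cong[OF Riem_bianchi[of "e i" "e j" "e k"], of "\<lambda>v. inn (g x) v (e l)"]
  by (simp add: r_def inn_algebra)

text \<open>The pair symmetry of an algebraic curvature tensor, by adding the Bianchi identity over the four
  cyclic permutations of the indices.\<close>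

lemma r_pair: "r i j k l = r k l i j"
  using r_bianchi[of i j k l] r_bianchi[of j k l i] r_bianchi[of k l i j] r_bianchi[of l i j k]
    r_antisym(1)[of i j] r_antisym(2)[of i j] r_antisym(1)[of k l]  r_antisym(2)
  by (smt (verit) r_antisym)

lemma r_zero: "r i i k l = 0" "r i j k k = 0"
  using r_antisym(1)[of i i k l] r_antisym(2)[of i j k k] by auto

text \<open>Rewriting with these facts and \<open>r_1423\<close> leaves 20 components, the dimension of the space of
  algebraic curvature tensors, so that linear identities for the curvature reduce to arithmetic.\<close>

lemmas r_normal =
  r_zero
  r_antisym(1)[of 2 1] r_antisym(1)[of 3 1] r_antisym(1)[of 4 1]
  r_antisym(1)[of 3 2] r_antisym(1)[of 4 2] r_antisym(1)[of 4 3]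
  r_antisym(2)[of _ _ 2 1] r_antisym(2)[of _ _ 3 1] r_antisym(2)[of _ _ 4 1]
  r_antisym(2)[of _ _ 3 2] r_antisym(2)[of _ _ 4 2] r_antisym(2)[of _ _ 4 3]
  r_pair[of 1 3 1 2] r_pair[of 1 4 1 2] r_pair[of 2 3 1 2] r_pair[of 2 4 1 2] r_pair[of 3 4 1 2]
  r_pair[of 1 4 1 3] r_pair[of 2 3 1 3] r_pair[of 2 4 1 3] r_pair[of 3 4 1 3]
  r_pair[of 2 3 1 4] r_pair[of 2 4 1 4] r_pair[of 3 4 1 4]
  r_pair[of 2 4 2 3] r_pair[of 3 4 2 3] r_pair[of 3 4 2 4]

lemma r_1423: "r 1 4 2 3 = r 1 3 2 4 - r 1 2 3 4"
  using r_bianchi[of 1 2 3 4] r_pair[of 2 3 1 4] r_antisym(1)[of 3 1 2 4] by simp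

definition ric :: "4 \<Rightarrow> 4 \<Rightarrow> real" where "ric i j = (\<Sum>m\<in>UNIV. r i m m j)"

lemma inn_Ric: "inn (g x) (Ric g x (e i)) (e j) = ric i j"
  by (simp add: Ric_frame[OF orthonormal] ric_def r_def inn_sum)

lemma scal_ric: "scal g x = (\<Sum>i\<in>UNIV. ric i i)"
  by (simp add: scal_frame[OF orthonormal] ric_def r_def)

definition kd :: "4 \<Rightarrow> 4 \<Rightarrow> real" where "kd i j = (if i = j then 1 else 0)"

text \<open>The components of the Weyl tensor, see \<open>inn_Weyl\<close>.\<close>

definition w :: "4 \<Rightarrow> 4 \<Rightarrow> 4 \<Rightarrow> 4 \<Rightarrow> real" where
  "w l k i j = r l k i j
     - 1/2 * (kd k i * ric l j - kd l i * ric k j + kd l j * ric k i - kd k j * ric l i)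
     + scal g x / 6 * (kd k i * kd l j - kd l i * kd k j)"

lemma inn_Weyl: "inn (g x) (Weyl g x (e l) (e k) (e i)) (e j) = w l k i j"
  by (simp add: Weyl_def w_def inn_algebra inn_e kd_def[symmetric] inn_Ric r_def algebra_simps)

lemma cm_Weyl_op: "cm (Weyl_op g x A) i j = (\<Sum>k\<in>UNIV. \<Sum>l\<in>UNIV. cm A k l * w l k i j)"
  by (simp add: cm_def[of "Weyl_op g x A"] Weyl_op_works[OF orthonormal] matvec_e[of A] linear_sum[OF Weyl_linear(1)]
      linear_scale[OF Weyl_linear(1)] inn_sum inn_algebra inn_Weyl)

lemma ric_values:
  "ric 1 1 = - (r 1 2 1 2 + r 1 3 1 3 + r 1 4 1 4)" "ric 2 2 = - (r 1 2 1 2 + r 2 3 2 3 + r 2 4 2 4)"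
  "ric 3 3 = - (r 1 3 1 3 + r 2 3 2 3 + r 3 4 3 4)" "ric 4 4 = - (r 1 4 1 4 + r 2 4 2 4 + r 3 4 3 4)"
  "ric 1 2 = - r 1 3 2 3 - r 1 4 2 4" "ric 2 1 = - r 1 3 2 3 - r 1 4 2 4"
  "ric 1 3 = r 1 2 2 3 - r 1 4 3 4" "ric 3 1 = r 1 2 2 3 - r 1 4 3 4"
  "ric 1 4 = r 1 2 2 4 + r 1 3 3 4" "ric 4 1 = r 1 2 2 4 + r 1 3 3 4"
  "ric 2 3 = - r 1 2 1 3 - r 2 4 3 4" "ric 3 2 = - r 1 2 1 3 - r 2 4 3 4"
  "ric 2 4 = - r 1 2 1 4 + r 2 3 3 4" "ric 4 2 = - r 1 2 1 4 + r 2 3 3 4"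
  "ric 3 4 = - r 1 3 1 4 - r 2 3 2 4" "ric 4 3 = - r 1 3 1 4 - r 2 3 2 4"
  by (simp_all add: ric_def sum_4 r_normal)

lemma scal_value:
  "scal g x = - 2 * (r 1 2 1 2 + r 1 3 1 3 + r 1 4 1 4 + r 2 3 2 3 + r 2 4 2 4 + r 3 4 3 4)"
  by (simp add: scal_ric sum_4 ric_values)

lemma scal_star_value: "scal_star g J x = - 2 * (r 1 2 1 2 + r 3 4 3 4 + 2 * r 1 2 3 4)"
  by (simp add: scal_star_frame[OF orthonormal] sum_4 J_e r_def[symmetric] linear_neg[OF Riem_linear]
      linear_neg[OF Riem_linear_snd] inn_algebra r_normal r_1423)

lemma w_antisym: "w k l i j = - w l k i j" "w l k j i = - w l k i j"
  by (simp_all add: w_def r_antisym(1)[of l k i j] r_antisym(2)[of l k j i] algebra_simps)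

lemma skew_Weyl_op: "Weyl_op g x A \<in> skew (g x)"
  unfolding cm_skew cm_Weyl_op sum_negf[symmetric]
proof (intro allI sum.cong refl)
  fix i j k l show "cm A k l * w l k i j = - (cm A k l * w l k j i)"
    by (subst w_antisym(2)) simp
qed

lemma cm_Weyl_skew:
  assumes "A \<in> skew (g x)"
  shows "cm (Weyl_op g x A) i j = - 2 * (cm A 1 2 * w 1 2 i j + cm A 1 3 * w 1 3 i j + cm A 1 4 * w 1 4 i j
    + cm A 2 3 * w 2 3 i j + cm A 2 4 * w 2 4 i j + cm A 3 4 * w 3 4 i j)"
proof -
  have sk: "cm A j i = - cm A i j" for i j using assms cm_skew by blast
  have "cm A i i = 0" for i using sk[of i i] by simp
  then show ?thesis
    by (simp add: cm_Weyl_op sum_4 sk[of 2 1] sk[of 3 1] sk[of 3 2] sk[of 4 1] sk[of 4 2] sk[of 4 3]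
        w_antisym(1)[of 2 1] w_antisym(1)[of 3 1] w_antisym(1)[of 3 2] w_antisym(1)[of 4 1] w_antisym(1)[of 4 2] w_antisym(1)[of 4 3])
qed

lemma Weyl_op_sym: "Weyl_op g x (A + adj A) = 0"
proof (rule cm_eqI)
  fix i j
  have "(\<Sum>k\<in>UNIV. \<Sum>l\<in>UNIV. cm (adj A) k l * w l k i j) = (\<Sum>l\<in>UNIV. \<Sum>k\<in>UNIV. cm A l k * w l k i j)"
    by (subst sum.swap) (simp add: cm_adj)
  also have "\<dots> = - (\<Sum>k\<in>UNIV. \<Sum>l\<in>UNIV. cm A k l * w l k i j)"
    unfolding sum_negf[symmetric] 
  proof (intro sum.cong refl)
    fix k l show "cm A k l * w k l i j = - (cm A k l * w l k i j)"
      by (subst w_antisym(1)) simp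
  qed
  finally show "cm (Weyl_op g x (A + adj A)) i j = cm 0 i j"
    by (simp add: cm_Weyl_op cm_algebra distrib_right sum.distrib)
qed

text \<open>The matrix of \<open>W\<^sub>+\<close> with respect to the basis \<open>J\<close>, \<open>I2\<close>, \<open>I3\<close>.\<close>

definition "t11 = - 2 * (w 1 2 1 2 + w 3 4 1 2)"
definition "t12 = - 2 * (w 1 2 1 3 + w 3 4 1 3)"
definition "t13 = - 2 * (w 1 2 1 4 + w 3 4 1 4)"
definition "t22 = - 2 * (w 1 3 1 3 - w 2 4 1 3)"
definition "t23 = - 2 * (w 1 3 1 4 - w 2 4 1 4)"
definition "t33 = - 2 * (w 1 4 1 4 + w 2 3 1 4)"

lemmas t_defs = t11_def t12_def t13_def t22_def t23_def t33_def

lemmas w_value = w_def kd_def ric_values scal_value r_normal r_1423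

lemma skew_combination: "a *\<^sub>R J x + b *\<^sub>R I2 + c *\<^sub>R I3 \<in> skew (g x)"
  using skew_basis by (auto simp: skew_def matvec_algebra inn_algebra algebra_simps)

text \<open>That the Weyl tensor preserves self-duality and is self-adjoint shows here in the
  absence of anti-self-dual terms and in the symmetry of the coefficients.\<close>

lemma Weyl_basis:
  "Weyl_op g x (J x) = t11 *\<^sub>R J x + t12 *\<^sub>R I2 + t13 *\<^sub>R I3"
  "Weyl_op g x I2 = t12 *\<^sub>R J x + t22 *\<^sub>R I2 + t23 *\<^sub>R I3"
  "Weyl_op g x I3 = t13 *\<^sub>R J x + t23 *\<^sub>R I2 + t33 *\<^sub>R I3"
  by (rule cm_skew_eqI[OF skew_Weyl_op skew_combination];
      simp add: cm_Weyl_skew skew_basis cm_algebra cm_basis t_defs w_value field_simps)+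

lemma t_trace: "t11 + t22 + t33 = 0"
  by (simp add: t_defs w_value field_simps)

lemma t11_scal: "t11 = 1/2 * (scal_star g J x - scal g x / 3)"
  by (simp add: t_defs w_value scal_star_value field_simps)

lemma Wp_basis: "Wp g J x A = p1 A *\<^sub>R (t11 *\<^sub>R J x + t12 *\<^sub>R I2 + t13 *\<^sub>R I3)
    + p2 A *\<^sub>R (t12 *\<^sub>R J x + t22 *\<^sub>R I2 + t23 *\<^sub>R I3)
    + p3 A *\<^sub>R (t13 *\<^sub>R J x + t23 *\<^sub>R I2 + t33 *\<^sub>R I3)"
  unfolding Wp_def star_starf projection_cm
  by (simp add: linear_add[OF linear_Weyl_op] linear_scale[OF linear_Weyl_op]
      Weyl_op_sym[unfolded linear_add[OF linear_Weyl_op]] Weyl_basis del: scaleR_add_right)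

lemma linear_Wp: "linear (Wp g J x)"
  unfolding Wp_def star_starf
  by (rule linearI) (simp_all add: linear_add[OF linear_Weyl_op] linear_scale[OF linear_Weyl_op]
      linear_add[OF linear_starf] linear_scale[OF linear_starf] algebra_simps)

lemma Wp_sqnorm_t: "Wp_sqnorm g J x = t11^2 + t22^2 + t33^2 + 2 * (t12^2 + t13^2 + t23^2)"
proof -
  let ?T = "Wp g J x \<circ> Wp g J x"
  define m where "m b c = (if c = J x then p1 (?T b) else if c = I2 then p2 (?T b) else p3 (?T b))" for b c
  have lin: "linear ?T" by (rule linear_compose[OF linear_Wp linear_Wp])
  have p: "p1 (Wp g J x A) = p1 A * t11 + p2 A * t12 + p3 A * t13"
    "p2 (Wp g J x A) = p1 A * t12 + p2 A * t22 + p3 A * t23"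
    "p3 (Wp g J x A) = p1 A * t13 + p2 A * t23 + p3 A * t33" for A
    unfolding Wp_basis p1_def[of "_ + _"] p2_def[of "_ + _"] p3_def[of "_ + _"]
    by (simp_all add: cm_algebra cm_basis algebra_simps)
  have W: "Wp g J x A = p1 (Wp g J x A) *\<^sub>R J x + p2 (Wp g J x A) *\<^sub>R I2 + p3 (Wp g J x A) *\<^sub>R I3" for A
    unfolding p by (simp add: Wp_basis algebra_simps)
  have "trace_on (Lambda_plus (g x) (J x)) ?T = (\<Sum>b\<in>{J x, I2, I3}. m b b)"
  proof (rule trace_on_basis[OF independent_basis _ Lambda_plus_span[symmetric] lin, where m=m])
    fix b assume "b \<in> {J x, I2, I3}"
    show "?T b = (\<Sum>c\<in>{J x, I2, I3}. m b c *\<^sub>R c)"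
      using distinct_basis W[of "Wp g J x b"] by (auto simp: m_def add.assoc)
  qed simp
  also have "\<dots> = p1 (?T (J x)) + p2 (?T I2) + p3 (?T I3)"
    using distinct_basis by (simp add: m_def add.assoc)
  also have "\<dots> = t11^2 + t22^2 + t33^2 + 2 * (t12^2 + t13^2 + t23^2)"
    by (simp add: p p_basis power2_eq_square)
  finally show ?thesis by (simp add: Wp_sqnorm_def)
qed

text \<open>As the trace is 0, the square norm minus \<open>3 / 2 t11\<^sup>2\<close> is
  \<open>2 (t22 + t11 / 2)\<^sup>2\<close> plus twice the squares of the entries above the diagonal.\<close>

lemma norm_condition_t:
  "Wp_sqnorm g J x = 3/8 * (scal_star g J x - scal g x / 3)^2 \<longleftrightarrow>
    t12 = 0 \<and> t13 = 0 \<and> t23 = 0 \<and> t22 = - t11/2 \<and> t33 = - t11/2"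
proof -
  have t33: "t33 = - t11 - t22" using t_trace by simp
  have "3/8 * (scal_star g J x - scal g x / 3)^2 = 3/2 * t11^2"
    unfolding t11_scal by (simp add: power2_eq_square)
  moreover have "t11^2 + t22^2 + t33^2 + 2 * (t12^2 + t13^2 + t23^2) - 3/2 * t11^2
     = 2 * (t22 + t11/2)^2 + 2 * (t12^2 + t13^2 + t23^2)"
    unfolding t33 by (simp add: power2_eq_square algebra_simps)
  ultimately have "Wp_sqnorm g J x = 3/8 * (scal_star g J x - scal g x / 3)^2 \<longleftrightarrow>
      (t22 + t11/2)^2 + (t12^2 + t13^2 + t23^2) = 0"
    unfolding Wp_sqnorm_t by auto
  also have "\<dots> \<longleftrightarrow> t22 + t11/2 = 0 \<and> t12 = 0 \<and> t13 = 0 \<and> t23 = 0"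
    by (simp add: add_nonneg_eq_0_iff)
  finally show ?thesis using t33 by auto
qed

lemma norm_condition_Qf_frame:
  "Wp_sqnorm g J x = 3/8 * (scal_star g J x - scal g x / 3)^2 \<longleftrightarrow>
    (\<forall>A. Wp g J x A = (1/2 * (scal_star g J x - scal g x / 3)) *\<^sub>R Qf A)"
  unfolding norm_condition_t t11_scal[symmetric]
proof
  assume t: "t12 = 0 \<and> t13 = 0 \<and> t23 = 0 \<and> t22 = - t11/2 \<and> t33 = - t11/2"
  show "\<forall>A. Wp g J x A = t11 *\<^sub>R Qf A"
    unfolding Wp_basis Qf_cm using t by (simp add: algebra_simps)
next
  assume W: "\<forall>A. Wp g J x A = t11 *\<^sub>R Qf A"
  have c: "cm (Wp g J x A) i j = cm (t11 *\<^sub>R Qf A) i j" for A i j using W by simp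
  show "t12 = 0 \<and> t13 = 0 \<and> t23 = 0 \<and> t22 = - t11/2 \<and> t33 = - t11/2"
    using c[of "J x" 1 3] c[of "J x" 1 4] c[of I2 1 4] c[of I2 1 3] c[of I3 1 4]
    unfolding Wp_basis Qf_cm by (simp add: p_basis cm_algebra cm_basis)
qed

text \<open>If every \<open>R(u, v)\<close> commutes with \<open>J\<close>, it is orthogonal to \<open>I2\<close> and \<open>I3\<close>.  By
  pair symmetry the curvature operator then kills \<open>I2\<close> and \<open>I3\<close>, and \<open>W\<^sub>+\<close> acts on them as a scalar.\<close>

lemma commuting_curvature_norm:
  assumes K: "\<And>u v w. Riem g x u v (J x *v w) = J x *v Riem g x u v w"
  shows "Wp_sqnorm g J x = 3/8 * (scal_star g J x - scal g x / 3)^2"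
proof -
  have k: "inn (g x) (Riem g x u v (J x *v e k)) (e l) = - inn (g x) (Riem g x u v (e k)) (J x *v e l)" for u v k l
    unfolding K by (rule inn_J)
  have r23: "r i j 2 3 = - r i j 1 4" for i j using k[of _ _ 1 3] by (simp add: J_e r_def)
  have r24: "r i j 2 4 = r i j 1 3" for i j using k[of _ _ 1 4] by (simp add: J_e r_def inn_algebra)
  have r23': "r 2 3 i j = - r 1 4 i j" for i j using r23[of i j] by (simp add: r_pair[of _ _ i j])
  have r24': "r 2 4 i j = r 1 3 i j" for i j using r24[of i j] by (simp add: r_pair[of _ _ i j])
  have r1234: "r 1 2 3 4 = r 1 3 1 3 + r 1 4 1 4" using r_1423 r23[of 1 4] r24[of 1 3] by simp
  show ?thesis
    unfolding norm_condition_t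
    by (simp add: t_defs w_value r23 r24 r23' r24' r1234 field_simps)
qed

end

context curvature_point
begin

lemma norm_condition_iff_Qf:
  "Wp_sqnorm g J x = 3/8 * (scal_star g J x - scal g x / 3)^2 \<longleftrightarrow>
    (\<forall>A. Wp g J x A = (1/2 * (scal_star g J x - scal g x / 3)) *\<^sub>R Qf A)"
proof -
  obtain e where "adapted e" using adapted_exists by blast
  then interpret curvature_frame g J x e by unfold_locales
  show ?thesis by (rule norm_condition_Qf_frame)
qed

lemma norm_condition_if_commuting:
  assumes "\<And>u v w. Riem g x u v (J x *v w) = J x *v Riem g x u v w"
  shows "Wp_sqnorm g J x = 3/8 * (scal_star g J x - scal g x / 3)^2"
proof -
  obtain e where "adapted e" using adapted_exists by blast
  then interpret curvature_frame g J x e by unfold_locales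
  show ?thesis by (rule commuting_curvature_norm[OF assms])
qed

end

context hermitian_space_4
begin

lemma trace_J_J: "trace (J ** J) = - 4"
  unfolding J_sq by (simp add: trace_algebra trace_I)

lemma adj_J: "adj J = - J"
proof (rule matrix_eq_vec, rule inn_eqI)
  fix v w
  have "inn G w (adj J *v v) = inn G w ((- J) *v v)"
    unfolding inn_adj[symmetric] by (simp add: inn_J matvec_algebra inn_algebra)
  then show "inn G (adj J *v v) w = inn G ((- J) *v v) w" by (simp add: inn_sym[of _ w])
qed

lemma Qf_J: "Qf J = J"
proof -
  have "J ** J ** J = - J" by (simp add: J_sq matmul_algebra)
  then show ?thesis by (simp add: Qf_def trace_J_J adj_J matmul_algebra scaleR_2[symmetric])
qed

lemma skew_anticommutator:
  assumes "N \<in> skew G" "N ** J = - (J ** N)" "A \<in> skew G"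
  shows "N ** A ** J + J ** A ** N = (1/2) *\<^sub>R (trace (N ** A) *\<^sub>R J + trace (J ** A) *\<^sub>R N)"
proof -
  obtain e where "adapted e" using adapted_exists by blast
  then interpret adapted_frame G J e by unfold_locales
  show ?thesis by (rule anticommutator_identity[OF assms])
qed

end

section \<open>The covariant derivative of J and of the model operator\<close>

lemma skew_matrix_iff: "A \<in> skew G \<longleftrightarrow> transpose A ** G = - (G ** A)"
proof -
  have "A \<in> skew G \<longleftrightarrow> (\<forall>v u. u \<bullet> ((transpose A ** G) *v v) = u \<bullet> ((- (G ** A)) *v v))"
    unfolding skew_def inn_def
    by (simp add: matrix_vector_mul_assoc[symmetric] inner_transpose matvec_algebra del: transpose_matrix_vector) blast
  also have "\<dots> \<longleftrightarrow> transpose A ** G = - (G ** A)"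
    unfolding vector_eq_ldot matrix_eq ..
  finally show ?thesis .
qed

lemma tens_works: "tens G Y X *v Z = inn G Y Z *\<^sub>R X"
  unfolding tens_def by (rule matrix_works4, rule linearI) (simp_all add: inn_algebra scaleR_add_left)

lemma (in metric_space_4) trace_matmul_tens:
  assumes "orthonormal_frame G e" shows "trace (A ** tens G Y X) = inn G Y (A *v X)"
proof -
  have "trace (A ** tens G Y X) = (\<Sum>i\<in>UNIV. inn G (e i) Y * inn G (e i) (A *v X))"
    by (simp add: trace_frame[OF assms] matrix_vector_mul_assoc[symmetric] tens_works matvec_algebra inn_algebra
        inn_sym[of "e _" Y] inn_sym[of "A *v X"])
  then show ?thesis by (simp add: frame_parseval[OF assms])
qed

lemma (in metric_space_4) skew_tens: "tens G Y X - tens G X Y \<in> skew G"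
  by (simp add: skew_def tens_works matvec_algebra inn_algebra inn_sym mult.commute)

locale hermitian_chart = chart_metric +
  fixes J :: mfield
  assumes smooth_J: "smooth_on U J"
    and J_square: "x \<in> U \<Longrightarrow> J x ** J x = - mat 1"
    and J_skew: "x \<in> U \<Longrightarrow> J x \<in> skew (G x)"
begin

lemma hermitian_at: "x \<in> U \<Longrightarrow> hermitian_space_4 (G x) (J x)"
  by (intro hermitian_space_4.intro metric_at hermitian_space_4_axioms.intro J_square J_skew)

lemma curvature_at: assumes "x \<in> U" shows "curvature_point G J x"
proof (intro curvature_point.intro hermitian_at assms curvature_point_axioms.intro)
  fix u v w a b
  show "linear (\<lambda>u. Riem G x u v w)"
    by (rule linearI) (simp_all add: Riem_Rm assms linear_add[OF Rm_linear] linear_scale[OF Rm_linear] matvec_algebra)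
  show "linear (Riem G x u v)"
    by (rule linearI) (simp_all add: Riem_Rm assms matvec_algebra)
  show "Riem G x v u w = - Riem G x u v w"
    unfolding Riem_Rm[OF assms] Rm_antisym[of x v u] by (simp add: matvec_algebra)
  show "inn (G x) (Riem G x u v a) b = - inn (G x) a (Riem G x u v b)"
    unfolding Riem_Rm[OF assms] by (rule Rm_skew[OF assms])
  show "Riem G x u v w + Riem G x v w u + Riem G x w u v = 0"
    unfolding Riem_Rm[OF assms] by (rule Rm_bianchi[OF assms])
qed

lemmas J_diff = smooth_on_differentiable[OF smooth_J]

abbreviation N :: "point \<Rightarrow> real^4 \<Rightarrow> real^4^4" where "N x u \<equiv> nabla_end G J x u"

lemma N_eq: "x \<in> U \<Longrightarrow> N x u = pd J x u + Gam x u ** J x - J x ** Gam x u"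
  by (rule nabla_end_eq) (auto intro: J_diff)

lemma linear_N: "x \<in> U \<Longrightarrow> linear (N x)"
  by (rule linearI) (simp_all add: N_eq linear_add[OF linear_pd[OF J_diff]] linear_scale[OF linear_pd[OF J_diff]]
      linear_add[OF Gam_linear] linear_scale[OF Gam_linear] matmul_algebra algebra_simps)

lemma continuous_N: "continuous_on U (\<lambda>x. N x u)"
proof -
  have "smooth_on U (\<lambda>x. pd J x u + Gam x u ** J x - J x ** Gam x u)"
    by (intro smooth_on_diff[OF open_U] smooth_on_add[OF open_U] smooth_on_frechet_derivative smooth_J
        smooth_on_bilinear[OF open_U bounded_bilinear_matmul] smooth_Gam)
  then have "smooth_on U (\<lambda>x. N x u)" by (rule smooth_on_cong[OF open_U, rotated]) (simp add: N_eq)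
  then show ?thesis unfolding smooth_on_def using Ck_on.simps(1) by blast
qed

text \<open>Covariant differentiation of \<open>J\<^sup>2 = -1\<close>.\<close>

lemma N_anticommutes: assumes x: "x \<in> U" shows "N x u ** J x = - (J x ** N x u)"
proof -
  have "pd (\<lambda>y. J y ** J y) x u = pd (\<lambda>y. - mat 1) x u"
    by (rule pd_cong[OF open_U x]) (rule J_square)
  then have "J x ** pd J x u + pd J x u ** J x = 0"
    by (simp add: pd_matmul J_diff[OF x] pd_const)
  moreover have "J x ** Gam x u ** J x = J x ** (Gam x u ** J x)" "Gam x u ** J x ** J x = - Gam x u"
     "J x ** (J x ** Gam x u) = - Gam x u"
    by (simp_all add: matrix_mul_assoc[symmetric] J_square[OF x] matmul_algebra)
       (simp add: matrix_mul_assoc J_square[OF x] matmul_algebra)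
  ultimately show ?thesis
    by (simp add: N_eq[OF x] matmul_algebra algebra_simps)
qed

text \<open>The metric is parallel, so \<open>\<nabla>J\<close> is skew because \<open>J\<close> is.\<close>

lemma N_skew: assumes x: "x \<in> U" shows "N x u \<in> skew (G x)"
proof -
  let ?L = "transpose (Gam x u) ** G x + G x ** Gam x u"
  have d: "(\<lambda>y. transpose (J y)) differentiable (at x)"
    by (rule differentiable_linear[OF bounded_linear_transpose J_diff[OF x]])
  have dG: "(\<lambda>y. G y ** J y) differentiable (at x)"
    by (rule differentiable_bilinear[OF bounded_bilinear_matmul G_diff[OF x] J_diff[OF x]])
  have "pd (\<lambda>y. transpose (J y) ** G y) x u = pd (\<lambda>y. - (G y ** J y)) x u"
    by (rule pd_cong[OF open_U x]) (rule J_skew[unfolded skew_matrix_iff])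
  then have 1: "transpose (J x) ** ?L + transpose (pd J x u) ** G x = - (G x ** pd J x u + ?L ** J x)"
    by (simp add: pd_linear[OF bounded_linear_minus[OF bounded_linear_ident] dG] pd_matmul d G_diff[OF x] J_diff[OF x]
       pd_linear[OF bounded_linear_transpose J_diff[OF x]] Gam_compat[OF x])
  have JG: "transpose (J x) ** G x = - (G x ** J x)" using J_skew[OF x] by (simp add: skew_matrix_iff)
  have 2: "transpose (Gam x u) ** transpose (J x) ** G x = - (transpose (Gam x u) ** G x ** J x)"
    by (simp add: matrix_mul_assoc[symmetric] JG matmul_algebra)
  have 3: "transpose (J x) ** G x ** Gam x u = - (G x ** J x ** Gam x u)"
    by (simp add: JG matmul_algebra)
  show ?thesis
    unfolding skew_matrix_iff N_eq[OF x] using 1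
    by (simp add: matmul_algebra transpose_algebra matrix_transpose_mul matrix_mul_assoc 2 3 algebra_simps)
qed

text \<open>Parallelism says \<open>\<partial>\<^sub>v J = [J, \<Gamma>\<^sub>v]\<close>; the symmetry of the second derivatives of \<open>J\<close> is
  the integrability condition \<open>[R(u, v), J] = 0\<close>.\<close>

lemma kaehler_Rm_commutes:
  assumes K: "\<And>y u. y \<in> U \<Longrightarrow> N y u = 0" and x: "x \<in> U"
  shows "Rm x u v ** J x = J x ** Rm x u v"
proof -
  have dJ: "pd J y u = J y ** Gam y u - Gam y u ** J y" if "y \<in> U" for y u
    using K[OF that, of u] N_eq[OF that, of u] by (simp add: algebra_simps)
  have "pd (\<lambda>y. pd J y v) x u = J x ** pd (\<lambda>y. Gam y v) x u + (J x ** Gam x u - Gam x u ** J x) ** Gam x v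
      - (Gam x v ** (J x ** Gam x u - Gam x u ** J x) + pd (\<lambda>y. Gam y v) x u ** J x)" for u v
  proof -
    have "pd (\<lambda>y. pd J y v) x u = pd (\<lambda>y. J y ** Gam y v - Gam y v ** J y) x u"
      by (rule pd_cong[OF open_U x]) (rule dJ)
    also have "\<dots> = pd (\<lambda>y. J y ** Gam y v) x u - pd (\<lambda>y. Gam y v ** J y) x u"
      by (rule pd_diff; intro differentiable_bilinear[OF bounded_bilinear_matmul] J_diff Gam_diff x)
    finally show ?thesis by (simp add: pd_matmul J_diff[OF x] Gam_diff[OF x] dJ[OF x])
  qed
  from this[of u v] this[of v u] second_derivative_sym[OF open_U smooth_J x, of u v]
  show ?thesis
    by (simp add: Rm_def matmul_algebra matrix_mul_assoc algebra_simps)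
qed

lemma kaehler_norm_condition:
  assumes K: "\<And>y u. y \<in> U \<Longrightarrow> N y u = 0" and x: "x \<in> U"
  shows "Wp_sqnorm G J x = 3/8 * (scal_star G J x - scal G x / 3)^2"
proof (rule curvature_point.norm_condition_if_commuting[OF curvature_at[OF x]])
  fix u v w
  show "Riem G x u v (J x *v w) = J x *v Riem G x u v w"
    by (simp add: Riem_Rm[OF x] matrix_vector_mul_assoc kaehler_Rm_commutes[OF K x])
qed

definition Q :: "point \<Rightarrow> real^4^4 \<Rightarrow> real^4^4" where
  "Q y A = hermitian_space_4.Qf (G y) (J y) A"

abbreviation adjoint_at :: "point \<Rightarrow> real^4^4 \<Rightarrow> real^4^4" where
  "adjoint_at y A \<equiv> matrix_inv (G y) ** transpose A ** G y"

lemma Q_eq: "y \<in> U \<Longrightarrow> Q y A = (- (1/4) * trace (J y ** A)) *\<^sub>R J y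
     - (1/4) *\<^sub>R ((1/2) *\<^sub>R (A - adjoint_at y A) + J y ** ((1/2) *\<^sub>R (A - adjoint_at y A)) ** J y)"
  unfolding Q_def hermitian_space_4.Qf_def[OF hermitian_at] hermitian_space_4.adj_def[OF hermitian_at] ..

lemma linear_Q: "y \<in> U \<Longrightarrow> linear (Q y)"
  by (rule linearI) (simp_all add: Q_eq matmul_algebra transpose_algebra trace_algebra algebra_simps)

lemma smooth_adjoint: "smooth_on U (\<lambda>y. adjoint_at y A)"
  by (intro smooth_on_bilinear[OF open_U bounded_bilinear_matmul] smooth_Ginv smooth_on_const[OF open_U] smooth_G)

text \<open>Taking adjoints commutes with covariant differentiation.  This enters because a constant matrix
  that is skew at one point is in general not skew at the points around it.\<close>

lemma nabla_adjoint:
  assumes x: "x \<in> U"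
  shows "pd (\<lambda>y. adjoint_at y A) x u + Gam x u ** adjoint_at x A - adjoint_at x A ** Gam x u
    = adjoint_at x (Gam x u ** A - A ** Gam x u)"
proof -
  let ?a = "adjoint_at x A" and ?d = "pd (\<lambda>y. adjoint_at y A) x u" and ?\<Gamma> = "Gam x u"
  note inv = metric_space_4.invertible_metric[OF metric_at]
  have Ga: "G y ** adjoint_at y B = transpose B ** G y" if "y \<in> U" for y B
    by (simp add: matrix_mul_assoc matrix_inv_right4[OF inv[OF that]])
  have "pd (\<lambda>y. G y ** adjoint_at y A) x u = pd (\<lambda>y. transpose A ** G y) x u"
    by (rule pd_cong[OF open_U x]) (rule Ga)
  then have 1: "G x ** ?d + (transpose ?\<Gamma> ** G x + G x ** ?\<Gamma>) ** ?a
      = transpose A ** (transpose ?\<Gamma> ** G x + G x ** ?\<Gamma>)"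
    using pd_matmul[OF G_diff[OF x] smooth_on_differentiable[OF smooth_adjoint x]]
      pd_linear[OF bounded_bilinear.bounded_linear_right[OF bounded_bilinear_matmul] G_diff[OF x]]
    by (simp add: Gam_compat[OF x])
  have 2: "transpose ?\<Gamma> ** G x ** ?a = transpose ?\<Gamma> ** transpose A ** G x"
    using Ga[OF x, of A] by (metis matrix_mul_assoc)
  have 3: "G x ** (?a ** ?\<Gamma>) = transpose A ** G x ** ?\<Gamma>"
    using Ga[OF x, of A] by (metis matrix_mul_assoc)
  have "G x ** (?d + ?\<Gamma> ** ?a - ?a ** ?\<Gamma>) = transpose (?\<Gamma> ** A - A ** ?\<Gamma>) ** G x"
  proof -
    \<comment> \<open>Generalized to opaque matrices, so that the inverse of the metric is not multiplied out.\<close>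
    have "G x ** (d + ?\<Gamma> ** a - a ** ?\<Gamma>) = transpose (?\<Gamma> ** A - A ** ?\<Gamma>) ** G x"
      if "G x ** d + (transpose ?\<Gamma> ** G x + G x ** ?\<Gamma>) ** a
          = transpose A ** (transpose ?\<Gamma> ** G x + G x ** ?\<Gamma>)"
        and "transpose ?\<Gamma> ** G x ** a = transpose ?\<Gamma> ** transpose A ** G x"
        and "G x ** (a ** ?\<Gamma>) = transpose A ** G x ** ?\<Gamma>" for a d
    proof -
      have "G x ** d + (transpose ?\<Gamma> ** transpose A ** G x + G x ** ?\<Gamma> ** a)
          = transpose A ** transpose ?\<Gamma> ** G x + transpose A ** G x ** ?\<Gamma>"
        using that(1) unfolding that(2)[symmetric] by (simp only: matmul_algebra matrix_mul_assoc)
      moreover have "G x ** (d + ?\<Gamma> ** a - a ** ?\<Gamma>) = G x ** d + G x ** ?\<Gamma> ** a - transpose A ** G x ** ?\<Gamma>"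
        unfolding that(3)[symmetric] by (simp only: matmul_algebra matrix_mul_assoc)
      ultimately show ?thesis
        by (simp add: matmul_algebra transpose_algebra matrix_transpose_mul matrix_mul_assoc algebra_simps)
    qed
    from this[OF 1 2 3] show ?thesis .
  qed
  also have "\<dots> = G x ** adjoint_at x (?\<Gamma> ** A - A ** ?\<Gamma>)" using Ga[OF x] by simp
  finally have "matrix_inv (G x) ** (G x ** (?d + ?\<Gamma> ** ?a - ?a ** ?\<Gamma>))
      = matrix_inv (G x) ** (G x ** adjoint_at x (?\<Gamma> ** A - A ** ?\<Gamma>))" by simp
  then show ?thesis
    by (simp only: matrix_mul_assoc[of "matrix_inv (G x)" "G x"] matrix_inv_left4[OF inv[OF x]] matrix_mul_lid)
qed

lemma smooth_Q: "smooth_on U (\<lambda>y. Q y A)"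
proof -
  have S: "smooth_on U (\<lambda>y. (1/2) *\<^sub>R (A - adjoint_at y A))"
    by (rule smooth_on_bounded_linear[OF open_U bounded_linear_scaleR_right])
      (rule smooth_on_diff[OF open_U smooth_on_const[OF open_U] smooth_adjoint])
  have t: "smooth_on U (\<lambda>y. - (1/4) * trace (J y ** A))"
    by (rule smooth_on_bounded_linear[OF open_U bounded_linear_mult_right])
      (rule smooth_on_bounded_linear[OF open_U bounded_linear_trace],
       rule smooth_on_bilinear[OF open_U bounded_bilinear_matmul smooth_J smooth_on_const[OF open_U]])
  have "smooth_on U (\<lambda>y. (- (1/4) * trace (J y ** A)) *\<^sub>R J y
     - (1/4) *\<^sub>R ((1/2) *\<^sub>R (A - adjoint_at y A) + J y ** ((1/2) *\<^sub>R (A - adjoint_at y A)) ** J y))"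
    by (intro smooth_on_diff[OF open_U] smooth_on_bilinear[OF open_U bounded_bilinear_scaleR t smooth_J]
      smooth_on_bounded_linear[OF open_U bounded_linear_scaleR_right, of _ "1/4"]
      smooth_on_add[OF open_U] smooth_on_bilinear[OF open_U bounded_bilinear_matmul] S smooth_J)
  then show ?thesis by (rule smooth_on_cong[OF open_U, rotated]) (simp add: Q_eq)
qed

text \<open>Product rule for the closed form of \<open>Q\<close>.  The terms in which the argument is differentiated add up to
  \<open>Q (\<nabla>\<^sub>u A)\<close>, and \<open>skew_anticommutator\<close> turns the derivative of the projection part into a
  multiple of the derivative of \<open>\<langle>J, A\<rangle> J\<close>.\<close>

lemma nabla_Q:
  assumes x: "x \<in> U" and A: "A \<in> skew (G x)"
  shows "nabla_op G Q x u A
    = - (3/8) *\<^sub>R (trace (N x u ** A) *\<^sub>R J x + trace (J x ** A) *\<^sub>R N x u)"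
proof -
  let ?\<Gamma> = "Gam x u" and ?N = "N x u" and ?dJ = "pd J x u"
  let ?B = "Gam x u ** A - A ** Gam x u"
  define S where "S y = (1/2) *\<^sub>R (A - adjoint_at y A)" for y
  define S' where "S' = (1/2) *\<^sub>R (?B - adjoint_at x ?B)"
  note dJ = J_diff[OF x]
  have da: "(\<lambda>y. adjoint_at y A) differentiable (at x)"
    by (rule smooth_on_differentiable[OF smooth_adjoint x])
  have dS: "S differentiable (at x)"
    unfolding S_def by (intro differentiable_linear[OF bounded_linear_scaleR_right] differentiable_diff differentiable_const da)
  have DS: "pd S x u = S' - ?\<Gamma> ** S x + S x ** ?\<Gamma>"
  proof -
    have "pd S x u = (1/2) *\<^sub>R (0 - pd (\<lambda>y. adjoint_at y A) x u)"
      unfolding S_def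
      by (simp only: pd_linear[OF bounded_linear_scaleR_right differentiable_diff[OF differentiable_const da]]
          pd_diff[OF differentiable_const da] pd_const)
    moreover have "pd (\<lambda>y. adjoint_at y A) x u
        = adjoint_at x ?B - ?\<Gamma> ** adjoint_at x A + adjoint_at x A ** ?\<Gamma>"
      using nabla_adjoint[OF x, of A u] by (simp add: algebra_simps)
    ultimately show ?thesis
      unfolding S_def S'_def by (simp only: matmul_algebra) (simp add: algebra_simps)
  qed
  have SA: "S x = A"
  proof -
    have "transpose A ** G x = - (G x ** A)" using A by (simp add: skew_matrix_iff)
    then have "adjoint_at x A = - A"
      by (simp add: matrix_mul_assoc[symmetric] matmul_algebra)
        (simp add: matrix_mul_assoc matrix_inv_left4[OF metric_space_4.invertible_metric[OF metric_at[OF x]]])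
    then show ?thesis by (simp add: S_def scaleR_2[symmetric])
  qed
  have dJ': "?dJ = ?N - ?\<Gamma> ** J x + J x ** ?\<Gamma>" by (simp add: N_eq[OF x])
  have dJS: "(\<lambda>y. J y ** S y) differentiable (at x)"
    by (rule differentiable_bilinear[OF bounded_bilinear_matmul dJ dS])
  have dJSJ: "(\<lambda>y. J y ** S y ** J y) differentiable (at x)"
    by (rule differentiable_bilinear[OF bounded_bilinear_matmul dJS dJ])
  have dJA: "(\<lambda>y. J y ** A) differentiable (at x)"
    by (rule differentiable_bilinear[OF bounded_bilinear_matmul dJ differentiable_const])
  have dt: "(\<lambda>y. - (1/4) * trace (J y ** A)) differentiable (at x)"
    by (rule differentiable_linear[OF bounded_linear_mult_right differentiable_linear[OF bounded_linear_trace dJA]])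
  have Dt: "pd (\<lambda>y. - (1/4) * trace (J y ** A)) x u = - (1/4) * trace (?dJ ** A)"
    by (simp only: pd_linear[OF bounded_linear_mult_right differentiable_linear[OF bounded_linear_trace dJA]]
        pd_linear[OF bounded_linear_trace dJA] pd_matmul[OF dJ differentiable_const] pd_const matmul_algebra) simp
  have pdQ: "pd (\<lambda>y. Q y A) x u
      = (- (1/4) * trace (J x ** A)) *\<^sub>R ?dJ + (- (1/4) * trace (?dJ ** A)) *\<^sub>R J x
       - (1/4) *\<^sub>R (pd S x u + (J x ** S x ** ?dJ + (J x ** pd S x u + ?dJ ** S x) ** J x))"
  proof -
    have "pd (\<lambda>y. Q y A) x u
      = pd (\<lambda>y. (- (1/4) * trace (J y ** A)) *\<^sub>R J y - (1/4) *\<^sub>R (S y + J y ** S y ** J y)) x u"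
      by (rule pd_cong[OF open_U x]) (simp add: Q_eq S_def)
    also have "\<dots> = pd (\<lambda>y. (- (1/4) * trace (J y ** A)) *\<^sub>R J y) x u - pd (\<lambda>y. (1/4) *\<^sub>R (S y + J y ** S y ** J y)) x u"
      by (intro pd_diff differentiable_bilinear[OF bounded_bilinear_scaleR dt dJ]
         differentiable_linear[OF bounded_linear_scaleR_right] differentiable_add dS dJSJ)
    also have "pd (\<lambda>y. (- (1/4) * trace (J y ** A)) *\<^sub>R J y) x u
        = (- (1/4) * trace (J x ** A)) *\<^sub>R ?dJ + (- (1/4) * trace (?dJ ** A)) *\<^sub>R J x"
      by (simp only: pd_bilinear[OF bounded_bilinear_scaleR dt dJ] Dt)
    also have "pd (\<lambda>y. (1/4) *\<^sub>R (S y + J y ** S y ** J y)) x u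
        = (1/4) *\<^sub>R (pd S x u + (J x ** S x ** ?dJ + (J x ** pd S x u + ?dJ ** S x) ** J x))"
      by (simp only: pd_linear[OF bounded_linear_scaleR_right differentiable_add[OF dS dJSJ]]
          pd_add[OF dS dJSJ] pd_matmul[OF dJS dJ] pd_matmul[OF dJ dS])
    finally show ?thesis .
  qed
  have tr: "trace (?dJ ** A) = trace (?N ** A) + trace (J x ** ?B)"
  proof -
    have "trace (?\<Gamma> ** J x ** A) = trace (J x ** (A ** ?\<Gamma>))"
      using trace_mul_sym[of ?\<Gamma> "J x ** A"] by (simp add: matrix_mul_assoc)
    then show ?thesis unfolding dJ' by (simp add: matmul_algebra trace_algebra matrix_mul_assoc)
  qed
  have "nabla_end G (\<lambda>y. Q y A) x u = pd (\<lambda>y. Q y A) x u + ?\<Gamma> ** Q x A - Q x A ** ?\<Gamma>"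
    by (rule nabla_end_eq[OF x smooth_on_differentiable[OF smooth_Q x]])
  also have "\<dots> = (- (1/4) * trace (?N ** A)) *\<^sub>R J x + (- (1/4) * trace (J x ** A)) *\<^sub>R ?N
      - (1/4) *\<^sub>R (?N ** S x ** J x + J x ** S x ** ?N)
      + ((- (1/4) * trace (J x ** ?B)) *\<^sub>R J x - (1/4) *\<^sub>R (S' + J x ** S' ** J x))"
    unfolding pdQ tr Q_eq[OF x] S_def[symmetric] DS
    unfolding dJ'
    by (simp add: matmul_algebra matrix_mul_assoc algebra_simps)
  also have "(- (1/4) * trace (J x ** ?B)) *\<^sub>R J x - (1/4) *\<^sub>R (S' + J x ** S' ** J x) = Q x ?B"
    by (simp add: Q_eq[OF x] S'_def)
  also have "?N ** S x ** J x + J x ** S x ** ?N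
      = (1/2) *\<^sub>R (trace (?N ** A) *\<^sub>R J x + trace (J x ** A) *\<^sub>R ?N)"
    unfolding SA
    by (rule hermitian_space_4.skew_anticommutator[OF hermitian_at[OF x] N_skew[OF x] N_anticommutes[OF x] A])
  also have "(- (1/4) * trace (?N ** A)) *\<^sub>R J x + (- (1/4) * trace (J x ** A)) *\<^sub>R ?N
      - (1/4) *\<^sub>R ((1/2) *\<^sub>R (trace (?N ** A) *\<^sub>R J x + trace (J x ** A) *\<^sub>R ?N))
      = - (3/8) *\<^sub>R (trace (?N ** A) *\<^sub>R J x + trace (J x ** A) *\<^sub>R ?N)"
    by (simp add: vec_eq_iff algebra_simps)
  finally have "nabla_end G (\<lambda>y. Q y A) x u
      = - (3/8) *\<^sub>R (trace (?N ** A) *\<^sub>R J x + trace (J x ** A) *\<^sub>R ?N) + Q x ?B" .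
  moreover have "nabla_end G (\<lambda>_. A) x u = ?B"
    using nabla_end_eq[OF x differentiable_const, of A u] by (simp add: pd_const)
  ultimately show ?thesis by (simp add: nabla_op_def)
qed

lemma nabla_op_scaled:
  assumes x: "x \<in> U" and W: "\<And>y B. y \<in> U \<Longrightarrow> T y B = \<phi> y *\<^sub>R Q y B"
    and l: "\<phi> differentiable (at x)"
  shows "nabla_op G T x u A = pd \<phi> x u *\<^sub>R Q x A + \<phi> x *\<^sub>R nabla_op G Q x u A"
proof -
  note dQ = smooth_on_differentiable[OF smooth_Q x]
  have d: "(\<lambda>y. \<phi> y *\<^sub>R Q y A) differentiable (at x)"
    by (rule differentiable_bilinear[OF bounded_bilinear_scaleR l dQ])
  have "(\<lambda>y. T y A) differentiable (at x)"
    using d differentiable_cong_open[OF open_U x, of "\<lambda>y. T y A" "\<lambda>y. \<phi> y *\<^sub>R Q y A"] W by simp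
  then have "nabla_end G (\<lambda>y. T y A) x u = pd (\<lambda>y. T y A) x u + Gam x u ** T x A - T x A ** Gam x u"
    by (rule nabla_end_eq[OF x])
  also have "pd (\<lambda>y. T y A) x u = pd (\<lambda>y. \<phi> y *\<^sub>R Q y A) x u"
    by (rule pd_cong[OF open_U x]) (rule W)
  also have "\<dots> = \<phi> x *\<^sub>R pd (\<lambda>y. Q y A) x u + pd \<phi> x u *\<^sub>R Q x A"
    by (rule pd_bilinear[OF bounded_bilinear_scaleR l dQ])
  finally show ?thesis
    by (simp add: nabla_op_def nabla_end_eq[OF x dQ] W x matmul_algebra algebra_simps)
qed

lemma grad_works:
  assumes x: "x \<in> U" and f: "linear (pd f x)"
  shows "inn (G x) (grad G f x) v = pd f x v"
proof -
  interpret hermitian_space_4 "G x" "J x" by (rule hermitian_at[OF x])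
  let ?e = "frame (G x)"
  define w where "w = (\<Sum>k\<in>UNIV. pd f x (?e k) *\<^sub>R ?e k)"
  have w: "inn (G x) w v = pd f x v" for v
  proof -
    have "pd f x v = pd f x (\<Sum>k\<in>UNIV. inn (G x) (?e k) v *\<^sub>R ?e k)"
      using frame_expand[OF frame_orthonormal, of v] by simp
    then show ?thesis
      by (simp add: w_def inn_sum inn_algebra linear_sum[OF f] linear_scale[OF f] mult.commute)
  qed
  have "grad G f x = w"
    unfolding grad_def by (rule the_equality) (use w inn_eqI in auto)
  then show ?thesis using w by simp
qed

text \<open>Both the divergence of \<open>\<phi> Q\<close> and the contraction with the gradient of \<open>ln |\<phi>|\<close> contribute
  half of \<open>Q (grad \<phi> \<and> X)\<close>, with opposite signs.  The rest is the divergence of \<open>Q\<close>.\<close>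

lemma delta_formula:
  assumes x: "x \<in> U" and W: "\<And>y B. y \<in> U \<Longrightarrow> Wp G J y B = \<phi> y *\<^sub>R Q y B"
    and nrm: "\<And>y. y \<in> U \<Longrightarrow> Wp_norm G J y = sqrt (3/2) * \<bar>\<phi> y\<bar>"
    and l: "smooth_on U \<phi>" and nz: "\<phi> x \<noteq> 0"
  shows "delta_Wp G J x X + Wp_vec G J x (grad G (\<lambda>y. ln (Wp_norm G J y)) x) X
    = - (3/8 * \<phi> x) *\<^sub>R ((\<Sum>k\<in>UNIV. inn (G x) (frame (G x) k) (N x (frame (G x) k) *v X)) *\<^sub>R J x
        + N x (J x *v X))"
proof -
  interpret hermitian_space_4 "G x" "J x" by (rule hermitian_at[OF x])
  let ?e = "frame (G x)"
  let ?A = "\<lambda>k. tens (G x) (?e k) X - tens (G x) X (?e k)"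
  let ?f = "\<lambda>y. ln (Wp_norm G J y)"
  note dl = smooth_on_differentiable[OF l x]
  have tr: "trace (M ** ?A k) = 2 * inn (G x) (?e k) (M *v X)" if "M \<in> skew (G x)" for M k
  proof -
    have "inn (G x) X (M *v ?e k) = - inn (G x) (?e k) (M *v X)"
    proof -
      have "inn (G x) (M *v X) (?e k) = - inn (G x) X (M *v ?e k)" using that by (simp add: skew_def)
      then show ?thesis using inn_sym[of "M *v X" "?e k"] by simp
    qed
    then show ?thesis
      by (simp add: matmul_algebra trace_algebra trace_matmul_tens[OF frame_orthonormal])
  qed
  have pdf: "pd ?f x v = pd \<phi> x v / \<phi> x" for v
  proof -
    \<comment> \<open>Near \<open>x\<close> the sign of \<open>\<phi>\<close> is constant, so the absolute value can be dropped.\<close>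
    define s where "s = sgn (\<phi> x) * sqrt (3/2)"
    let ?V = "{y \<in> U. s * \<phi> y > 0}"
    have "continuous_on U \<phi>" using l unfolding smooth_on_def using Ck_on.simps(1) by blast
    then have "openin (top_of_set U) (U \<inter> (\<lambda>y. s * \<phi> y) -` {0<..})"
      by (intro continuous_openin_preimage_gen continuous_intros) auto
    then have V: "open ?V" using open_U by (auto simp: openin_open_eq vimage_def Int_def)
    have xV: "x \<in> ?V" using x nz by (auto simp: s_def sgn_real_def zero_less_mult_iff)
    have "Wp_norm G J y = s * \<phi> y" if "y \<in> ?V" for y
      using that nrm[of y] by (auto simp: s_def sgn_real_def zero_less_mult_iff abs_if split: if_splits)
    then have "pd ?f x v = pd (\<lambda>y. ln (s * \<phi> y)) x v"
      by (intro pd_cong[OF V xV]) simp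
    also have "\<dots> = pd \<phi> x v / \<phi> x"
    proof (rule pd_eqI)
      have "((\<lambda>y. ln (s * \<phi> y)) has_derivative (\<lambda>h. (s * pd \<phi> x h) * inverse (s * \<phi> x))) (at x)"
        by (rule has_derivative_ln[OF _ has_derivative_mult_right[OF pd_works[OF dl]]]) (use xV in auto)
      moreover have "(s * pd \<phi> x h) * inverse (s * \<phi> x) = pd \<phi> x h / \<phi> x" for h
        using xV nz by (auto simp: field_simps)
      ultimately show "((\<lambda>y. ln (s * \<phi> y)) has_derivative (\<lambda>h. pd \<phi> x h / \<phi> x)) (at x)" by simp
    qed
    finally show ?thesis .
  qed
  let ?v = "\<Sum>k\<in>UNIV. pd \<phi> x (?e k) *\<^sub>R ?e k"
  have gr: "\<phi> x *\<^sub>R grad G ?f x = ?v"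
  proof -
    have lin: "linear (pd ?f x)"
      unfolding pdf by (rule linearI) (simp_all add: linear_add[OF linear_pd[OF dl]] linear_scale[OF linear_pd[OF dl]] add_divide_distrib)
    have "\<phi> x *\<^sub>R grad G ?f x = (\<Sum>k\<in>UNIV. inn (G x) (?e k) (\<phi> x *\<^sub>R grad G ?f x) *\<^sub>R ?e k)"
      by (rule frame_expand[OF frame_orthonormal])
    then show ?thesis
      using nz by (simp add: inn_algebra inn_sym[of "?e _"] grad_works[OF x lin] pdf)
  qed
  have tens: "tens (G x) (a *\<^sub>R Y) Z = a *\<^sub>R tens (G x) Y Z" "tens (G x) Z (a *\<^sub>R Y) = a *\<^sub>R tens (G x) Z Y"
    "tens (G x) (sum h I) Z = (\<Sum>i\<in>I. tens (G x) (h i) Z)" "tens (G x) Z (sum h I) = (\<Sum>i\<in>I. tens (G x) Z (h i))"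
    for a Y Z and h :: "4 \<Rightarrow> real^4" and I
    by (rule matrix_eq_vec; simp add: tens_works matvec_algebra inn_algebra inn_sum scaleR_sum_left scaleR_sum_right)+
  note linQ = linear_Q[OF x]
  have vec: "Wp_vec G J x (grad G ?f x) X = - (1/2) *\<^sub>R Q x (tens (G x) ?v X - tens (G x) X ?v)"
    unfolding Wp_vec_def W[OF x] gr[symmetric] tens(1,2)
    by (simp add: linear_diff[OF linQ] linear_scale[OF linQ] algebra_simps)
  have sumQ: "(\<Sum>k\<in>UNIV. pd \<phi> x (?e k) *\<^sub>R Q x (?A k)) = Q x (tens (G x) ?v X - tens (G x) X ?v)"
    by (simp add: tens linear_diff[OF linQ] linear_sum[OF linQ] linear_scale[OF linQ] sum_subtractf scaleR_diff_right)
  have NJ: "(\<Sum>k\<in>UNIV. inn (G x) (?e k) (J x *v X) *\<^sub>R N x (?e k)) = N x (J x *v X)"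
    by (subst (2) frame_expand[OF frame_orthonormal, of "J x *v X"])
      (simp add: linear_sum[OF linear_N[OF x]] linear_scale[OF linear_N[OF x]])
  have op: "nabla_op G (Wp G J) x u A = pd \<phi> x u *\<^sub>R Q x A + \<phi> x *\<^sub>R nabla_op G Q x u A" for u A
    by (rule nabla_op_scaled[OF x _ dl]) (rule W)
  have "delta_Wp G J x X = (1/2) *\<^sub>R (\<Sum>k\<in>UNIV. pd \<phi> x (?e k) *\<^sub>R Q x (?A k)
      + \<phi> x *\<^sub>R (- (3/8) *\<^sub>R ((2 * inn (G x) (?e k) (N x (?e k) *v X)) *\<^sub>R J x
          + (2 * inn (G x) (?e k) (J x *v X)) *\<^sub>R N x (?e k))))"
    unfolding delta_Wp_def op nabla_Q[OF x skew_tens] tr[OF N_skew[OF x]] tr[OF J_skew] by (rule refl)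
  also have "\<dots> = (1/2) *\<^sub>R (\<Sum>k\<in>UNIV. pd \<phi> x (?e k) *\<^sub>R Q x (?A k))
      - (3/8 * \<phi> x) *\<^sub>R ((\<Sum>k\<in>UNIV. inn (G x) (?e k) (N x (?e k) *v X)) *\<^sub>R J x
          + (\<Sum>k\<in>UNIV. inn (G x) (?e k) (J x *v X) *\<^sub>R N x (?e k)))"
    by (simp add: sum.distrib sum_subtractf sum_negf scaleR_sum_left scaleR_sum_right scaleR_add_right scaleR_diff_right
        mult.assoc mult.left_commute)
  finally show ?thesis unfolding sumQ NJ vec by simp
qed

text \<open>\<open>J\<close> and \<open>\<nabla>\<^bsub>JX\<^esub> J\<close> are orthogonal, so taking the trace against \<open>J\<close> separates the two summands of
  \<open>delta_formula\<close>; and \<open>J X\<close> runs through all vectors.\<close>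

lemma delta_vanishes_iff:
  assumes x: "x \<in> U" and W: "\<And>y B. y \<in> U \<Longrightarrow> Wp G J y B = \<phi> y *\<^sub>R Q y B"
    and nrm: "\<And>y. y \<in> U \<Longrightarrow> Wp_norm G J y = sqrt (3/2) * \<bar>\<phi> y\<bar>"
    and l: "smooth_on U \<phi>" and nz: "\<phi> x \<noteq> 0"
  shows "(\<forall>X. delta_Wp G J x X + Wp_vec G J x (grad G (\<lambda>y. ln (Wp_norm G J y)) x) X = 0)
    \<longleftrightarrow> (\<forall>u. N x u = 0)"
proof -
  interpret hermitian_space_4 "G x" "J x" by (rule hermitian_at[OF x])
  let ?c = "\<lambda>X. \<Sum>k\<in>UNIV. inn (G x) (frame (G x) k) (N x (frame (G x) k) *v X)"
  have "(\<forall>X. delta_Wp G J x X + Wp_vec G J x (grad G (\<lambda>y. ln (Wp_norm G J y)) x) X = 0)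
    \<longleftrightarrow> (\<forall>X. ?c X *\<^sub>R J x + N x (J x *v X) = 0)"
  proof -
    have "delta_Wp G J x X + Wp_vec G J x (grad G (\<lambda>y. ln (Wp_norm G J y)) x) X
        = - (3/8 * \<phi> x) *\<^sub>R (?c X *\<^sub>R J x + N x (J x *v X))" for X
      by (rule delta_formula[OF x W nrm l nz])
    then show ?thesis using nz by (simp del: scaleR_minus_left scaleR_add_right)
  qed
  also have "\<dots> \<longleftrightarrow> (\<forall>u. N x u = 0)"
  proof
    assume z: "\<forall>X. ?c X *\<^sub>R J x + N x (J x *v X) = 0"
    have "N x (J x *v X) = 0" for X
    proof -
      have "trace (J x ** N x u) = 0" for u
        using trace_mul_sym[of "J x" "N x u"] N_anticommutes[OF x, of u] by (simp add: trace_algebra)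
      then have "trace (J x ** (?c X *\<^sub>R J x + N x (J x *v X))) = ?c X * - 4"
        using trace_J_J by (simp add: matmul_algebra trace_algebra)
      then have "?c X = 0" using z by (simp add: matmul_algebra trace_algebra)
      then show ?thesis using z[rule_format, of X] by simp
    qed
    from this[of "- (J x *v _)"] show "\<forall>u. N x u = 0"
      by (simp add: matvec_algebra J_J)
  qed (simp add: matvec_algebra inn_algebra)
  finally show ?thesis .
qed

end

section \<open>The two conditions in a chart\<close>

text \<open>The frame at a point is an arbitrary choice and need not depend continuously on the point.
  Contracting with the inverse of the metric instead shows that scalar curvatures are smooth.\<close>

lemma (in metric_space_4) frame_sum_inverse:
  assumes B: "bilinear B" and e: "orthonormal_frame G e"
  shows "(\<Sum>k\<in>UNIV. B (e k) (e k))
    = (\<Sum>a\<in>UNIV. \<Sum>b\<in>UNIV. (matrix_inv G $ a $ b) *\<^sub>R B (axis a 1) (axis b 1))"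
proof -
  interpret l: linear "\<lambda>u. B u v" for v using B by (simp add: bilinear_def)
  interpret r: linear "B u" for u using B by (simp add: bilinear_def)
  let ?E = "frame_matrix e"
  have ax: "v = (\<Sum>a\<in>UNIV. v $ a *\<^sub>R axis a 1)" for v :: "real^4"
    by (simp add: vec_eq_iff axis_def if_distrib cong: if_cong)
  have "?E ** transpose ?E = ?E ** transpose ?E ** (G ** matrix_inv G)"
    by (simp add: matrix_inv_right4[OF invertible_metric])
  also have "\<dots> = matrix_inv G"
    by (simp add: matrix_mul_assoc frame_matrix_gram(2)[OF e])
  finally have inv: "matrix_inv G $ a $ b = (\<Sum>k\<in>UNIV. e k $ a * e k $ b)" for a b
    by (simp add: matrix_matrix_mult_def transpose_def frame_matrix_def vec_eq_iff)
  have exp: "B u v = (\<Sum>a\<in>UNIV. \<Sum>b\<in>UNIV. (u $ a * v $ b) *\<^sub>R B (axis a 1) (axis b 1))" for u v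
  proof -
    have "B u v = B (\<Sum>a\<in>UNIV. u $ a *\<^sub>R axis a 1) (\<Sum>b\<in>UNIV. v $ b *\<^sub>R axis b 1)"
      using ax[of u] ax[of v] by simp
    also have "\<dots> = (\<Sum>a\<in>UNIV. u $ a *\<^sub>R B (axis a 1) (\<Sum>b\<in>UNIV. v $ b *\<^sub>R axis b 1))"
      by (simp only: l.sum l.scale)
    finally show ?thesis by (simp only: r.sum r.scale scaleR_sum_right scaleR_scaleR)
  qed
  have "(\<Sum>k\<in>UNIV. B (e k) (e k))
      = (\<Sum>k\<in>UNIV. \<Sum>a\<in>UNIV. \<Sum>b\<in>UNIV. (e k $ a * e k $ b) *\<^sub>R B (axis a 1) (axis b 1))"
    by (intro sum.cong refl exp)
  also have "\<dots> = (\<Sum>a\<in>UNIV. \<Sum>k\<in>UNIV. \<Sum>b\<in>UNIV. (e k $ a * e k $ b) *\<^sub>R B (axis a 1) (axis b 1))"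
    by (rule sum.swap)
  also have "\<dots> = (\<Sum>a\<in>UNIV. \<Sum>b\<in>UNIV. \<Sum>k\<in>UNIV. (e k $ a * e k $ b) *\<^sub>R B (axis a 1) (axis b 1))"
    by (intro sum.cong refl sum.swap)
  finally show ?thesis by (simp add: inv scaleR_sum_left)
qed

lemma differentiable_compose_at:
  "f differentiable (at x) \<Longrightarrow> h differentiable (at (f x)) \<Longrightarrow> (\<lambda>y. h (f y)) differentiable (at x)"
  using has_derivative_compose[OF pd_works pd_works, of f x h] by (auto simp: differentiable_def)

context hermitian_chart
begin

lemma Rm_linear_snd: assumes "x \<in> U" shows "linear (Rm x u)"
proof -
  have "Rm x u = (\<lambda>v. - Rm x v u)" by (rule ext) (rule Rm_antisym)
  then show ?thesis using linear_compose_neg[OF Rm_linear[OF assms], of u] by simp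
qed

lemma smooth_Rm_field:
  assumes "smooth_on U a" "smooth_on U b"
  shows "smooth_on U (\<lambda>x. Rm x (a x) (b x))"
proof -
  have ax: "v = (\<Sum>a\<in>UNIV. v $ a *\<^sub>R axis a 1)" for v :: "real^4"
    by (simp add: vec_eq_iff axis_def if_distrib cong: if_cong)
  note lin2 = Rm_linear_snd
  have eq: "(\<Sum>i\<in>UNIV. \<Sum>j\<in>UNIV. (a x $ i * b x $ j) *\<^sub>R Rm x (axis i 1) (axis j 1)) = Rm x (a x) (b x)"
    if x: "x \<in> U" for x
  proof -
    have "Rm x (a x) (b x) = Rm x (\<Sum>i\<in>UNIV. a x $ i *\<^sub>R axis i 1) (\<Sum>j\<in>UNIV. b x $ j *\<^sub>R axis j 1)"
      using ax[of "a x"] ax[of "b x"] by simp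
    then show ?thesis
      by (simp only: linear_sum[OF lin2[OF x]] linear_scale[OF lin2[OF x]] linear_sum[OF Rm_linear[OF x]]
        linear_scale[OF Rm_linear[OF x]] scaleR_sum_right scaleR_scaleR)
        (subst sum.swap, simp add: mult.commute)
  qed
  have nth: "smooth_on U (\<lambda>x. c x $ i)" if "smooth_on U c" for c :: vfield and i
    by (rule smooth_on_bounded_linear[OF open_U bounded_linear_vec_nth that])
  show ?thesis
    by (rule smooth_on_cong[OF open_U], erule eq)
      (intro smooth_on_sum[OF open_U] smooth_on_bilinear[OF open_U bounded_bilinear_scaleR]
        smooth_on_bilinear[OF open_U bounded_bilinear_mult] nth assms smooth_Rm)
qed

lemma smooth_curvature_contraction:
  assumes "\<And>x u. x \<in> U \<Longrightarrow> linear (C x)" and C: "\<And>u. smooth_on U (\<lambda>x. C x u)"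
  shows "smooth_on U (\<lambda>x. \<Sum>i\<in>UNIV. \<Sum>k\<in>UNIV.
    inn (G x) (Rm x (C x (frame (G x) i)) (C x (frame (G x) k)) *v frame (G x) k) (frame (G x) i))"
proof -
  let ?r = "\<lambda>x u v w z. inn (G x) (Rm x (C x u) (C x v) *v w) z"
  let ?I = "\<lambda>x. matrix_inv (G x)"
  have nth: "smooth_on U (\<lambda>x. ?I x $ a $ b)" for a b
    by (rule smooth_on_entry[OF open_U smooth_Ginv])
  have r: "smooth_on U (\<lambda>x. ?r x u v w z)" for u v w z
    unfolding inn_def
    by (rule smooth_on_bilinear[OF open_U bounded_bilinear_inner])
      (rule smooth_on_bilinear[OF open_U bounded_bilinear_matvec] smooth_Rm_field C smooth_on_const[OF open_U] smooth_G)+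
  have eq: "(\<Sum>a\<in>UNIV. \<Sum>b\<in>UNIV. ?I x $ a $ b *\<^sub>R (\<Sum>c\<in>UNIV. \<Sum>d\<in>UNIV. ?I x $ c $ d *\<^sub>R
        ?r x (axis a 1) (axis c 1) (axis d 1) (axis b 1)))
      = (\<Sum>i\<in>UNIV. \<Sum>k\<in>UNIV. ?r x (frame (G x) i) (frame (G x) k) (frame (G x) k) (frame (G x) i))"
    if x: "x \<in> U" for x
  proof -
    interpret hermitian_space_4 "G x" "J x" by (rule hermitian_at[OF x])
    note lin1 = Rm_linear[OF x] and linC = assms(1)[OF x]
    note lin2 = Rm_linear_snd[OF x]
    have b1: "bilinear (\<lambda>v w. ?r x u v w z)" for u z
      unfolding bilinear_def
      by (auto intro!: linearI simp: matvec_algebra inn_algebra linear_add[OF lin2] linear_scale[OF lin2]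
          linear_add[OF linC] linear_scale[OF linC])
    have b2: "bilinear (\<lambda>u z. \<Sum>c\<in>UNIV. \<Sum>d\<in>UNIV. ?I x $ c $ d *\<^sub>R ?r x u (axis c 1) (axis d 1) z)"
      unfolding bilinear_def
      by (auto intro!: linearI simp: matvec_algebra inn_algebra linear_add[OF lin1] linear_scale[OF lin1]
          linear_add[OF linC] linear_scale[OF linC] sum.distrib sum_distrib_left algebra_simps)
    show ?thesis
      unfolding frame_sum_inverse[OF b1 frame_orthonormal] frame_sum_inverse[OF b2 frame_orthonormal] ..
  qed
  show ?thesis
    by (rule smooth_on_cong[OF open_U], erule eq)
      (intro smooth_on_sum[OF open_U] smooth_on_bilinear[OF open_U bounded_bilinear_scaleR] nth r)
qed

text \<open>The number \<open>\<langle>W\<^sub>+ J, J\<rangle>\<close>, see \<open>t11_scal\<close>.\<close>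

definition lam :: "point \<Rightarrow> real" where
  "lam x = 1/2 * (scal_star G J x - scal G x / 3)"

lemma smooth_lam: "smooth_on U lam"
proof -
  note fr = hermitian_space_4.frame_orthonormal[OF hermitian_at]
  have s1: "smooth_on U (\<lambda>x. \<Sum>i\<in>UNIV. \<Sum>k\<in>UNIV.
    inn (G x) (Rm x (frame (G x) i) (frame (G x) k) *v frame (G x) k) (frame (G x) i))"
    by (rule smooth_curvature_contraction[where C="\<lambda>x u. u"]) (auto intro: linearI smooth_on_const[OF open_U])
  have s2: "(\<Sum>i\<in>UNIV. \<Sum>k\<in>UNIV.
      inn (G x) (Rm x (frame (G x) i) (frame (G x) k) *v frame (G x) k) (frame (G x) i)) = scal G x"
    if x: "x \<in> U" for x
    unfolding curvature_point.scal_frame[OF curvature_at[OF x] fr[OF x]] Riem_Rm[OF x] ..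
  have s: "smooth_on U (scal G)"
    by (rule smooth_on_cong[OF open_U s2 s1])
  have "smooth_on U (\<lambda>x. J x *v u)" for u
    by (rule smooth_on_bilinear[OF open_U bounded_bilinear_matvec smooth_J smooth_on_const[OF open_U]])
  then have t1: "smooth_on U (\<lambda>x. \<Sum>i\<in>UNIV. \<Sum>k\<in>UNIV.
    inn (G x) (Rm x (J x *v frame (G x) i) (J x *v frame (G x) k) *v frame (G x) k) (frame (G x) i))"
    by (intro smooth_curvature_contraction[where C="\<lambda>x u. J x *v u"]) auto
  have t2: "(\<Sum>i\<in>UNIV. \<Sum>k\<in>UNIV.
      inn (G x) (Rm x (J x *v frame (G x) i) (J x *v frame (G x) k) *v frame (G x) k) (frame (G x) i)) = scal_star G J x"
    if x: "x \<in> U" for x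
    unfolding curvature_point.scal_star_frame[OF curvature_at[OF x] fr[OF x]] Riem_Rm[OF x] ..
  have ss: "smooth_on U (scal_star G J)"
    by (rule smooth_on_cong[OF open_U t2 t1])
  have "smooth_on U (\<lambda>x. 1/2 * (scal_star G J x - 1/3 * scal G x))"
    by (intro smooth_on_bounded_linear[OF open_U bounded_linear_mult_right] smooth_on_diff[OF open_U] s ss)
  then show ?thesis by (rule smooth_on_cong[OF open_U, rotated]) (simp add: lam_def)
qed

lemma norm_condition_iff:
  "x \<in> U \<Longrightarrow> Wp_sqnorm G J x = 3/8 * (scal_star G J x - scal G x / 3)^2 \<longleftrightarrow>
    (\<forall>A. Wp G J x A = lam x *\<^sub>R Q x A)"
  unfolding lam_def Q_def by (rule curvature_point.norm_condition_iff_Qf[OF curvature_at])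

lemma norm_condition_Wp_norm:
  assumes "Wp_sqnorm G J x = 3/8 * (scal_star G J x - scal G x / 3)^2"
  shows "Wp_norm G J x = sqrt (3/2) * \<bar>lam x\<bar>"
proof -
  have "Wp_sqnorm G J x = 3/2 * (lam x)^2" unfolding assms lam_def by (simp add: power2_eq_square)
  then show ?thesis unfolding Wp_norm_def by (simp only: real_sqrt_mult real_sqrt_abs)
qed

lemma norm_condition_Wp_nonzero:
  assumes x: "x \<in> U" and c: "Wp_sqnorm G J x = 3/8 * (scal_star G J x - scal G x / 3)^2"
  shows "Wp_nonzero G J x \<longleftrightarrow> lam x \<noteq> 0"
proof -
  interpret hermitian_space_4 "G x" "J x" by (rule hermitian_at[OF x])
  have W: "Wp G J x A = lam x *\<^sub>R Q x A" for A using c norm_condition_iff[OF x] by blast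
  have "Q x (J x) \<noteq> 0"
    using Qf_J trace_J_J by (auto simp: Q_def matmul_algebra trace_algebra)
  then show ?thesis
    unfolding Wp_nonzero_def W using J_skew by auto
qed

lemma delta_condition_iff_parallel:
  assumes c: "\<And>y. y \<in> U \<Longrightarrow> Wp_sqnorm G J y = 3/8 * (scal_star G J y - scal G y / 3)^2"
    and x: "x \<in> U" "lam x \<noteq> 0"
  shows "(\<forall>X. delta_Wp G J x X + Wp_vec G J x (grad G (\<lambda>y. ln (Wp_norm G J y)) x) X = 0)
    \<longleftrightarrow> (\<forall>u. nabla_end G J x u = 0)"
proof (rule delta_vanishes_iff[OF x(1) _ _ smooth_lam x(2)])
  fix y B assume y: "y \<in> U"
  then show "Wp G J y B = lam y *\<^sub>R Q y B" using c[OF y] norm_condition_iff[OF y] by blast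
next
  fix y assume y: "y \<in> U"
  then show "Wp_norm G J y = sqrt (3/2) * \<bar>lam y\<bar>" by (rule norm_condition_Wp_norm[OF c])
qed

end

section \<open>Invariance under change of coordinates\<close>

lemma (in chart_metric) pd_Gam_field:
  assumes W: "open W" "x \<in> W" "\<And>y. y \<in> W \<Longrightarrow> \<Phi> y \<in> U"
    and d: "\<Phi> differentiable (at x)" "w differentiable (at x)"
  shows "pd (\<lambda>y. Gam (\<Phi> y) (w y)) x u
    = pd (\<lambda>z. Gam z (w x)) (\<Phi> x) (pd \<Phi> x u) + Gam (\<Phi> x) (pd w x u)"
    and "(\<lambda>y. Gam (\<Phi> y) (w y)) differentiable (at x)"
proof -
  have ax: "v = (\<Sum>a\<in>UNIV. v $ a *\<^sub>R axis a 1)" for v :: "real^4"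
    by (simp add: vec_eq_iff axis_def if_distrib cong: if_cong)
  have z: "\<Phi> x \<in> U" using W by blast
  have exp: "Gam z v = (\<Sum>a\<in>UNIV. v $ a *\<^sub>R Gam z (axis a 1))" if "z \<in> U" for z v
    by (subst ax[of v]) (simp only: linear_sum[OF Gam_linear[OF that]] linear_scale[OF Gam_linear[OF that]])
  have dc: "(\<lambda>y. Gam (\<Phi> y) v) differentiable (at x)" for v
    using differentiable_compose_at[OF d(1), of "\<lambda>z. Gam z v"] Gam_diff[OF z] by simp
  have dn: "(\<lambda>y. w y $ a) differentiable (at x)" for a
    by (rule differentiable_linear[OF bounded_linear_vec_nth d(2)])
  have dt: "(\<lambda>y. w y $ a *\<^sub>R Gam (\<Phi> y) (axis a 1)) differentiable (at x)" for a
    by (rule differentiable_bilinear[OF bounded_bilinear_scaleR dn dc])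
  have eq: "Gam (\<Phi> y) (w y) = (\<Sum>a\<in>UNIV. w y $ a *\<^sub>R Gam (\<Phi> y) (axis a 1))" if "y \<in> W" for y
    by (rule exp[OF W(3)[OF that]])
  show "(\<lambda>y. Gam (\<Phi> y) (w y)) differentiable (at x)"
    using differentiable_cong_open[OF W(1,2) eq] differentiable_sum[OF finite, of UNIV] dt by simp
  have "pd (\<lambda>y. Gam (\<Phi> y) (w y)) x u = pd (\<lambda>y. \<Sum>a\<in>UNIV. w y $ a *\<^sub>R Gam (\<Phi> y) (axis a 1)) x u"
    by (rule pd_cong[OF W(1,2) eq])
  also have "\<dots> = (\<Sum>a\<in>UNIV. pd (\<lambda>y. w y $ a *\<^sub>R Gam (\<Phi> y) (axis a 1)) x u)"
    by (rule pd_eqI[OF has_derivative_sum[OF pd_works[OF dt]]])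
  also have "\<dots> = (\<Sum>a\<in>UNIV. w x $ a *\<^sub>R pd (\<lambda>z. Gam z (axis a 1)) (\<Phi> x) (pd \<Phi> x u))
      + (\<Sum>a\<in>UNIV. pd w x u $ a *\<^sub>R Gam (\<Phi> x) (axis a 1))"
    by (simp only: pd_bilinear[OF bounded_bilinear_scaleR dn dc] pd_linear[OF bounded_linear_vec_nth d(2)]
        pd_compose[OF d(1) Gam_diff[OF z]] sum.distrib)
  also have "(\<Sum>a\<in>UNIV. w x $ a *\<^sub>R pd (\<lambda>z. Gam z (axis a 1)) (\<Phi> x) (pd \<Phi> x u))
      = pd (\<lambda>z. Gam z (w x)) (\<Phi> x) (pd \<Phi> x u)"
    by (subst (2) ax[of "w x"])
      (simp only: linear_sum[OF pd_Gam_linear[OF z]] linear_scale[OF pd_Gam_linear[OF z]])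
  finally show "pd (\<lambda>y. Gam (\<Phi> y) (w y)) x u
    = pd (\<lambda>z. Gam z (w x)) (\<Phi> x) (pd \<Phi> x u) + Gam (\<Phi> x) (pd w x u)"
    by (simp only: exp[OF z, of "pd w x u"])
qed

locale chart_change = src: hermitian_chart U G J + tgt: hermitian_chart V H K
  for U G J V H K +
  fixes W :: "point set" and \<Phi> :: "point \<Rightarrow> point"
  assumes open_W: "open W" and W_U: "W \<subseteq> U" and smooth_\<Phi>: "smooth_on W \<Phi>"
    and \<Phi>_V: "x \<in> W \<Longrightarrow> \<Phi> x \<in> V"
    and G_H: "x \<in> W \<Longrightarrow> inn (G x) u v = inn (H (\<Phi> x)) (pd \<Phi> x u) (pd \<Phi> x v)"
    and J_K: "x \<in> W \<Longrightarrow> pd \<Phi> x (J x *v u) = K (\<Phi> x) *v pd \<Phi> x u"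
begin

definition P :: "point \<Rightarrow> real^4^4" where "P x = matrix (pd \<Phi> x)"

lemmas \<Phi>_diff = smooth_on_differentiable[OF smooth_\<Phi>]

lemma P_works: "x \<in> W \<Longrightarrow> P x *v u = pd \<Phi> x u"
  unfolding P_def by (rule matrix_works4[OF linear_pd[OF \<Phi>_diff]])

lemma smooth_P: "smooth_on W P"
proof (rule smooth_on_matrix[OF open_W])
  fix u show "smooth_on W (\<lambda>x. P x *v u)"
    by (rule smooth_on_cong[OF open_W _ smooth_on_frechet_derivative[OF smooth_\<Phi>]]) (simp add: P_works)
qed

lemmas P_diff = smooth_on_differentiable[OF smooth_P]

lemma inn_P: "x \<in> W \<Longrightarrow> inn (H (\<Phi> x)) (P x *v u) (P x *v v) = inn (G x) u v"
  by (simp add: P_works G_H)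

lemma pd_P_sym: assumes x: "x \<in> W" shows "pd P x u *v v = pd P x v *v u"
proof -
  have "pd P x u *v v = pd (\<lambda>y. pd \<Phi> y v) x u" for u v
  proof -
    have "pd (\<lambda>y. P y *v v) x u = pd (\<lambda>y. pd \<Phi> y v) x u"
      by (rule pd_cong[OF open_W x]) (rule P_works)
    then show ?thesis by (simp add: pd_matvec_const[OF P_diff[OF x]])
  qed
  then show ?thesis using second_derivative_sym[OF open_W smooth_\<Phi> x] by simp
qed

lemma invertible_P: assumes x: "x \<in> W" shows "invertible (P x)"
proof -
  have "P x *v v = 0 \<Longrightarrow> v = 0" for v
  proof (rule ccontr)
    assume "P x *v v = 0" "v \<noteq> 0"
    moreover have "inn (G x) v v > 0" using src.G_pos[OF _ \<open>v \<noteq> 0\<close>] W_U x by blast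
    ultimately show False using inn_P[OF x, of v v] by (simp add: inn_algebra)
  qed
  then show ?thesis unfolding invertible_left_inverse matrix_left_invertible_ker by blast
qed

text \<open>The connection matrix of the target chart, pulled back to the source chart.\<close>

definition \<theta> :: "point \<Rightarrow> real^4 \<Rightarrow> real^4^4" where "\<theta> x u = tgt.Gam (\<Phi> x) (P x *v u)"

text \<open>Product rule for \<open>P\<^sup>T h P\<close>, where \<open>h\<close> is the target metric along the coordinate change, and
  compatibility of \<open>h\<close> with its connection.\<close>

lemma pd_metric:
  assumes x: "x \<in> W"
  shows "pd (\<lambda>y. inn (G y) v w) x u
    = inn (H (\<Phi> x)) ((pd P x u + \<theta> x u ** P x) *v v) (P x *v w)
      + inn (H (\<Phi> x)) (P x *v v) ((pd P x u + \<theta> x u ** P x) *v w)"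
proof -
  note z = \<Phi>_V[OF x]
  have dP: "(\<lambda>y. P y *v a) differentiable (at x)" for a
    by (rule differentiable_linear[OF bounded_bilinear.bounded_linear_left[OF bounded_bilinear_matvec] P_diff[OF x]])
  have dH: "(\<lambda>y. H (\<Phi> y)) differentiable (at x)"
    using differentiable_compose_at[OF \<Phi>_diff[OF x], of H] tgt.G_diff[OF z] by simp
  have dHP: "(\<lambda>y. H (\<Phi> y) *v (P y *v w)) differentiable (at x)"
    by (rule differentiable_bilinear[OF bounded_bilinear_matvec dH dP])
  have "pd (\<lambda>y. inn (G y) v w) x u = pd (\<lambda>y. (P y *v v) \<bullet> (H (\<Phi> y) *v (P y *v w))) x u"
    by (rule pd_cong[OF open_W x]) (simp add: inn_def[symmetric] inn_P)
  also have "\<dots> = (P x *v v) \<bullet> (H (\<Phi> x) *v (pd P x u *v w) + pd H (\<Phi> x) (P x *v u) *v (P x *v w))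
      + (pd P x u *v v) \<bullet> (H (\<Phi> x) *v (P x *v w))"
    by (simp only: pd_bilinear[OF bounded_bilinear_inner dP dHP] pd_matvec[OF dH dP] pd_matvec_const[OF P_diff[OF x]]
        pd_compose[OF \<Phi>_diff[OF x] tgt.G_diff[OF z]] P_works[OF x])
  finally show ?thesis
    by (simp add: inner_add_right tgt.Gam_compat_inn[OF z] matvec_algebra inn_algebra \<theta>_def matrix_vector_mul_assoc[symmetric])
      (simp add: inn_def)
qed

text \<open>The transformation law of the Christoffel symbols: \<open>P\<^bsup>-1\<^esup> (\<partial>\<^sub>u P + \<theta>\<^sub>u P)\<close> is
  symmetric, since second derivatives commute, and compatible with the source metric, so it is the
  connection matrix of the source chart.\<close>

lemma Gam_change: assumes x: "x \<in> W" shows "pd P x u = P x ** src.Gam x u - \<theta> x u ** P x"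
proof -
  have xU: "x \<in> U" using x W_U by blast
  define \<Gamma> where "\<Gamma> u v = matrix_inv (P x) *v ((pd P x u + \<theta> x u ** P x) *v v)" for u v
  have PG: "P x *v \<Gamma> u v = (pd P x u + \<theta> x u ** P x) *v v" for u v
    unfolding \<Gamma>_def matrix_vector_mul_assoc matrix_mul_assoc matrix_inv_right4[OF invertible_P[OF x]] by simp
  have "christoffel G x = \<Gamma>"
  proof (rule christoffel_eqI[where g=G and x=x])
    show "metric_space_4 (G x)" by (rule src.metric_at[OF xU])
    show "\<Gamma> u v = \<Gamma> v u" for u v
    proof -
      have "\<theta> x u *v (P x *v v) = \<theta> x v *v (P x *v u)"
        unfolding \<theta>_def by (rule tgt.Gam_sym[OF \<Phi>_V[OF x]])
      then show ?thesis
        unfolding \<Gamma>_def by (simp add: matvec_algebra matrix_vector_mul_assoc[symmetric] pd_P_sym[OF x, of u v])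
    qed
    show "bilinear \<Gamma>"
      unfolding bilinear_def \<Gamma>_def \<theta>_def
      by (auto intro!: linearI simp: matvec_algebra linear_add[OF linear_pd[OF P_diff[OF x]]]
          linear_scale[OF linear_pd[OF P_diff[OF x]]] linear_add[OF tgt.Gam_linear[OF \<Phi>_V[OF x]]]
          linear_scale[OF tgt.Gam_linear[OF \<Phi>_V[OF x]]] matmul_algebra algebra_simps)
    show "pd (\<lambda>y. inn (G y) v w) x u = inn (G x) (\<Gamma> u v) w + inn (G x) v (\<Gamma> u w)" for u v w
      unfolding inn_P[OF x, symmetric] PG by (rule pd_metric[OF x])
  qed
  then have "src.Gam x u *v v = \<Gamma> u v" for v using src.christoffel_Gam[OF xU] by simp
  then have "(P x ** src.Gam x u) *v v = (pd P x u + \<theta> x u ** P x) *v v" for v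
    using PG[of u v] by (simp only: matrix_vector_mul_assoc[symmetric])
  then have "P x ** src.Gam x u = pd P x u + \<theta> x u ** P x" by (rule matrix_eq_vec)
  then show ?thesis by simp
qed

text \<open>The integrability condition of the linear system \<open>Gam_change\<close> for \<open>P\<close>.\<close>

lemma Rm_change: assumes x: "x \<in> W"
  shows "tgt.Rm (\<Phi> x) (P x *v u) (P x *v v) ** P x = P x ** src.Rm x u v"
proof -
  have xU: "x \<in> U" using x W_U by blast
  have dPv: "(\<lambda>y. P y *v v) differentiable (at x)" for v
    by (rule differentiable_linear[OF bounded_bilinear.bounded_linear_left[OF bounded_bilinear_matvec] P_diff[OF x]])
  let ?D = "\<lambda>u v. pd (\<lambda>z. tgt.Gam z (P x *v v)) (\<Phi> x) (P x *v u)"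
  have d\<theta>: "pd (\<lambda>y. \<theta> y v) x u = ?D u v + tgt.Gam (\<Phi> x) (pd P x u *v v)" for u v
  proof -
    have "pd (\<lambda>y. \<theta> y v) x u = pd (\<lambda>z. tgt.Gam z (P x *v v)) (\<Phi> x) (pd \<Phi> x u)
        + tgt.Gam (\<Phi> x) (pd (\<lambda>y. P y *v v) x u)"
      unfolding \<theta>_def by (rule tgt.pd_Gam_field(1)[OF open_W x _ \<Phi>_diff[OF x] dPv], erule \<Phi>_V)
    then show ?thesis by (simp only: pd_matvec_const[OF P_diff[OF x]] P_works[OF x])
  qed
  have \<theta>_diff: "(\<lambda>y. \<theta> y v) differentiable (at x)" for v
    unfolding \<theta>_def by (rule tgt.pd_Gam_field(2)[OF open_W x _ \<Phi>_diff[OF x] dPv], erule \<Phi>_V)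
  have "pd (\<lambda>y. pd P y v) x u
      = P x ** pd (\<lambda>y. src.Gam y v) x u + (P x ** src.Gam x u - \<theta> x u ** P x) ** src.Gam x v
       - (\<theta> x v ** (P x ** src.Gam x u - \<theta> x u ** P x) + (?D u v + tgt.Gam (\<Phi> x) (pd P x u *v v)) ** P x)" for u v
  proof -
    have "pd (\<lambda>y. pd P y v) x u = pd (\<lambda>y. P y ** src.Gam y v - \<theta> y v ** P y) x u"
      by (rule pd_cong[OF open_W x]) (rule Gam_change)
    also have "\<dots> = pd (\<lambda>y. P y ** src.Gam y v) x u - pd (\<lambda>y. \<theta> y v ** P y) x u"
      by (rule pd_diff; intro differentiable_bilinear[OF bounded_bilinear_matmul] P_diff[OF x] src.Gam_diff[OF xU] \<theta>_diff)
    finally show ?thesis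
      by (simp only: pd_matmul[OF P_diff[OF x] src.Gam_diff[OF xU]] pd_matmul[OF \<theta>_diff P_diff[OF x]] Gam_change[OF x] d\<theta>)
  qed
  from this[of u v] this[of v u] second_derivative_sym[OF open_W smooth_P x, of u v]
  have "P x ** pd (\<lambda>y. src.Gam y v) x u + (P x ** src.Gam x u - \<theta> x u ** P x) ** src.Gam x v
       - (\<theta> x v ** (P x ** src.Gam x u - \<theta> x u ** P x) + (?D u v + tgt.Gam (\<Phi> x) (pd P x u *v v)) ** P x)
     = P x ** pd (\<lambda>y. src.Gam y u) x v + (P x ** src.Gam x v - \<theta> x v ** P x) ** src.Gam x u
       - (\<theta> x u ** (P x ** src.Gam x v - \<theta> x v ** P x) + (?D v u + tgt.Gam (\<Phi> x) (pd P x u *v v)) ** P x)"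
    by (simp only: pd_P_sym[OF x, of v u])
  then show ?thesis
    unfolding tgt.Rm_def src.Rm_def \<theta>_def[symmetric]
    by (simp add: matmul_algebra matrix_mul_assoc algebra_simps)
qed

lemma lam_change: assumes x: "x \<in> W" shows "tgt.lam (\<Phi> x) = src.lam x"
proof -
  have xU: "x \<in> U" using x W_U by blast
  note z = \<Phi>_V[OF x]
  interpret s: curvature_point G J x by (rule src.curvature_at[OF xU])
  interpret t: curvature_point H K "\<Phi> x" by (rule tgt.curvature_at[OF z])
  let ?e = "frame (G x)" and ?f = "\<lambda>k. P x *v frame (G x) k"
  have f: "orthonormal_frame (H (\<Phi> x)) ?f"
    using s.frame_orthonormal by (simp add: orthonormal_frame_def inn_P[OF x])
  have R: "Riem H (\<Phi> x) (P x *v u) (P x *v v) (P x *v w) = P x *v Riem G x u v w" for u v w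
    by (simp only: tgt.Riem_Rm[OF z] src.Riem_Rm[OF xU] matrix_vector_mul_assoc Rm_change[OF x])
  have KP: "K (\<Phi> x) *v (P x *v u) = P x *v (J x *v u)" for u by (simp add: P_works[OF x] J_K[OF x])
  show ?thesis
    unfolding src.lam_def tgt.lam_def s.scal_frame[OF s.frame_orthonormal] s.scal_star_frame[OF s.frame_orthonormal]
      t.scal_frame[OF f] t.scal_star_frame[OF f] KP R inn_P[OF x] ..
qed

end

section \<open>Kaehler surfaces\<close>

context almost_hermitian_4_manifold
begin

lemma hermitian_chart: "c \<in> A \<Longrightarrow> hermitian_chart (chart_image c) (g c) (J c)"
  by unfold_locales
    (auto intro: open_image metric_smooth metric_sym metric_pos J_smooth J_square J_skew)

lemma domain_subset: "c \<in> A \<Longrightarrow> fst c \<subseteq> topspace M"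
  using open_domain openin_subset by blast

lemma inj_chart: "c \<in> A \<Longrightarrow> inj_on (snd c) (fst c)"
  using homeomorphic_imp_injective_map[OF homeomorphic] domain_subset by (simp add: inf_absorb2)

lemma transition_at: "c \<in> A \<Longrightarrow> p \<in> fst c \<Longrightarrow> transition c d (snd c p) = snd d p"
  by (simp add: transition_def inv_into_f_f inj_chart)

lemma open_overlap:
  assumes "c \<in> A" "d \<in> A" shows "open (snd c ` (fst c \<inter> fst d))"
proof -
  have "openin (subtopology M (fst c)) (fst c \<inter> fst d)"
    using open_domain[OF assms(2)] openin_subtopology_Int2 by blast
  then have "openin (top_of_set (chart_image c)) (snd c ` (fst c \<inter> fst d))"
    using homeomorphic_imp_open_map[OF homeomorphic[OF assms(1)]] open_map_def by blast
  then show ?thesis using open_image[OF assms(1)] by (simp add: openin_open_eq)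
qed

lemma chart_change:
  assumes c: "c \<in> A" and d: "d \<in> A"
  shows "chart_change (chart_image c) (g c) (J c) (chart_image d) (g d) (J d)
    (snd c ` (fst c \<inter> fst d)) (transition c d)"
proof -
  have jac: "jacobian c d x *v u = pd (transition c d) x u" if "x \<in> snd c ` (fst c \<inter> fst d)" for x u
    unfolding jacobian_def
    by (rule matrix_works4[OF linear_pd[OF smooth_on_differentiable[OF smooth_transition[OF c d] that]]])
  show ?thesis
  proof (intro chart_change.intro hermitian_chart c d chart_change_axioms.intro)
    show "open (snd c ` (fst c \<inter> fst d))" by (rule open_overlap[OF c d])
    show "snd c ` (fst c \<inter> fst d) \<subseteq> chart_image c" by (auto simp: chart_image_def)
    show "smooth_on (snd c ` (fst c \<inter> fst d)) (transition c d)" by (rule smooth_transition[OF c d])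
    fix x u v assume x: "x \<in> snd c ` (fst c \<inter> fst d)"
    show "transition c d x \<in> chart_image d" using x c by (auto simp: transition_at chart_image_def)
    show "inn (g c x) u v = inn (g d (transition c d x)) (pd (transition c d) x u) (pd (transition c d) x v)"
      using metric_transform[OF c d x] by (simp add: jac[OF x])
    show "pd (transition c d) x (J c x *v u) = J d (transition c d x) *v pd (transition c d) x u"
      using J_transform[OF c d x] by (simp add: jac[OF x])
  qed
qed

lemma lam_chart_independent:
  assumes "c \<in> charts_at A p" "d \<in> charts_at A p"
  shows "hermitian_chart.lam (g d) (J d) (snd d p) = hermitian_chart.lam (g c) (J c) (snd c p)"
proof -
  have cd: "c \<in> A" "d \<in> A" "p \<in> fst c" "p \<in> fst d" using assms by (auto simp: charts_at_def)
  then have "snd c p \<in> snd c ` (fst c \<inter> fst d)" by blast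
  from chart_change.lam_change[OF chart_change[OF cd(1,2)] this]
  show ?thesis by (simp add: transition_at cd)
qed

lemma chart_point:
  assumes "c \<in> A" "x \<in> chart_image c"
  obtains p where "p \<in> topspace M" "c \<in> charts_at A p" "x = snd c p"
proof -
  obtain p where p: "p \<in> fst c" "x = snd c p" using assms(2) by (auto simp: chart_image_def)
  have "p \<in> topspace M" using domain_subset[OF assms(1)] p(1) by blast
  moreover have "c \<in> charts_at A p" using assms(1) p(1) by (simp add: charts_at_def)
  ultimately show ?thesis using p(2) by (rule that)
qed

text \<open>A continuous field that is nonzero at \<open>p\<close> is nonzero on a neighbourhood of \<open>p\<close> in the chart
  domain, which meets the dense set.\<close>

lemma dense_extension:
  assumes dense: "M closure_of D = topspace M" and c: "c \<in> charts_at A p"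
    and cont: "continuous_on (chart_image c) (f :: point \<Rightarrow> real^4^4)"
    and zero: "\<And>q. q \<in> D \<Longrightarrow> c \<in> charts_at A q \<Longrightarrow> f (snd c q) = 0"
  shows "f (snd c p) = 0"
proof (rule ccontr)
  assume nz: "f (snd c p) \<noteq> 0"
  have cA: "c \<in> A" and p: "p \<in> fst c" using c by (auto simp: charts_at_def)
  let ?O = "chart_image c \<inter> f -` (- {0})"
  let ?T = "{q \<in> topspace (subtopology M (fst c)). snd c q \<in> ?O}"
  have "openin (top_of_set (chart_image c)) ?O"
    by (rule continuous_openin_preimage_gen[OF cont]) auto
  then have "openin (subtopology M (fst c)) ?T"
    by (rule openin_continuous_map_preimage[OF homeomorphic_imp_continuous_map[OF homeomorphic[OF cA]]])
  then have T: "openin M ?T" using openin_open_subtopology[OF open_domain[OF cA]] by blast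
  have "p \<in> ?T" using p domain_subset[OF cA] nz by (auto simp: chart_image_def)
  moreover have "p \<in> M closure_of D" unfolding dense using p domain_subset[OF cA] by (rule subsetD[rotated])
  then have "\<forall>T. p \<in> T \<and> openin M T \<longrightarrow> (\<exists>q. q \<in> D \<and> q \<in> T)" by (simp add: in_closure_of)
  ultimately obtain q where "q \<in> D" "q \<in> ?T" using T by meson
  then show False using zero[of q] cA by (auto simp: charts_at_def)
qed

end

theorem theorem3p3:
  fixes M :: "'m topology" and A :: "'m chart set"
    and g :: "'m chart \<Rightarrow> mfield" and J :: "'m chart \<Rightarrow> mfield"
  assumes "almost_hermitian_4_manifold M A g J"
    and "M closure_of (M_plus M A g J) = topspace M"
  shows "kaehler M A g J \<longleftrightarrow>
    (\<forall>p\<in>topspace M. \<forall>c\<in>charts_at A p.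
       Wp_sqnorm (g c) (J c) (snd c p) =
         3/8 * (scal_star (g c) (J c) (snd c p) - scal (g c) (snd c p) / 3)^2) \<and>
    (\<forall>p\<in>M_plus M A g J. \<forall>c\<in>charts_at A p. \<forall>X.
       delta_Wp (g c) (J c) (snd c p) X
       + Wp_vec (g c) (J c) (snd c p)
           (grad (g c) (\<lambda>y. ln (Wp_norm (g c) (J c) y)) (snd c p)) X = 0)"
proof -
  interpret almost_hermitian_4_manifold M A g J by fact
  have chart: "c \<in> A" "snd c p \<in> chart_image c" if "c \<in> charts_at A p" for c p
    using that by (auto simp: charts_at_def chart_image_def)
  let ?cond = "\<lambda>c x. Wp_sqnorm (g c) (J c) x = 3/8 * (scal_star (g c) (J c) x - scal (g c) x / 3)^2"
  let ?div = "\<lambda>c x X. delta_Wp (g c) (J c) x X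
    + Wp_vec (g c) (J c) x (grad (g c) (\<lambda>y. ln (Wp_norm (g c) (J c) y)) x) X = 0"
  \<comment> \<open>\<open>Wp_nonzero\<close> holds in some chart \<open>d\<close>; by invariance \<open>lam\<close> is nonzero in the given chart \<open>c\<close> too.\<close>
  have parallel: "(\<forall>X. ?div c (snd c p) X) \<longleftrightarrow> (\<forall>u. nabla_end (g c) (J c) (snd c p) u = 0)"
    if cond: "\<And>d y. d \<in> A \<Longrightarrow> y \<in> chart_image d \<Longrightarrow> ?cond d y"
      and p: "p \<in> M_plus M A g J" and c: "c \<in> charts_at A p" for p c
  proof -
    obtain d where d: "d \<in> charts_at A p" "Wp_nonzero (g d) (J d) (snd d p)"
      using p by (auto simp: M_plus_def)
    have "hermitian_chart.lam (g d) (J d) (snd d p) \<noteq> 0"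
      using hermitian_chart.norm_condition_Wp_nonzero[OF hermitian_chart chart(2) cond, of d p] d chart[OF d(1)] by simp
    then have "hermitian_chart.lam (g c) (J c) (snd c p) \<noteq> 0"
      using lam_chart_independent[OF c d(1)] by simp
    from hermitian_chart.delta_condition_iff_parallel[OF hermitian_chart[OF chart(1)[OF c]] cond[OF chart(1)[OF c]] chart(2)[OF c] this]
    show ?thesis by blast
  qed
  show ?thesis
  proof
    assume K: "kaehler M A g J"
    have N: "nabla_end (g c) (J c) y u = 0" if "c \<in> A" "y \<in> chart_image c" for c y u
      using K chart_point[OF that] unfolding kaehler_def by metis
    have cond: "?cond c y" if "c \<in> A" "y \<in> chart_image c" for c y
      by (rule hermitian_chart.kaehler_norm_condition[OF hermitian_chart[OF that(1)] N[OF that(1)] that(2)])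
    show "(\<forall>p\<in>topspace M. \<forall>c\<in>charts_at A p. ?cond c (snd c p))
      \<and> (\<forall>p\<in>M_plus M A g J. \<forall>c\<in>charts_at A p. \<forall>X. ?div c (snd c p) X)"
    proof (intro conjI ballI)
      fix p c assume "p \<in> topspace M" "c \<in> charts_at A p"
      then show "?cond c (snd c p)" using cond chart by blast
    next
      fix p c assume "p \<in> M_plus M A g J" "c \<in> charts_at A p"
      then show "\<forall>X. ?div c (snd c p) X" using parallel[OF cond] N chart by blast
    qed
  next
    assume R: "(\<forall>p\<in>topspace M. \<forall>c\<in>charts_at A p. ?cond c (snd c p))
      \<and> (\<forall>p\<in>M_plus M A g J. \<forall>c\<in>charts_at A p. \<forall>X. ?div c (snd c p) X)"
    have cond: "?cond c y" if "c \<in> A" "y \<in> chart_image c" for c y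
      using chart_point[OF that] R by metis
    show "kaehler M A g J"
      unfolding kaehler_def
    proof (intro ballI allI)
      fix p c u assume c: "c \<in> charts_at A p"
      show "nabla_end (g c) (J c) (snd c p) u = 0"
      proof (rule dense_extension[OF assms(2) c])
        show "continuous_on (chart_image c) (\<lambda>x. nabla_end (g c) (J c) x u)"
          by (rule hermitian_chart.continuous_N[OF hermitian_chart[OF chart(1)[OF c]]])
        fix q assume "q \<in> M_plus M A g J" "c \<in> charts_at A q"
        then show "nabla_end (g c) (J c) (snd c q) u = 0" using parallel[OF cond] R by blast
      qed
    qed
  qed
qed

end
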